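(* Let $Q$ be the dP3 quiver with initial cluster $(x_0,\dots,x_5)$, and let $\tau_{a_1}\tau_{a_2}\tau_{a_3}\cdots$ (with $a_m\in\{1,2,3\}$) be any $\tau$-mutation sequence on $Q$. For each $n\ge 1$, let $y_n$ and $y_n'$ be the two cluster variables produced by the $n$-th step $\tau_{a_n}$. Then there is a finite induced subgraph $G$ of the dP3 brane tiling such that $$y_n = c(G) \quad\text{and}\quad y_n' = c(\sigma G).$$
   Context: The dP3 quiver $Q$ has vertices $0,1,\dots,5$ and the twelve arrows $3\to1,\ 1\to4,\ 4\to2,\ 2\to0,\ 0\to5,\ 5\to3,\ 3\to4,\ 4\to0,\ 0\to3,\ 1\to2,\ 2\to5,\ 5\to1$. Vertex $i$ carries the cluster variable $x_i$. Mutation $\mu_i$ at vertex $i$ follows the usual Fomin–Zelevinsky rules: for each path $j\to i\to k$ add an arrow $j\to k$, reverse all arrows at $i$, delete 2-cycles; the cluster variable at $i$ is replaced by $x_i'$ with $x_i'x_i=\prod_{i\to j}x_j+\prod_{j\to i}x_j$ (products over arrows, with multiplicity), all other variables unchanged. Define $\tau_1=\mu_0\circ\mu_1$, $\tau_2=\mu_2\circ\mu_3$, $\tau_3=\mu_4\circ\mu_5$ (the two vertices mutated by a $\tau_k$ are never joined by an arrow along such a sequence, so the two mutations commute). A $\tau$-mutation sequence $\tau_{a_1}\tau_{a_2}\cdots$ means applying $\tau_{a_1}$ first, then $\tau_{a_2}$, etc., starting from $(Q,(x_0,\dots,x_5))$. If $a_n=k$, $y_n$ denotes the new cluster variable produced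 at vertex $2k-2$ and $y_n'$ the new cluster variable produced at vertex $2k-1$ by the step $\tau_{a_n}$. The dP3 brane tiling is the doubly periodic bipartite planar graph obtained as the lift to the plane of the following bipartite graph on the torus: its faces are labeled $0,\dots,5$ (one per quiver vertex), its edges correspond to the twelve arrows (the edge of arrow $i\to j$ separates faces $i$ and $j$), and its vertices correspond to the terms of the superpotential $W=E_{31}E_{14}E_{42}E_{20}E_{05}E_{53}+E_{34}E_{40}E_{03}+E_{12}E_{25}E_{51}-E_{14}E_{40}E_{05}E_{51}-E_{34}E_{42}E_{25}E_{53}-E_{31}E_{12}E_{20}E_{03}$ ($E_{ij}$ the arrow $i\to j$): white vertices for positive terms and black vertices for negative terms, each vertex incident to the edges of the arrows in its term, in that cyclic order. Equivalently it is the planar dual of the unfolded (periodic) quiver. Every face is a quadrilateral. Each edge bordering faces labeled $i$ and $j$ has weight $\frac{1}{x_ix_j}$. For a finite subgraph $G$, $w(G)=\sum_M \prod_{e\in M} \mathrm{wt}(e)$, summing over perfect matchings $M$ of $G$; the covering monomial is $m(G)=\prod_{j=0}^5 x_j^{a_j}$ where $a_j$ is the number of faces labeled $j$ enclosed in or bordering $G$; and $c(G)=w(G)\,m(G)$. Let $\sigma=(01)(23)(45)$; it acts on the brane tiling as a $180^\circ$ rotation sending faces labeled $k$ to faces labeled $\sigma(k)$, and $\sigma G$ denotes the image of $G$ under this rotation. *)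

theory Defs
  imports Complex_Main "HOL-Library.Poly_Mapping" "HOL-Computational_Algebra.Fraction_Field"
begin

section \<open>The field of rational functions\<close>

text \<open>
  The field of fractions of the polynomial ring over the rationals in indeterminates
  indexed by the naturals.  Only the six indeterminates with index below \<open>6\<close> are ever used.
\<close>
type_synonym ratfun = "((nat \<Rightarrow>\<^sub>0 nat) \<Rightarrow>\<^sub>0 rat) fract"

definition var :: "nat \<Rightarrow> ratfun" where
  "var i = Fract (Poly_Mapping.single (Poly_Mapping.single i 1) 1) 1"

section \<open>Quivers, seeds and mutation\<close>

text \<open>\<open>q i j\<close> is the number of arrows \<open>i \<rightarrow> j\<close>; the vertices are \<open>0, \<dots>, 5\<close>.\<close>
type_synonym quiver = "nat \<Rightarrow> nat \<Rightarrow> nat"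
type_synonym seed = "quiver \<times> (nat \<Rightarrow> ratfun)"

definition dP3_arrows :: "(nat \<times> nat) set" where
  "dP3_arrows = {(3,1), (1,4), (4,2), (2,0), (0,5), (5,3), (3,4), (4,0), (0,3), (1,2), (2,5), (5,1)}"

definition dP3_quiver :: quiver where
  "dP3_quiver i j = (if (i, j) \<in> dP3_arrows then 1 else 0)"

definition add_paths :: "nat \<Rightarrow> quiver \<Rightarrow> quiver" where
  "add_paths k q = (\<lambda>i j. q i j + q i k * q k j)"

definition reverse_at :: "nat \<Rightarrow> quiver \<Rightarrow> quiver \<Rightarrow> quiver" where
  "reverse_at k q q' = (\<lambda>i j. if i = k \<or> j = k then q j i else q' i j)"

text \<open>Truncated subtraction on \<open>nat\<close> removes a maximal set of pairs of opposite arrows.\<close>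
definition delete_2cycles :: "quiver \<Rightarrow> quiver" where
  "delete_2cycles q = (\<lambda>i j. q i j - q j i)"

definition mutate_quiver :: "nat \<Rightarrow> quiver \<Rightarrow> quiver" where
  "mutate_quiver k q = delete_2cycles (reverse_at k q (add_paths k q))"

definition exchange :: "nat \<Rightarrow> seed \<Rightarrow> ratfun" where
  "exchange k s = (case s of (q, x) \<Rightarrow>
     ((\<Prod>j<6. x j ^ q k j) + (\<Prod>j<6. x j ^ q j k)) / x k)"

definition mutate :: "nat \<Rightarrow> seed \<Rightarrow> seed" where
  "mutate k s = (mutate_quiver k (fst s), (snd s)(k := exchange k s))"

text \<open>\<open>\<tau>\<^sub>1 = \<mu>\<^sub>0 \<circ> \<mu>\<^sub>1\<close>, \<open>\<tau>\<^sub>2 = \<mu>\<^sub>2 \<circ> \<mu>\<^sub>3\<close>, \<open>\<tau>\<^sub>3 = \<mu>\<^sub>4 \<circ> \<mu>\<^sub>5\<close>.\<close>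
definition tau :: "nat \<Rightarrow> seed \<Rightarrow> seed" where
  "tau k = mutate (2 * k - 2) \<circ> mutate (2 * k - 1)"

text \<open>The seed after the first \<open>n\<close> steps of \<open>\<tau>\<^bsub>a 1\<^esub> \<tau>\<^bsub>a 2\<^esub> \<dots>\<close>; the value \<open>a 0\<close> is not used.\<close>
primrec tau_seed :: "(nat \<Rightarrow> nat) \<Rightarrow> nat \<Rightarrow> seed" where
  "tau_seed a 0 = (dP3_quiver, var)"
| "tau_seed a (Suc n) = tau (a (Suc n)) (tau_seed a n)"

definition tau_y :: "(nat \<Rightarrow> nat) \<Rightarrow> nat \<Rightarrow> ratfun" where
  "tau_y a n = snd (tau_seed a n) (2 * a n - 2)"

definition tau_y' :: "(nat \<Rightarrow> nat) \<Rightarrow> nat \<Rightarrow> ratfun" where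
  "tau_y' a n = snd (tau_seed a n) (2 * a n - 1)"

section \<open>The dP3 brane tiling\<close>

text \<open>
  The tiling is drawn with straight edges in the plane, all vertices having integer coordinates
  with respect to two basis vectors that may be thought of as unit vectors at angle \<open>60\<close> degrees;
  it is then the tiling of the plane by kites (deltoidal trihexagonal tiling).  The period
  lattice is \<open>6\<int> \<times> 6\<int>\<close>.  White vertices are the lattice points (degree \<open>6\<close>) and their
  translates by \<open>(2, 2)\<close> and \<open>(-2, 4)\<close> (degree \<open>3\<close>); black vertices are the translates by
  \<open>(3, 0)\<close>, \<open>(0, 3)\<close>, \<open>(-3, 3)\<close> (degree \<open>4\<close>).
  The face \<open>(k, a, b)\<close> has label \<open>k\<close> and is the translate by \<open>(6 a, 6 b)\<close> of a kite with
  a corner at the origin; counterclockwise around the origin the labels are \<open>3, 1, 4, 2, 0, 5\<close>.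
  Lemma \<open>around_vertices\<close> below shows that the vertices correspond, modulo the period lattice, to
  the six terms of the superpotential
  \<open>E31 E14 E42 E20 E05 E53 + E34 E40 E03 + E12 E25 E51
    - E14 E40 E05 E51 - E34 E42 E25 E53 - E31 E12 E20 E03\<close>
  (in this order): each list of faces runs counterclockwise around the white and clockwise around
  the black vertices, and its cyclic sequence of labels is that of the corresponding term.
\<close>

type_synonym point = "int \<times> int"
type_synonym face = "nat \<times> int \<times> int"

definition kite :: "nat \<Rightarrow> point list" where
  "kite k =
    [[(0,0), (0,-3), (2,-4), (3,-3)],
     [(0,0), (0,3), (-2,4), (-3,3)],
     [(0,0), (-3,0), (-2,-2), (0,-3)],
     [(0,0), (3,0), (2,2), (0,3)],
     [(0,0), (-3,3), (-4,2), (-3,0)],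
     [(0,0), (3,-3), (4,-2), (3,0)]] ! k"

definition translate :: "int \<Rightarrow> int \<Rightarrow> point \<Rightarrow> point" where
  "translate a b p = (fst p + 6 * a, snd p + 6 * b)"

fun label :: "face \<Rightarrow> nat" where
  "label (k, a, b) = k"

fun corners :: "face \<Rightarrow> point list" where
  "corners (k, a, b) = map (translate a b) (kite k)"

definition faces :: "face set" where
  "faces = {0..<6} \<times> UNIV \<times> UNIV"

definition face_edges :: "face \<Rightarrow> point set set" where
  "face_edges f = {{corners f ! 0, corners f ! 1}, {corners f ! 1, corners f ! 2},
     {corners f ! 2, corners f ! 3}, {corners f ! 3, corners f ! 0}}"

definition tiling_edges :: "point set set" where
  "tiling_edges = (\<Union>f\<in>faces. face_edges f)"

definition tiling_vertices :: "point set" where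
  "tiling_vertices = (\<Union>f\<in>faces. set (corners f))"

text \<open>
  \<open>cyclically_around v fs\<close>: the list \<open>fs\<close> enumerates all faces at the vertex \<open>v\<close>,
  cyclically consecutive ones \<open>f\<close>, \<open>g\<close> share an edge at \<open>v\<close>, and there is an arrow
  from the label of \<open>f\<close> to the label of \<open>g\<close>.
\<close>
definition cyclically_around :: "point \<Rightarrow> face list \<Rightarrow> bool" where
  "cyclically_around v fs \<longleftrightarrow> distinct fs \<and> set fs = {f \<in> faces. v \<in> set (corners f)} \<and>
     (\<forall>(f, g) \<in> set (zip fs (rotate1 fs)).
        (\<exists>e \<in> face_edges f \<inter> face_edges g. v \<in> e) \<and> (label f, label g) \<in> dP3_arrows)"

definition rot :: "point \<Rightarrow> point" where
  "rot p = (- fst p, - snd p)"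

definition sigma :: "nat \<Rightarrow> nat" where
  "sigma k = [1, 0, 3, 2, 5, 4] ! k"

section \<open>Subgraphs, weights and covering monomials\<close>

text \<open>
  An induced subgraph is given by its vertex set \<open>S\<close>; the rotated subgraph has vertex set \<open>rot ` S\<close>.
\<close>

definition induced_edges :: "point set \<Rightarrow> point set set" where
  "induced_edges S = {e \<in> tiling_edges. e \<subseteq> S}"

definition perfect_matchings :: "point set \<Rightarrow> point set set set" where
  "perfect_matchings S = {M. M \<subseteq> induced_edges S \<and> (\<forall>v\<in>S. \<exists>!e. e \<in> M \<and> v \<in> e)}"

definition edge_weight :: "point set \<Rightarrow> ratfun" where
  "edge_weight e = 1 / (\<Prod>f | f \<in> faces \<and> e \<in> face_edges f. var (label f))"

definition graph_weight :: "point set \<Rightarrow> ratfun" where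
  "graph_weight S = (\<Sum>M\<in>perfect_matchings S. \<Prod>e\<in>M. edge_weight e)"

definition borders :: "face \<Rightarrow> point set \<Rightarrow> bool" where
  "borders f S \<longleftrightarrow> face_edges f \<inter> induced_edges S \<noteq> {}"

text \<open>
  A face is enclosed in the subgraph if it lies in a bounded component of the complement of
  the subgraph in the plane, i.e. if only finitely many faces can be reached from it
  by crossing edges of the tiling that do not belong to the subgraph.
\<close>
definition crossing :: "point set \<Rightarrow> (face \<times> face) set" where
  "crossing S = {(f, g). f \<in> faces \<and> g \<in> faces \<and>
     (\<exists>e \<in> face_edges f \<inter> face_edges g. e \<notin> induced_edges S)}"

definition enclosed :: "face \<Rightarrow> point set \<Rightarrow> bool" where
  "enclosed f S \<longleftrightarrow> finite {g. (f, g) \<in> (crossing S)\<^sup>*}"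

definition covering_exponent :: "point set \<Rightarrow> nat \<Rightarrow> nat" where
  "covering_exponent S j = card {f \<in> faces. label f = j \<and> (enclosed f S \<or> borders f S)}"

definition covering_monomial :: "point set \<Rightarrow> ratfun" where
  "covering_monomial S = (\<Prod>j<6. var j ^ covering_exponent S j)"

definition graph_c :: "point set \<Rightarrow> ratfun" where
  "graph_c S = graph_weight S * covering_monomial S"

section \<open>Consistency of the drawing with the superpotential\<close>

lemma less_6_cases: "k < 6 \<longleftrightarrow> k = 0 \<or> k = 1 \<or> k = 2 \<or> k = 3 \<or> k = 4 \<or> k = (5::nat)"
  by auto

lemma nth_kite:
  "kite 0 = [(0,0), (0,-3), (2,-4), (3,-3)]"
  "kite (Suc 0) = [(0,0), (0,3), (-2,4), (-3,3)]"
  "kite 2 = [(0,0), (-3,0), (-2,-2), (0,-3)]"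
  "kite 3 = [(0,0), (3,0), (2,2), (0,3)]"
  "kite 4 = [(0,0), (-3,3), (-4,2), (-3,0)]"
  "kite 5 = [(0,0), (3,-3), (4,-2), (3,0)]"
  by (simp_all add: kite_def)

lemma mod6: "p + 6 * c = q + 6 * d \<longleftrightarrow> (p - q) mod 6 = 0 \<and> d = c + (p - q) div 6"
  for p q c d :: int
proof
  assume "p + 6 * c = q + 6 * d"
  then have "p - q = 6 * (d - c)" by simp
  then show "(p - q) mod 6 = 0 \<and> d = c + (p - q) div 6" by simp
next
  assume *: "(p - q) mod 6 = 0 \<and> d = c + (p - q) div 6"
  have "p - q = 6 * ((p - q) div 6) + (p - q) mod 6" by simp
  with * show "p + 6 * c = q + 6 * d" by linarith
qed

lemma translate_eq_iff:
  "translate a b (x, y) = translate a' b' (x', y') \<longleftrightarrow>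
     (x - x') mod 6 = 0 \<and> (y - y') mod 6 = 0 \<and> a' = a + (x - x') div 6 \<and> b' = b + (y - y') div 6"
  unfolding translate_def prod.inject fst_conv snd_conv mod6 by blast

lemma faces_at:
  "{f \<in> faces. translate a b (x, y) \<in> set (corners f)} =
     (\<Union>k\<in>{0,1,2,3,4,5}. \<Union>(x', y')\<in>set (kite k).
        if (x - x') mod 6 = 0 \<and> (y - y') mod 6 = 0
        then {(k, a + (x - x') div 6, b + (y - y') div 6)} else {})" (is "?L = ?R")
proof (rule set_eqI)
  fix f :: face
  obtain k a' b' where f: "f = (k, a', b')" by (cases f)
  have "f \<in> ?L \<longleftrightarrow> k \<in> {0,1,2,3,4,5} \<and> (\<exists>p\<in>set (kite k). translate a b (x, y) = translate a' b' p)"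
    unfolding f mem_Collect_eq faces_def corners.simps by (simp add: less_6_cases image_iff disj_ac)
  also have "\<dots> \<longleftrightarrow> f \<in> ?R"
    unfolding f by (simp add: translate_eq_iff split_beta Bex_def cong: conj_cong; blast)
  finally show "f \<in> ?L \<longleftrightarrow> f \<in> ?R" .
qed

lemma shared_edge_iff:
  "(\<exists>e\<in>face_edges f \<inter> face_edges g. v \<in> e) \<longleftrightarrow> (\<exists>e\<in>face_edges f. v \<in> e \<and> e \<in> face_edges g)"
  by blast

lemma around_vertices:
  "cyclically_around (translate a b (0, 0))
     [(3, a, b), (1, a, b), (4, a, b), (2, a, b), (0, a, b), (5, a, b)]"
  "cyclically_around (translate a b (2, 2)) [(3, a, b), (4, a + 1, b), (0, a, b + 1)]"
  "cyclically_around (translate a b (-2, 4)) [(1, a, b), (2, a, b + 1), (5, a - 1, b + 1)]"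
  "cyclically_around (translate a b (-3, 3))
     [(1, a, b), (4, a, b), (0, a - 1, b + 1), (5, a - 1, b + 1)]"
  "cyclically_around (translate a b (3, 0))
     [(3, a, b), (4, a + 1, b), (2, a + 1, b), (5, a, b)]"
  "cyclically_around (translate a b (0, 3))
     [(3, a, b), (1, a, b), (2, a, b + 1), (0, a, b + 1)]"
  unfolding cyclically_around_def faces_at
  apply (simp_all add: nth_kite)
  apply (intro conjI)
  apply ((simp add: dP3_arrows_def; fail)
    | (simp add: shared_edge_iff face_edges_def nth_kite translate_eq_iff doubleton_eq_iff; fail)
    | (rule subset_antisym; simp; fail) | (intro conjI))+
  done

lemma tiling_vertices_eq:
  "tiling_vertices =
     {translate a b p | a b p. p \<in> {(0, 0), (2, 2), (-2, 4), (-3, 3), (3, 0), (0, 3)}}"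
    (is "_ = {translate a b p | a b p. p \<in> ?P}")
proof (intro subset_antisym subsetI)
  fix v assume "v \<in> tiling_vertices"
  then obtain k a b p where k: "k < 6" and p: "p \<in> set (kite k)" and v: "v = translate a b p"
    by (auto simp: tiling_vertices_def faces_def)
  have "\<exists>c d. \<exists>q\<in>?P. p = translate c d q"
  proof -
    have "p \<in> ?P \<or> p \<in> translate 0 (-1) ` ?P \<or> p \<in> translate (-1) 0 ` ?P \<or>
        p \<in> translate 1 (-1) ` ?P"
      using k p unfolding less_6_cases by (elim disjE; simp add: nth_kite translate_def; elim disjE; simp)
    moreover have "p = translate 0 0 p" by (simp add: translate_def)
    ultimately show ?thesis by blast
  qed
  then obtain c d q where "q \<in> ?P" "p = translate c d q" by blast
  moreover from this have "v = translate (a + c) (b + d) q"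
    by (simp add: v translate_def)
  ultimately show "v \<in> {translate a b p | a b p. p \<in> ?P}" by blast
next
  fix v assume "v \<in> {translate a b p | a b p. p \<in> ?P}"
  then obtain a b p where p: "p \<in> ?P" and v: "v = translate a b p" by blast
  from p have "p \<in> set (kite 3) \<or> p \<in> set (kite 1)"
    by (simp add: nth_kite) (elim disjE; simp)
  then have "v \<in> set (corners (3, a, b)) \<or> v \<in> set (corners (1, a, b))"
    by (auto simp: v)
  moreover have "(3, a, b) \<in> faces" "(1, a, b) \<in> faces" by (simp_all add: faces_def)
  ultimately show "v \<in> tiling_vertices" unfolding tiling_vertices_def by blast
qed

lemma rot_corners:
  assumes "k < 6"
  shows "map rot (corners (k, a, b)) = corners (sigma k, - a, - b)"
  using assms unfolding less_6_cases
  by (elim disjE; simp add: rot_def sigma_def nth_kite translate_def)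
end

theory Submission
  imports Defs
begin

text \<open>
  Every seed of a \<open>\<tau>\<close>-mutation sequence is attached to a unit triangle of the triangular lattice: the
  two variables of a pair are \<open>x\<^sub>i\<close> and \<open>x\<^sub>i'\<close> times a common monomial in the three ratios
  \<open>(x\<^sub>2 x\<^sub>4 + x\<^sub>3 x\<^sub>5) / (x\<^sub>0 x\<^sub>1)\<close>, \<dots>, whose exponents are integer parts of \<open>N / 3\<close> with \<open>N\<close> the
  quadratic form \<open>x\<^sup>2 + x y + y\<^sup>2\<close> at the corner of the triangle, and \<open>\<tau>\<^sub>k\<close> reflects one corner in the
  opposite side.  It thus suffices to find, for each lattice point, a subgraph with the prescribed
  value.  Up to the sixfold rotation of the tiling these are two families of regions bounded by
  hexagonal contours (the castles of Lai and Musiker) and one path with four vertices.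

  The values are computed by induction.  Urban renewal at all faces labelled \<open>0\<close> and \<open>1\<close> at once turns
  the tiling into a sheared copy of itself and a region into another one of the family, while the
  variables \<open>x\<^sub>0, x\<^sub>1\<close> are replaced by their mutations.  After a rotation this step decreases the size of
  the region; the recursion ends at a single edge.  For the covering monomials one has to know that
  no face off the border is enclosed: each of them is joined to infinity by crossing absent edges.
\<close>

section \<open>Matchings of the tiling in lattice coordinates\<close>

text \<open>The sixth turn of the tiling acts on lattice points as a third of a turn about the
  initial triangle. Its cube, the half turn, therefore fixes every lattice point and only exchanges
  the two labels of a pair: one region, turned or not, serves both variables of a step. Urban
  renewal is not a bijection of matchings, since a square covered by a pair admits two pairs while
  the renewed square is then uncovered. Only matchings with one preferred pair are kept; the others
  are absorbed into a factor per pair, after which renewal is an involution. A region can be renewed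
  only if its boundary fits the squares that are renewed; removing forced edges brings it into that
  form, which is why cores appear beside the regions. Because a renewal step changes the variables,
  values are computed for arbitrary nondegenerate weights in a field, and the indeterminates are
  substituted only at the end. The first family, continued to its smallest member, yields an edge
  whose value is \<open>1\<close> instead of a variable; this is the reason for the exceptional
  path.\<close>

text \<open>
  \<open>Ov, Wv, Xv\<close> are the white vertices at \<open>(0,0), (2,2), (-2,4)\<close>, and \<open>Hv, Sv, Tv\<close> the black ones at
  \<open>(3,0), (0,3), (-3,3)\<close>, each translated by \<open>(6 a, 6 b)\<close>.
\<close>
datatype vtx_kind = Ov | Hv | Sv | Tv | Wv | Xv
datatype arrow = E31 | E12 | E51 | E14 | E20 | E03 | E40 | E05 | E53 | E42 | E34 | E25
type_synonym vtx = "vtx_kind \<times> int \<times> int"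
type_synonym edg = "arrow \<times> int \<times> int"

text \<open>
  Edges are named after their arrow and indexed by the face labelled \<open>1\<close> or \<open>0\<close> on their border;
  the other four are indexed by a vertex \<open>Ov\<close> or \<open>Hv\<close>.
\<close>

fun white :: "edg \<Rightarrow> vtx" where
  "white (E31, a, b) = (Ov, a, b)"
| "white (E12, a, b) = (Xv, a, b)"
| "white (E51, a, b) = (Xv, a, b)"
| "white (E14, a, b) = (Ov, a, b)"
| "white (E20, a, b) = (Ov, a, b)"
| "white (E03, a, b) = (Wv, a, b - 1)"
| "white (E40, a, b) = (Wv, a, b - 1)"
| "white (E05, a, b) = (Ov, a, b)"
| "white (E53, a, b) = (Ov, a, b)"
| "white (E42, a, b) = (Ov, a, b)"
| "white (E34, a, b) = (Wv, a, b)"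
| "white (E25, a, b) = (Xv, a + 1, b - 1)"

fun black :: "edg \<Rightarrow> vtx" where
  "black (E31, a, b) = (Sv, a, b)"
| "black (E12, a, b) = (Sv, a, b)"
| "black (E51, a, b) = (Tv, a, b)"
| "black (E14, a, b) = (Tv, a, b)"
| "black (E20, a, b) = (Sv, a, b - 1)"
| "black (E03, a, b) = (Sv, a, b - 1)"
| "black (E40, a, b) = (Tv, a + 1, b - 1)"
| "black (E05, a, b) = (Tv, a + 1, b - 1)"
| "black (E53, a, b) = (Hv, a, b)"
| "black (E42, a, b) = (Hv, a - 1, b)"
| "black (E34, a, b) = (Hv, a, b)"
| "black (E25, a, b) = (Hv, a, b)"

fun incident :: "vtx \<Rightarrow> edg list" where
  "incident (Ov, a, b) = [(E31, a, b), (E14, a, b), (E20, a, b), (E05, a, b), (E53, a, b), (E42, a, b)]"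
| "incident (Hv, a, b) = [(E53, a, b), (E42, a + 1, b), (E34, a, b), (E25, a, b)]"
| "incident (Sv, a, b) = [(E31, a, b), (E12, a, b), (E20, a, b + 1), (E03, a, b + 1)]"
| "incident (Tv, a, b) = [(E51, a, b), (E14, a, b), (E40, a - 1, b + 1), (E05, a - 1, b + 1)]"
| "incident (Wv, a, b) = [(E03, a, b + 1), (E40, a, b + 1), (E34, a, b)]"
| "incident (Xv, a, b) = [(E12, a, b), (E51, a, b), (E25, a - 1, b + 1)]"

lemma in_incident: "white e = v \<or> black e = v \<longleftrightarrow> e \<in> set (incident v)"
  by (cases v rule: incident.cases; cases e rule: white.cases; simp; linarith)

lemma distinct_incident: "distinct (incident v)"
  by (cases v rule: incident.cases) auto

text \<open>Turns the unique-existence condition at a vertex into a propositional formula over the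
  edges listed by \<open>incident\<close>, so that local claims about shuffling become finite
  Boolean problems.\<close>

fun one_of :: "bool list \<Rightarrow> bool" where
  "one_of [] = False"
| "one_of (p # ps) = (if p then list_all Not ps else one_of ps)"

lemma one_of_iff: "distinct es \<Longrightarrow> one_of (map (\<lambda>e. e \<in> M) es) \<longleftrightarrow> (\<exists>!e. e \<in> M \<and> e \<in> set es)"
proof (induction es)
  case (Cons x es)
  have "list_all Not (map (\<lambda>e. e \<in> M) es) \<longleftrightarrow> (\<forall>e\<in>set es. e \<notin> M)"
    by (auto simp: list_all_iff)
  with Cons show ?case by (cases "x \<in> M") auto
qed auto

definition edges_in :: "vtx set \<Rightarrow> edg set" where
  "edges_in V = {e. white e \<in> V \<and> black e \<in> V}"

definition matchings :: "vtx set \<Rightarrow> edg set set" where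
  "matchings V = {M. M \<subseteq> edges_in V \<and> (\<forall>v\<in>V. \<exists>!e. e \<in> M \<and> (white e = v \<or> black e = v))}"

lemma matchings_iff:
  "M \<in> matchings V \<longleftrightarrow> M \<subseteq> edges_in V \<and> (\<forall>v\<in>V. one_of (map (\<lambda>e. e \<in> M) (incident v)))"
  by (simp add: matchings_def in_incident one_of_iff distinct_incident)

lemma edges_in_subset: "edges_in V \<subseteq> (\<Union>v\<in>V. set (incident v))"
  by (auto simp: edges_in_def in_incident[symmetric])

lemma finite_edges_in: "finite V \<Longrightarrow> finite (edges_in V)"
  by (rule finite_subset[OF edges_in_subset]) auto

lemma finite_matchings: "finite V \<Longrightarrow> finite (matchings V)"
  by (rule finite_subset[of _ "Pow (edges_in V)"]) (auto simp: matchings_def finite_edges_in)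


section \<open>Shuffling\<close>

text \<open>
  The vertex \<open>(Xv, a, b)\<close> lies at the face \<open>(1, a, b)\<close> and \<open>(Wv, a, b - 1)\<close> at the face \<open>(0, a, b)\<close>;
  their presence in \<open>G\<close> marks the faces at which urban renewal takes place.  The new tiling is
  identified with the old one by the shear \<open>(a, b) \<mapsto> (- a - b, b)\<close>, which swaps the labels \<open>0\<close> and \<open>1\<close>.
\<close>

definition uncovered1 where "uncovered1 G M a b \<longleftrightarrow> (Xv, a, b) \<in> G \<and> (E31, a, b) \<notin> M \<and> (E12, a, b) \<notin> M \<and> (E51, a, b) \<notin> M \<and> (E14, a, b) \<notin> M"
definition uncovered0 where "uncovered0 G M a b \<longleftrightarrow> (Wv, a, b - 1) \<in> G \<and> (E20, a, b) \<notin> M \<and> (E03, a, b) \<notin> M \<and> (E40, a, b) \<notin> M \<and> (E05, a, b) \<notin> M"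

text \<open>
  A single edge of a renewed square goes to the opposite edge, a full pair disappears, and an
  uncovered square receives the pair \<open>E31, E51\<close> (or \<open>E03, E05\<close>).  This is a bijection between the
  matchings that contain no pair \<open>E12, E14\<close> (or \<open>E20, E40\<close>).
\<close>
fun shuffle_mem :: "vtx set \<Rightarrow> edg set \<Rightarrow> edg \<Rightarrow> bool" where
  "shuffle_mem G M (E05, a, b) = ((E31, 1 - a - b, b - 1) \<in> M \<and> (E51, 1 - a - b, b - 1) \<notin> M \<or> uncovered1 G M (1 - a - b) (b - 1))"
| "shuffle_mem G M (E03, a, b) = ((E51, 1 - a - b, b - 1) \<in> M \<and> (E31, 1 - a - b, b - 1) \<notin> M \<or> uncovered1 G M (1 - a - b) (b - 1))"
| "shuffle_mem G M (E40, a, b) = ((E12, 1 - a - b, b - 1) \<in> M)"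
| "shuffle_mem G M (E20, a, b) = ((E14, 1 - a - b, b - 1) \<in> M)"
| "shuffle_mem G M (E14, a, b) = ((E20, - a - b, b + 1) \<in> M)"
| "shuffle_mem G M (E12, a, b) = ((E40, - a - b, b + 1) \<in> M)"
| "shuffle_mem G M (E51, a, b) = ((E03, - a - b, b + 1) \<in> M \<and> (E05, - a - b, b + 1) \<notin> M \<or> uncovered0 G M (- a - b) (b + 1))"
| "shuffle_mem G M (E31, a, b) = ((E05, - a - b, b + 1) \<in> M \<and> (E03, - a - b, b + 1) \<notin> M \<or> uncovered0 G M (- a - b) (b + 1))"
| "shuffle_mem G M (E53, a, b) = ((E53, - a - b, b) \<in> M)"
| "shuffle_mem G M (E42, a, b) = ((E42, 1 - a - b, b) \<in> M)"
| "shuffle_mem G M (E34, a, b) = ((E31, - a - b, b) \<in> M \<or> (E14, - a - b, b) \<in> M)"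
| "shuffle_mem G M (E25, a, b) = ((E20, - a - b, b) \<in> M \<or> (E05, - a - b, b) \<in> M)"

definition shuffle :: "vtx set \<Rightarrow> edg set \<Rightarrow> edg set" where
  "shuffle G M = {e. shuffle_mem G M e}"

definition reduced_matchings :: "vtx set \<Rightarrow> edg set set" where
  "reduced_matchings V = {M \<in> matchings V. (\<forall>a b. \<not> ((E12, a, b) \<in> M \<and> (E14, a, b) \<in> M)) \<and> (\<forall>a b. \<not> ((E20, a, b) \<in> M \<and> (E40, a, b) \<in> M))}"

text \<open>No edge of \<open>G\<close> lies on a face labelled \<open>1\<close> or \<open>0\<close> that is not renewed.\<close>
definition dead_ok :: "vtx set \<Rightarrow> bool" where
  "dead_ok G \<longleftrightarrow> (\<forall>a b. (Xv, a, b) \<notin> G \<longrightarrow> \<not> ((Ov, a, b) \<in> G \<and> ((Sv, a, b) \<in> G \<or> (Tv, a, b) \<in> G))) \<and>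
     (\<forall>a b. (Wv, a, b - 1) \<notin> G \<longrightarrow> \<not> ((Ov, a, b) \<in> G \<and> ((Sv, a, b - 1) \<in> G \<or> (Tv, a + 1, b - 1) \<in> G)))"

text \<open>
  A black vertex \<open>p\<close> between two squares \<open>f, g\<close> is split by urban renewal: it survives as \<open>q\<close> if both
  squares are renewed, and turns from present to absent or vice versa if exactly one is.
\<close>
definition compat :: "bool \<Rightarrow> bool \<Rightarrow> bool \<Rightarrow> bool \<Rightarrow> bool" where
  "compat f g p q \<longleftrightarrow> (if f \<and> g then p \<and> q else if f \<or> g then p \<noteq> q else \<not> p \<and> \<not> q)"

text \<open>Renewal exchanges the colours. At \<open>Ov\<close> the four edges on squares give way
  to two legs, so it becomes an \<open>Hv\<close>; an \<open>Hv\<close> absorbs the contracted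
  \<open>Wv\<close> and \<open>Xv\<close> next to it and becomes an \<open>Ov\<close>; the inner
  corner facing \<open>Ov\<close> in a renewed square becomes a new \<open>Wv\<close> or
  \<open>Xv\<close>.\<close>

definition shuffle_rel :: "vtx set \<Rightarrow> vtx set \<Rightarrow> bool" where
  "shuffle_rel G G' \<longleftrightarrow>
    (\<forall>a b. ((Wv, a, b) \<in> G \<longleftrightarrow> (Xv, - a - b, b) \<in> G') \<and> ((Xv, a, b) \<in> G \<longleftrightarrow> (Wv, - a - b, b) \<in> G') \<and>
       ((Ov, a, b) \<in> G \<longleftrightarrow> (Hv, - a - b, b) \<in> G') \<and> ((Hv, a, b) \<in> G \<longleftrightarrow> (Ov, - a - b, b) \<in> G') \<and>
       compat ((Xv, a, b) \<in> G) ((Wv, a, b) \<in> G) ((Sv, a, b) \<in> G) ((Sv, - a - b, b) \<in> G') \<and>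
       compat ((Xv, a, b) \<in> G) ((Wv, a - 1, b) \<in> G) ((Tv, a, b) \<in> G) ((Tv, 1 - a - b, b) \<in> G')) \<and>
     dead_ok G \<and> dead_ok G'"

lemma compat_cong: "compat f g p q \<Longrightarrow> compat g f q p"
  by (auto simp: compat_def split: if_splits)

lemma shuffle_rel_sym:
  assumes "shuffle_rel G G'" shows "shuffle_rel G' G"
proof -
  note A = assms[unfolded shuffle_rel_def, THEN conjunct1, rule_format]
  have 1: "(Wv, a, b) \<in> G' \<longleftrightarrow> (Xv, - a - b, b) \<in> G" "(Xv, a, b) \<in> G' \<longleftrightarrow> (Wv, - a - b, b) \<in> G"
     "(Ov, a, b) \<in> G' \<longleftrightarrow> (Hv, - a - b, b) \<in> G" "(Hv, a, b) \<in> G' \<longleftrightarrow> (Ov, - a - b, b) \<in> G" for a b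
    using A[of "- a - b" b] by simp_all
  have 2: "compat ((Xv, a, b) \<in> G') ((Wv, a, b) \<in> G') ((Sv, a, b) \<in> G') ((Sv, - a - b, b) \<in> G)" for a b
    using A[of "- a - b" b] by (simp add: 1) (metis compat_cong)
  have 3: "compat ((Xv, a, b) \<in> G') ((Wv, a - 1, b) \<in> G') ((Tv, a, b) \<in> G') ((Tv, 1 - a - b, b) \<in> G)" for a b
    using A[of "1 - a - b" b] by (simp add: 1 algebra_simps) (metis compat_cong)
  show ?thesis using assms 1 2 3 unfolding shuffle_rel_def by blast
qed

lemma pm_at:
  assumes "M \<in> matchings G"
  shows "if v \<in> G then one_of (map (\<lambda>e. e \<in> M) (incident v)) else list_all (\<lambda>e. e \<notin> M) (incident v)"
proof (cases "v \<in> G")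
  case True then show ?thesis using assms by (simp add: matchings_iff)
next
  case False
  have "e \<notin> M" if "e \<in> set (incident v)" for e
    using assms False that unfolding matchings_iff edges_in_def in_incident[symmetric] by auto
  then show ?thesis using False by (auto simp: list_all_iff)
qed

lemma pm_ends: "M \<in> matchings G \<Longrightarrow> e \<in> M \<Longrightarrow> white e \<in> G \<and> black e \<in> G"
  by (auto simp: matchings_def edges_in_def)

text \<open>Leaves six states of a square: no edge, one of its four edges, or the pair
  \<open>E31, E51\<close>. Adjacent edges clash at their common vertex, the other pair is excluded
  by reducedness, and a square that is not renewed carries no edge by
  \<open>dead_ok\<close>.\<close>

lemma sq1_state:
  assumes "M \<in> reduced_matchings G" "dead_ok G"
  shows "\<not> ((E31, a, b) \<in> M \<and> (E12, a, b) \<in> M) \<and> \<not> ((E12, a, b) \<in> M \<and> (E51, a, b) \<in> M) \<and>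
    \<not> ((E51, a, b) \<in> M \<and> (E14, a, b) \<in> M) \<and> \<not> ((E31, a, b) \<in> M \<and> (E14, a, b) \<in> M) \<and>
    \<not> ((E12, a, b) \<in> M \<and> (E14, a, b) \<in> M) \<and>
    ((Xv, a, b) \<notin> G \<longrightarrow> (E31, a, b) \<notin> M \<and> (E12, a, b) \<notin> M \<and> (E51, a, b) \<notin> M \<and> (E14, a, b) \<notin> M)"
proof -
  have M: "M \<in> matchings G" using assms by (simp add: reduced_matchings_def)
  have "(Xv, a, b) \<notin> G \<longrightarrow> (E31, a, b) \<notin> M \<and> (E12, a, b) \<notin> M \<and> (E51, a, b) \<notin> M \<and> (E14, a, b) \<notin> M"
    using pm_ends[OF M, of "(E31, a, b)"] pm_ends[OF M, of "(E12, a, b)"] pm_ends[OF M, of "(E51, a, b)"]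
      pm_ends[OF M, of "(E14, a, b)"] assms(2) unfolding dead_ok_def by auto
  moreover have "\<not> ((E12, a, b) \<in> M \<and> (E14, a, b) \<in> M)" using assms by (simp add: reduced_matchings_def)
  ultimately show ?thesis
    using pm_at[OF M, of "(Ov, a, b)"] pm_at[OF M, of "(Sv, a, b)"] pm_at[OF M, of "(Tv, a, b)"]
      pm_at[OF M, of "(Xv, a, b)"] by (simp split: if_splits)
qed

lemma sq0_state:
  assumes "M \<in> reduced_matchings G" "dead_ok G"
  shows "\<not> ((E20, a, b) \<in> M \<and> (E03, a, b) \<in> M) \<and> \<not> ((E03, a, b) \<in> M \<and> (E40, a, b) \<in> M) \<and>
    \<not> ((E40, a, b) \<in> M \<and> (E05, a, b) \<in> M) \<and> \<not> ((E20, a, b) \<in> M \<and> (E05, a, b) \<in> M) \<and>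
    \<not> ((E20, a, b) \<in> M \<and> (E40, a, b) \<in> M) \<and>
    ((Wv, a, b - 1) \<notin> G \<longrightarrow> (E20, a, b) \<notin> M \<and> (E03, a, b) \<notin> M \<and> (E40, a, b) \<notin> M \<and> (E05, a, b) \<notin> M)"
proof -
  have M: "M \<in> matchings G" using assms by (simp add: reduced_matchings_def)
  have "(Wv, a, b - 1) \<notin> G \<longrightarrow> (E20, a, b) \<notin> M \<and> (E03, a, b) \<notin> M \<and> (E40, a, b) \<notin> M \<and> (E05, a, b) \<notin> M"
    using pm_ends[OF M, of "(E20, a, b)"] pm_ends[OF M, of "(E03, a, b)"] pm_ends[OF M, of "(E40, a, b)"]
      pm_ends[OF M, of "(E05, a, b)"] assms(2) unfolding dead_ok_def by auto
  moreover have "\<not> ((E20, a, b) \<in> M \<and> (E40, a, b) \<in> M)" using assms by (simp add: reduced_matchings_def)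
  ultimately show ?thesis
    using pm_at[OF M, of "(Ov, a, b)"] pm_at[OF M, of "(Sv, a, b - 1)"] pm_at[OF M, of "(Tv, a + 1, b - 1)"]
      pm_at[OF M, of "(Wv, a, b - 1)"] by (simp split: if_splits)
qed

lemma mem_shuffle: "e \<in> shuffle G M \<longleftrightarrow> shuffle_mem G M e"
  by (simp add: shuffle_def)

lemma list_all_rec: "list_all P [] = True" "list_all P (x # xs) = (P x \<and> list_all P xs)" by simp_all
lemmas one_of_unfold = incident.simps list.map one_of.simps list_all_rec simp_thms

text \<open>The edges of the new matching at a vertex depend on boundedly many old edges, so for
  each kind of vertex the claim is a finite propositional problem. The facts collected in each case
  are the states of the old squares and vertices where these edges lie.\<close>

lemma shuffle_vertex:
  assumes M: "M \<in> reduced_matchings G" and R: "shuffle_rel G G'" and v: "(k, A, b) \<in> G'"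
  shows "one_of (map (\<lambda>e. e \<in> shuffle G M) (incident (k, A, b)))"
proof -
  have M': "M \<in> matchings G" using M by (simp add: reduced_matchings_def)
  have d: "dead_ok G" using R by (simp add: shuffle_rel_def)
  note r = R[unfolded shuffle_rel_def compat_def if_bool_eq_conj, THEN conjunct1, rule_format]
  note q1 = sq1_state[OF M d] and q0 = sq0_state[OF M d]
    and p = pm_at[OF M', unfolded if_bool_eq_conj]
   have ?thesis if k: "k = Ov"
  proof -
    define a where "a = - A - b"
    have A: "A = - a - b" by (simp add: a_def)
    \<comment> \<open>Normalises the sheared indices, so that equal edges become syntactically equal
      atoms for the solver; likewise in the other cases.\<close>
    have ix: "1 - A - b = a + 1" "- A - b = a" "- (a + 1) - b = A - 1" "1 - a - b = A + 1" "- a - b = A" "b + 1 - 1 = b" "1 + a = a + 1" "a + 1 - 1 = a" "b - 1 + 1 = b"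
      by (simp_all add: A)
    note r[of a b] q1[of "a + 1" "b - 1"] q0[of a "b + 1"] p[of "(Hv, a, b)"] p[of "(Wv, a, b)"] p[of "(Xv, a + 1, b - 1)"]
    note * = this[unfolded one_of_unfold if_bool_eq_conj ix]
    show ?thesis using v[unfolded k A] * 
      unfolding k one_of_unfold mem_shuffle shuffle_mem.simps uncovered0_def uncovered1_def ix if_bool_eq_conj A[symmetric] by (smt (verit))
  qed
  moreover have ?thesis if k: "k = Hv"
  proof -
    define a where "a = - A - b"
    have A: "A = - a - b" by (simp add: a_def)
    have ix: "1 - (A + 1) - b = a" "- A - b = a" "1 - a - b = A + 1" "- a - b = A"
      by (simp_all add: A)
    note r[of a b] q1[of a b] q0[of a b] p[of "(Ov, a, b)"]
    note * = this[unfolded one_of_unfold if_bool_eq_conj ix]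
    show ?thesis using v[unfolded k A] * 
      unfolding k one_of_unfold mem_shuffle shuffle_mem.simps uncovered0_def uncovered1_def ix if_bool_eq_conj A[symmetric] by (smt (verit))
  qed
  moreover have ?thesis if k: "k = Sv"
  proof -
    define a where "a = - A - b"
    have A: "A = - a - b" by (simp add: a_def)
    have ix: "1 - A - (b + 1) = a" "- A - b = a" "1 - a - b = A + 1" "- a - b = A" "b + 1 - 1 = b"
      by (simp_all add: A)
    note r[of a b] q1[of a b] q0[of a "b + 1"] p[of "(Sv, a, b)"]
    note * = this[unfolded one_of_unfold if_bool_eq_conj ix]
    show ?thesis using v[unfolded k A] * 
      unfolding k one_of_unfold mem_shuffle shuffle_mem.simps uncovered0_def uncovered1_def ix if_bool_eq_conj A[symmetric] by (smt (verit))
  qed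
  moreover have ?thesis if k: "k = Tv"
  proof -
    define a where "a = 1 - A - b"
    have A: "A = 1 - a - b" by (simp add: a_def)
    have ix: "- A - b = a - 1" "1 - (A - 1) - (b + 1) = a" "1 - a - b = A" "- a - b = A - 1" "b + 1 - 1 = b" "1 - A - (b + 1) = a - 1"
      by (simp_all add: A)
    note r[of a b] q1[of a b] q0[of "a - 1" "b + 1"] p[of "(Tv, a, b)"]
    note * = this[unfolded one_of_unfold if_bool_eq_conj ix]
    show ?thesis using v[unfolded k A] * 
      unfolding k one_of_unfold mem_shuffle shuffle_mem.simps uncovered0_def uncovered1_def ix if_bool_eq_conj A[symmetric] by (smt (verit))
  qed
  moreover have ?thesis if k: "k = Wv"
  proof -
    define a where "a = - A - b"
    have A: "A = - a - b" by (simp add: a_def)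
    have ix: "1 - A - (b + 1) = a" "- A - b = a" "- a - b = A" "b + 1 - 1 = b"
      by (simp_all add: A)
    note r[of a b] q1[of a b]
    note * = this[unfolded one_of_unfold if_bool_eq_conj ix]
    show ?thesis using v[unfolded k A] * 
      unfolding k one_of_unfold mem_shuffle shuffle_mem.simps uncovered0_def uncovered1_def ix if_bool_eq_conj A[symmetric] by (smt (verit))
  qed
  moreover have ?thesis if k: "k = Xv"
  proof -
    define a where "a = - A - b"
    have A: "A = - a - b" by (simp add: a_def)
    have ix: "- (A - 1) - (b + 1) = a" "- A - b = a" "- a - b = A" "b + 1 - 1 = b"
      by (simp_all add: A)
    note r[of a b] q0[of a "b + 1"]
    note * = this[unfolded one_of_unfold if_bool_eq_conj ix]
    show ?thesis using v[unfolded k A] * 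
      unfolding k one_of_unfold mem_shuffle shuffle_mem.simps uncovered0_def uncovered1_def ix if_bool_eq_conj A[symmetric] by (smt (verit))
  qed
  ultimately show ?thesis by (cases k) blast+
qed

lemma shuffle_edge:
  assumes M: "M \<in> reduced_matchings G" and R: "shuffle_rel G G'" and e: "shuffle_mem G M (k, A, B)"
  shows "white (k, A, B) \<in> G' \<and> black (k, A, B) \<in> G'"
proof -
  have M': "M \<in> matchings G" using M by (simp add: reduced_matchings_def)
  have d: "dead_ok G" using R by (simp add: shuffle_rel_def)
  note r = R[unfolded shuffle_rel_def compat_def if_bool_eq_conj, THEN conjunct1, rule_format]
  note q1 = sq1_state[OF M d] and q0 = sq0_state[OF M d]
    and p = pm_at[OF M', unfolded if_bool_eq_conj]
   have ?thesis if k: "k = E05 \<or> k = E03 \<or> k = E40 \<or> k = E20"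
  proof -
    define a b where ab: "a = 1 - A - B" "b = B - 1"
    have A: "A = - a - b" "B = b + 1" by (simp_all add: ab)
    have ix: "1 - A - B = a" "B - 1 = b" "b + 1 = B" "- (a - 1) - B = A" "- a - b = A" "1 - a - b = A + 1" "1 - (a - 1) - B = A + 1" "b + 1 - 1 = b"
      by (simp_all add: A)
    note r[of a b] r[of "a - 1" "b + 1"] q1[of a b] q0[of a "b + 1"] q0[of "a - 1" "b + 1"] p[of "(Ov, a, b)"] p[of "(Sv, a, b)"] p[of "(Tv, a, b)"] p[of "(Xv, a, b)"] p[of "(Hv, a - 1, b + 1)"]
    note * = this[unfolded one_of_unfold if_bool_eq_conj ix]
    show ?thesis using k by (elim disjE; use e * in \<open>simp only: white.simps black.simps shuffle_mem.simps uncovered0_def uncovered1_def ix; argo\<close>)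
  qed
  moreover have ?thesis if k: "k = E14 \<or> k = E12 \<or> k = E51 \<or> k = E31"
  proof -
    define a where ab: "a = - A - B"
    have A: "A = - a - B" by (simp_all add: ab)
    have ix: "- A - B = a" "B + 1 - 1 = B" "- a - B = A" "1 - (a + 1) - B = A" "- (a + 1) - B = A - 1" "1 - a - B = A + 1" "a + 1 - 1 = a"
      by (simp_all add: A)
    note r[of a B] r[of "a + 1" B] q0[of a "B + 1"] q1[of a B] q1[of "a + 1" B] p[of "(Ov, a, B + 1)"] p[of "(Sv, a, B)"] p[of "(Tv, a + 1, B)"] p[of "(Wv, a, B)"] p[of "(Hv, a, B)"]
    note * = this[unfolded one_of_unfold if_bool_eq_conj ix]
    show ?thesis using k by (elim disjE; use e * in \<open>simp only: white.simps black.simps shuffle_mem.simps uncovered0_def uncovered1_def ix; argo\<close>)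
  qed
  moreover have ?thesis if k: "k = E53 \<or> k = E34 \<or> k = E25"
  proof -
    define a where ab: "a = - A - B"
    have A: "A = - a - B" by (simp_all add: ab)
    have ix: "- A - B = a" "- a - B = A" "1 - a - B = A + 1" "- a - (B - 1) = A + 1" "1 - a - (B - 1) = A + 2" "B - 1 + 1 = B"
      by (simp_all add: A)
    note r[of a B] r[of a "B - 1"] q0[of a B] q1[of a B] p[of "(Ov, a, B)"] p[of "(Hv, a, B)"]
    note * = this[unfolded one_of_unfold if_bool_eq_conj ix]
    show ?thesis using k by (elim disjE; use e * in \<open>simp only: white.simps black.simps shuffle_mem.simps uncovered0_def uncovered1_def ix; argo\<close>)
  qed
  moreover have ?thesis if k: "k = E42"
  proof -
    define a where ab: "a = 1 - A - B"
    have A: "A = 1 - a - B" by (simp_all add: ab)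
    have ix: "1 - A - B = a" "1 - a - B = A" "- a - B = A - 1" "- (a - 1) - B = A" "1 - (a - 1) - B = A + 1" "a - 1 + 1 = a"
      by (simp_all add: A)
    note r[of a B] r[of "a - 1" B] p[of "(Ov, a, B)"] p[of "(Hv, a - 1, B)"]
    note * = this[unfolded one_of_unfold if_bool_eq_conj ix]
    show ?thesis by (use k e * in \<open>simp only: white.simps black.simps shuffle_mem.simps uncovered0_def uncovered1_def ix; argo\<close>)
  qed
  ultimately show ?thesis by (cases k) blast+
qed

lemma shuffle_matchings:
  assumes M: "M \<in> reduced_matchings G" and R: "shuffle_rel G G'"
  shows "shuffle G M \<in> matchings G'"
  using shuffle_vertex[OF M R] shuffle_edge[OF M R] unfolding matchings_iff edges_in_def
  by (auto simp: mem_shuffle)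

lemma shuffle_reduced_matchings:
  assumes M: "M \<in> reduced_matchings G" and R: "shuffle_rel G G'"
  shows "shuffle G M \<in> reduced_matchings G'"
proof -
  have d: "dead_ok G" using R by (simp add: shuffle_rel_def)
  show ?thesis using shuffle_matchings[OF M R] sq1_state[OF M d] sq0_state[OF M d]
    unfolding reduced_matchings_def by (auto simp: mem_shuffle)
qed

text \<open>The shear is an involution, and shuffling exchanges full squares with uncovered ones and
  single edges with opposite ones; repeating it undoes every local change.\<close>

lemma shuffle_shuffle:
  assumes M: "M \<in> reduced_matchings G" and R: "shuffle_rel G G'"
  shows "shuffle G' (shuffle G M) = M"
proof -
  have M': "M \<in> matchings G" using M by (simp add: reduced_matchings_def)
  have d: "dead_ok G" using R by (simp add: shuffle_rel_def)
  note r = R[unfolded shuffle_rel_def compat_def if_bool_eq_conj, THEN conjunct1, rule_format]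
  note q1 = sq1_state[OF M d] and q0 = sq0_state[OF M d]
    and p = pm_at[OF M', unfolded if_bool_eq_conj]
  have "shuffle_mem G' (shuffle G M) (k, a, b) \<longleftrightarrow> (k, a, b) \<in> M" for k a b
  proof -
    define A where "A = - a - b"
    have ix: "1 - a - b = A + 1" "- a - b = A" "1 - (A + 1) - b = a" "- A - b = a" "- (A + 1) - (b - 1) = a" "- A - (b + 1) = a - 1"
      "1 - A - (b + 1) = a" "b + 1 - 1 = b" "b - 1 + 1 = b" "1 - (A + 1) - (b - 1) = a + 1" "- a - (b - 1) = A + 1" "- (a + 1) - (b - 1) = A" "1 - A - b = a + 1" "- a - (b + 1) = A - 1" "- A - (b - 1) = a + 1"
      "a + 1 - 1 = a" "- (A + 1) - b = a - 1"
      by (simp_all add: A_def)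
    note q0[of a b] q1[of a b] r[of a b] r[of a "b - 1"] p[of "(Wv, a, b)"] p[of "(Xv, a + 1, b - 1)"]
      p[of "(Ov, a, b)"] q1[of "a + 1" "b - 1"] q0[of a "b + 1"]
    note * = this[unfolded one_of_unfold if_bool_eq_conj ix]
    show ?thesis
      by (cases k; use * in \<open>simp only: mem_shuffle shuffle_mem.simps uncovered0_def uncovered1_def ix; argo\<close>)
  qed
  then show ?thesis unfolding set_eq_iff mem_shuffle by (metis prod_cases3)
qed

lemma bij_shuffle:
  assumes R: "shuffle_rel G G'"
  shows "bij_betw (shuffle G) (reduced_matchings G) (reduced_matchings G')"
  by (rule bij_betw_byWitness[where f' = "shuffle G'"])
    (use R shuffle_rel_sym[OF R] in \<open>auto intro: shuffle_reduced_matchings simp: shuffle_shuffle\<close>)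

section \<open>Weights under shuffling\<close>

fun edge_wt :: "(nat \<Rightarrow> 'a::field) \<Rightarrow> arrow \<Rightarrow> 'a" where
  "edge_wt v E31 = 1 / (v 3 * v 1)"
| "edge_wt v E12 = 1 / (v 1 * v 2)"
| "edge_wt v E51 = 1 / (v 5 * v 1)"
| "edge_wt v E14 = 1 / (v 1 * v 4)"
| "edge_wt v E20 = 1 / (v 2 * v 0)"
| "edge_wt v E03 = 1 / (v 0 * v 3)"
| "edge_wt v E40 = 1 / (v 4 * v 0)"
| "edge_wt v E05 = 1 / (v 0 * v 5)"
| "edge_wt v E53 = 1 / (v 5 * v 3)"
| "edge_wt v E42 = 1 / (v 4 * v 2)"
| "edge_wt v E34 = 1 / (v 3 * v 4)"
| "edge_wt v E25 = 1 / (v 2 * v 5)"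

definition wt :: "(nat \<Rightarrow> 'a::field) \<Rightarrow> edg set \<Rightarrow> 'a" where
  "wt v M = (\<Prod>e\<in>M. edge_wt v (fst e))"

definition wsum :: "(nat \<Rightarrow> 'a::field) \<Rightarrow> vtx set \<Rightarrow> 'a" where
  "wsum v G = (\<Sum>M\<in>matchings G. wt v M)"

text \<open>The common exchange binomial of the vertices \<open>0\<close> and \<open>1\<close>,
  which have the same neighbours with all arrows reversed.\<close>

definition exch_num :: "(nat \<Rightarrow> 'a::field) \<Rightarrow> 'a" where
  "exch_num v = v 2 * v 4 + v 3 * v 5"

section \<open>Exchanging the two pairs of a square\<close>

type_synonym sqr = "bool \<times> int \<times> int"

text \<open>The two matchings of a square; \<open>True\<close> stands for a face labelled \<open>1\<close>.\<close>
fun pair1 :: "sqr \<Rightarrow> edg set" where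
  "pair1 (True, a, b) = {(E31, a, b), (E51, a, b)}"
| "pair1 (False, a, b) = {(E03, a, b), (E05, a, b)}"

fun pair2 :: "sqr \<Rightarrow> edg set" where
  "pair2 (True, a, b) = {(E12, a, b), (E14, a, b)}"
| "pair2 (False, a, b) = {(E20, a, b), (E40, a, b)}"

abbreviation ends :: "edg \<Rightarrow> vtx \<Rightarrow> bool" where
  "ends e v \<equiv> white e = v \<or> black e = v"

lemma ends_p12: "(\<exists>e\<in>pair1 f. ends e v) \<longleftrightarrow> (\<exists>e\<in>pair2 f. ends e v)"
  by (cases f rule: pair1.cases) auto

lemma ends_pair1_unique: "e \<in> pair1 f \<Longrightarrow> e' \<in> pair1 f \<Longrightarrow> ends e v \<Longrightarrow> ends e' v \<Longrightarrow> e = e'"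
  by (cases f rule: pair1.cases) auto

lemma ends_pair2_unique: "e \<in> pair2 f \<Longrightarrow> e' \<in> pair2 f \<Longrightarrow> ends e v \<Longrightarrow> ends e' v \<Longrightarrow> e = e'"
  by (cases f rule: pair1.cases) auto

lemma matchings_ex1: "M \<in> matchings G \<Longrightarrow> e \<in> M \<Longrightarrow> e' \<in> M \<Longrightarrow> ends e v \<Longrightarrow> ends e' v \<Longrightarrow> e = e'"
  unfolding matchings_def edges_in_def by blast

lemma p12_disj: "pair1 f \<inter> pair2 g = {}" "f \<noteq> g \<Longrightarrow> pair1 f \<inter> pair1 g = {}" "f \<noteq> g \<Longrightarrow> pair2 f \<inter> pair2 g = {}"
  by (cases f rule: pair1.cases; cases g rule: pair1.cases; auto)+

text \<open>By \<open>cov\<close> the two sets of edges meet the same vertices, and by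
  \<open>un\<close> the new one meets none of them twice; away from these vertices nothing
  changes.\<close>

lemma exch_matchings:
  assumes M: "M \<in> matchings G" and sub: "P \<subseteq> M" and dj: "P' \<inter> M = {}"
    and cov: "\<And>v. (\<exists>e\<in>P. ends e v) \<longleftrightarrow> (\<exists>e\<in>P'. ends e v)"
    and un: "\<And>e e' v. e \<in> P' \<Longrightarrow> e' \<in> P' \<Longrightarrow> ends e v \<Longrightarrow> ends e' v \<Longrightarrow> e = e'"
  shows "M - P \<union> P' \<in> matchings G"
proof -
  have inG: "white e \<in> G \<and> black e \<in> G" if "e \<in> P'" for e
  proof -
    have "\<exists>e'\<in>P. ends e' (white e)" "\<exists>e'\<in>P. ends e' (black e)" using cov that by blast+
    then show ?thesis using pm_ends[OF M] sub by (metis subsetD)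
  qed
  have "\<exists>!e. e \<in> M - P \<union> P' \<and> ends e v" if v: "v \<in> G" for v
  proof (cases "\<exists>e\<in>P. ends e v")
    case True
    then obtain e e' where e: "e \<in> P" "ends e v" and e': "e' \<in> P'" "ends e' v" using cov by blast
    have "d = e'" if "d \<in> M - P \<union> P'" "ends d v" for d
    proof (cases "d \<in> P'")
      case True then show ?thesis using un e' that by blast
    next
      case False
      then have "d \<in> M" "d \<notin> P" using that by auto
      then show ?thesis using matchings_ex1[OF M, of d e v] e that sub by blast
    qed
    then show ?thesis using e' by blast
  next
    case False
    have "\<exists>!e. e \<in> M \<and> ends e v" using M v by (simp add: matchings_def)
    moreover have "e \<in> M - P \<union> P' \<longleftrightarrow> e \<in> M" if "ends e v" for e
      using False cov that by blast
    ultimately show ?thesis by metis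
  qed
  moreover have "M - P \<union> P' \<subseteq> edges_in G" using M inG by (auto simp: matchings_def edges_in_def)
  ultimately show ?thesis unfolding matchings_def by blast
qed

lemma pair1_not_M:
  assumes "M \<in> matchings G" "pair2 f \<subseteq> M" shows "pair1 f \<inter> M = {}"
proof (rule equals0I)
  fix e assume e: "e \<in> pair1 f \<inter> M"
  then obtain d where "d \<in> pair2 f" "ends d (white e)" using ends_p12[of f "white e"] by blast
  then show False using matchings_ex1[OF assms(1), of e d "white e"] e assms(2) p12_disj(1)[of f f] by blast
qed

lemma pair2_not_M:
  assumes "M \<in> matchings G" "pair1 f \<subseteq> M" shows "pair2 f \<inter> M = {}"
proof (rule equals0I)
  fix e assume e: "e \<in> pair2 f \<inter> M"
  then obtain d where "d \<in> pair1 f" "ends d (white e)" using ends_p12[of f "white e"] by blast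
  then show False using matchings_ex1[OF assms(1), of e d "white e"] e assms(2) p12_disj(1)[of f f] by blast
qed

lemma flip21:
  assumes "M \<in> matchings G" "pair2 f \<subseteq> M" shows "M - pair2 f \<union> pair1 f \<in> matchings G"
  by (rule exch_matchings[OF assms pair1_not_M[OF assms] ends_p12[symmetric]]) (erule (3) ends_pair1_unique)

lemma flip12:
  assumes "M \<in> matchings G" "pair1 f \<subseteq> M" shows "M - pair1 f \<union> pair2 f \<in> matchings G"
  by (rule exch_matchings[OF assms pair2_not_M[OF assms] ends_p12]) (erule (3) ends_pair2_unique)

definition full_in :: "sqr set \<Rightarrow> edg set \<Rightarrow> sqr set" where
  "full_in F M = {f \<in> F. pair1 f \<subseteq> M}"

lemma matchings_finite_elem: "finite G \<Longrightarrow> M \<in> matchings G \<Longrightarrow> finite M"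
  using finite_edges_in by (auto simp: matchings_def intro: finite_subset)

text \<open>For either label the second pair weighs \<open>v 3 * v 5 / (v 2 * v 4)\<close> times the
  first.\<close>

lemma wt_p: 
  fixes v :: "nat \<Rightarrow> 'a::field"
  assumes nz: "\<And>i. i < 6 \<Longrightarrow> v i \<noteq> 0"
  shows "wt v (pair2 f) = (exch_num v / (v 2 * v 4) - 1) * wt v (pair1 f)"
  by (cases f rule: pair1.cases) (use nz in \<open>simp_all add: wt_def exch_num_def field_simps\<close>)

lemma wt_flip:
  fixes v :: "nat \<Rightarrow> 'a::field"
  assumes nz: "\<And>i. i < 6 \<Longrightarrow> v i \<noteq> 0" and "finite M" "pair2 f \<subseteq> M" "pair1 f \<inter> M = {}"
  shows "wt v M = (exch_num v / (v 2 * v 4) - 1) * wt v (M - pair2 f \<union> pair1 f)"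
proof -
  have fp: "finite (pair1 f)" "finite (pair2 f)" by (cases f rule: pair1.cases; simp)+
  have "wt v M = wt v (M - pair2 f) * wt v (pair2 f)"
    unfolding wt_def using assms by (metis prod.subset_diff)
  moreover have "wt v (M - pair2 f \<union> pair1 f) = wt v (M - pair2 f) * wt v (pair1 f)"
    unfolding wt_def using assms fp by (intro prod.union_disjoint) auto
  ultimately show ?thesis using wt_p[OF nz, where f = f] by simp
qed

lemma exch_sub: "Q \<inter> A = {} \<Longrightarrow> Q \<inter> B = {} \<Longrightarrow> Q \<subseteq> M - A \<union> B \<longleftrightarrow> Q \<subseteq> M"
  by blast

lemma reduced_matchings_iff: "M \<in> reduced_matchings G \<longleftrightarrow> M \<in> matchings G \<and> (\<forall>f. \<not> pair2 f \<subseteq> M)"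
  unfolding reduced_matchings_def split_paired_All all_bool_eq by simp

text \<open>Squares are treated one at a time. Flipping matches the matchings containing
  \<open>pair2 f\<close> with those containing \<open>pair1 f\<close>, and the former contribute
  \<open>\<rho> - 1\<close> times as much; they may thus be dropped if the latter receive the factor
  \<open>\<rho>\<close>. Flips at different squares do not interfere, as their pairs share no
  edge.\<close>

lemma wsum_reduced_matchings:
  fixes v :: "nat \<Rightarrow> 'a::field"
  assumes nz: "\<And>i. i < 6 \<Longrightarrow> v i \<noteq> 0" and fin: "finite G"
  shows "wsum v G = (\<Sum>M\<in>reduced_matchings G. wt v M * (exch_num v / (v 2 * v 4)) ^ card (full_in UNIV M))"
proof -
  define \<rho> where "\<rho> = exch_num v / (v 2 * v 4)"
  define PF where "PF F = {M \<in> matchings G. \<forall>f\<in>F. \<not> pair2 f \<subseteq> M}" for F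
  have finP: "finite (PF F)" for F using finite_matchings[OF fin] by (simp add: PF_def)
  have main: "(\<Sum>M\<in>PF F. wt v M * \<rho> ^ card (full_in F M)) = wsum v G" if "finite F" for F
    using that
  proof (induction F)
    case empty
    then show ?case by (simp add: PF_def wsum_def full_in_def)
  next
    case (insert f F)
    let ?w = "\<lambda>F M. wt v M * \<rho> ^ card (full_in F M)"
    let ?A = "{M \<in> PF F. \<not> pair2 f \<subseteq> M \<and> \<not> pair1 f \<subseteq> M}"
    let ?B = "{M \<in> PF F. pair1 f \<subseteq> M}" and ?C = "{M \<in> PF F. pair2 f \<subseteq> M}"
    have fF: "finite (full_in F M)" for M using insert by (simp add: full_in_def)
    have nB: "\<not> pair2 f \<subseteq> M" if "M \<in> ?B" for M
    proof -
      have "pair2 f \<inter> M = {}" using that pair2_not_M[of M G f] by (simp add: PF_def)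
      moreover have "pair2 f \<noteq> {}" by (cases f rule: pair1.cases) auto
      ultimately show ?thesis by blast
    qed
    have PFi: "PF (insert f F) = ?A \<union> ?B" using nB by (auto simp: PF_def)
    have PFF: "PF F = ?A \<union> ?B \<union> ?C" by auto
    have 1: "sum (?w F) (PF F) = sum (?w F) ?A + sum (?w F) ?B + sum (?w F) ?C"
      by (subst PFF, subst sum.union_disjoint, use finP nB in auto)
        (subst sum.union_disjoint, use finP in auto)
    have 2: "sum (?w (insert f F)) (PF (insert f F)) = sum (?w F) ?A + \<rho> * sum (?w F) ?B"
    proof -
      have "sum (?w (insert f F)) (PF (insert f F)) = sum (?w (insert f F)) ?A + sum (?w (insert f F)) ?B"
        unfolding PFi by (rule sum.union_disjoint) (use finP in auto)
      moreover have "sum (?w (insert f F)) ?A = sum (?w F) ?A"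
      proof (rule sum.cong)
        fix M assume "M \<in> ?A"
        then have "full_in (insert f F) M = full_in F M" by (auto simp: full_in_def)
        then show "?w (insert f F) M = ?w F M" by simp
      qed simp
      moreover have "sum (?w (insert f F)) ?B = \<rho> * sum (?w F) ?B"
        unfolding sum_distrib_left
      proof (rule sum.cong)
        fix M assume "M \<in> ?B"
        then have "full_in (insert f F) M = insert f (full_in F M)" by (auto simp: full_in_def)
        moreover have "f \<notin> full_in F M" using insert by (simp add: full_in_def)
        ultimately show "?w (insert f F) M = \<rho> * ?w F M" using fF by simp
      qed simp
      ultimately show ?thesis by simp
    qed
    have 3: "sum (?w F) ?C = (\<rho> - 1) * sum (?w F) ?B"
      unfolding sum_distrib_left
    proof (rule sum.reindex_bij_witness[where i = "\<lambda>M. M - pair1 f \<union> pair2 f" and j = "\<lambda>M. M - pair2 f \<union> pair1 f"])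
      fix M assume M: "M \<in> ?C"
      then have Mp: "M \<in> matchings G" "pair2 f \<subseteq> M" by (auto simp: PF_def)
      note n = pair1_not_M[OF Mp]
      show "M - pair2 f \<union> pair1 f - pair1 f \<union> pair2 f = M" using n Mp by blast
      have eq: "pair2 g \<subseteq> M - pair2 f \<union> pair1 f \<longleftrightarrow> pair2 g \<subseteq> M" "pair1 g \<subseteq> M - pair2 f \<union> pair1 f \<longleftrightarrow> pair1 g \<subseteq> M" if "g \<in> F" for g
      proof -
        have "f \<noteq> g" using that insert.hyps by blast
        then have "pair2 g \<inter> pair2 f = {}" "pair2 g \<inter> pair1 f = {}" "pair1 g \<inter> pair1 f = {}" "pair1 g \<inter> pair2 f = {}"
          using p12_disj(1)[of f g] p12_disj(1)[of g f] p12_disj(2)[of f g] p12_disj(3)[of f g] by (simp_all add: Int_commute)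
        then show "pair2 g \<subseteq> M - pair2 f \<union> pair1 f \<longleftrightarrow> pair2 g \<subseteq> M" "pair1 g \<subseteq> M - pair2 f \<union> pair1 f \<longleftrightarrow> pair1 g \<subseteq> M"
          by (simp_all add: exch_sub)
      qed
      show "M - pair2 f \<union> pair1 f \<in> ?B" using M eq flip21[OF Mp] by (auto simp: PF_def)
      have "full_in F (M - pair2 f \<union> pair1 f) = full_in F M" using eq unfolding full_in_def by blast
      then show "(\<rho> - 1) * ?w F (M - pair2 f \<union> pair1 f) = ?w F M"
        using wt_flip[OF nz matchings_finite_elem[OF fin Mp(1)] Mp(2) n] by (simp add: \<rho>_def)
    next
      fix M assume M: "M \<in> ?B"
      then have Mp: "M \<in> matchings G" "pair1 f \<subseteq> M" by (auto simp: PF_def)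
      note n = pair2_not_M[OF Mp]
      show "M - pair1 f \<union> pair2 f - pair2 f \<union> pair1 f = M" using n Mp by blast
      have eq: "pair2 g \<subseteq> M - pair1 f \<union> pair2 f \<longleftrightarrow> pair2 g \<subseteq> M" "pair1 g \<subseteq> M - pair1 f \<union> pair2 f \<longleftrightarrow> pair1 g \<subseteq> M" if "g \<in> F" for g
      proof -
        have "f \<noteq> g" using that insert.hyps by blast
        then have "pair2 g \<inter> pair2 f = {}" "pair2 g \<inter> pair1 f = {}" "pair1 g \<inter> pair1 f = {}" "pair1 g \<inter> pair2 f = {}"
          using p12_disj(1)[of f g] p12_disj(1)[of g f] p12_disj(2)[of f g] p12_disj(3)[of f g] by (simp_all add: Int_commute)
        then show "pair2 g \<subseteq> M - pair1 f \<union> pair2 f \<longleftrightarrow> pair2 g \<subseteq> M" "pair1 g \<subseteq> M - pair1 f \<union> pair2 f \<longleftrightarrow> pair1 g \<subseteq> M"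
          by (simp_all add: exch_sub)
      qed
      show "M - pair1 f \<union> pair2 f \<in> ?C" using M eq flip12[OF Mp] by (auto simp: PF_def)
    qed
    have "sum (?w (insert f F)) (PF (insert f F)) = sum (?w F) (PF F)"
      unfolding 1 2 3 by (simp add: algebra_simps)
    then show ?case using insert.IH by simp
  qed
  \<comment> \<open>The induction needs a finite set of squares. Those whose second pair lies in
    \<open>G\<close> suffice, because flipping shows that a square whose first pair lies in a
    matching is among them.\<close>
  define F where "F = {f. pair2 f \<subseteq> edges_in G}"
  have fF: "finite F"
  proof -
    have "(s, a, b) \<in> (\<lambda>(e :: edg). (True, snd e)) ` edges_in G \<union> (\<lambda>(e :: edg). (False, snd e)) ` edges_in G" if "(s, a, b) \<in> F" for s a b
      using that by (cases s) (force simp: F_def)+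
    then have "F \<subseteq> (\<lambda>(e :: edg). (True, snd e)) ` edges_in G \<union> (\<lambda>(e :: edg). (False, snd e)) ` edges_in G" by auto
    then show ?thesis by (rule finite_subset) (simp add: finite_edges_in fin)
  qed
  have "PF F = reduced_matchings G"
  proof -
    have "M \<in> PF F \<longleftrightarrow> M \<in> reduced_matchings G" for M
    proof -
      have "f \<in> F" if "M \<in> matchings G" "pair2 f \<subseteq> M" for f
        using that unfolding F_def matchings_def by blast
      then show ?thesis unfolding reduced_matchings_iff PF_def by blast
    qed
    then show ?thesis by blast
  qed
  moreover have "full_in F M = full_in UNIV M" if "M \<in> reduced_matchings G" for M
  proof -
    have "f \<in> F" if "pair1 f \<subseteq> M" for f
    proof -
      have "M - pair1 f \<union> pair2 f \<in> matchings G" using flip12 that \<open>M \<in> reduced_matchings G\<close> by (simp add: reduced_matchings_def)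
      then show ?thesis by (auto simp: matchings_def F_def)
    qed
    then show ?thesis by (auto simp: full_in_def)
  qed
  ultimately show ?thesis using main[OF fF] by (simp add: \<rho>_def)
qed

text \<open>Integer valued, since the relations between counts involve differences. As
  \<open>card\<close> is \<open>0\<close> on infinite sets, additivity needs the finiteness
  condition \<open>fin_pred\<close>.\<close>

definition count :: "(int \<Rightarrow> int \<Rightarrow> bool) \<Rightarrow> int" where
  "count P = int (card {(a, b). P a b})"

lemma count_shift1: "count (\<lambda>a b. P (s - a - b) (b + t)) = count P"
proof -
  have "bij_betw (\<lambda>(a, b). (s - a - b, b + t)) {(a, b). P (s - a - b) (b + t)} {(a, b). P a b}"
    by (rule bij_betw_byWitness[where f' = "\<lambda>(a, b). (s + t - a - b, b - t)"]) auto
  then show ?thesis by (simp add: count_def bij_betw_same_card)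
qed

lemma count_shift2: "count (\<lambda>a b. P (a + s) (b + t)) = count P"
proof -
  have "bij_betw (\<lambda>(a, b). (a + s, b + t)) {(a, b). P (a + s) (b + t)} {(a, b). P a b}"
    by (rule bij_betw_byWitness[where f' = "\<lambda>(a, b). (a - s, b - t)"]) auto
  then show ?thesis by (simp add: count_def bij_betw_same_card)
qed

lemma count_sum:
  assumes "finite B" "{(a, b). P a b} \<subseteq> B"
  shows "count P = (\<Sum>(a, b)\<in>B. of_bool (P a b))"
proof -
  have "(\<Sum>(a, b)\<in>B. of_bool (P a b)) = (\<Sum>c\<in>B \<inter> {(a, b). P a b}. (1::int))"
    by (rule sum.mono_neutral_cong_right) (use assms in auto)
  also have "B \<inter> {(a, b). P a b} = {(a, b). P a b}" using assms by auto
  finally show ?thesis by (simp add: count_def)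
qed

definition fin_pred :: "(int \<Rightarrow> int \<Rightarrow> bool) \<Rightarrow> bool" where
  "fin_pred P \<longleftrightarrow> finite {(a, b). P a b}"

text \<open>Pointwise linear relations between indicator functions sum to relations between matching_counts.\<close>
lemma count_linear:
  assumes fin: "\<And>P. P \<in> fst ` set L \<Longrightarrow> fin_pred P"
    and pw: "\<And>a b. (\<Sum>(P, c)\<leftarrow>L. c * of_bool (P a b)) = (0::int)"
  shows "(\<Sum>(P, c)\<leftarrow>L. c * count P) = 0"
proof -
  define B where "B = (\<Union>P\<in>fst ` set L. {(a, b). P a b})"
  have fB: "finite B" using fin unfolding B_def fin_pred_def by auto
  have "count P = (\<Sum>(a, b)\<in>B. of_bool (P a b))" if "P \<in> fst ` set L" for P
    by (rule count_sum[OF fB]) (use that in \<open>auto simp: B_def\<close>)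
  then have "(\<Sum>(P, c)\<leftarrow>L. c * count P) = (\<Sum>(P, c)\<leftarrow>L. c * (\<Sum>(a, b)\<in>B. of_bool (P a b)))"
    by (intro arg_cong[of _ _ sum_list] map_cong) force+
  also have "\<dots> = (\<Sum>(a, b)\<in>B. (\<Sum>(P, c)\<leftarrow>L. c * of_bool (P a b)))"
    by (induction L) (auto simp: sum_distrib_left sum.distrib split_def)
  also have "\<dots> = 0" using pw by simp
  finally show ?thesis .
qed

section \<open>Edge counts of a matching and of its shuffle\<close>

definition kind_count :: "arrow \<Rightarrow> edg set \<Rightarrow> int" where
  "kind_count k M = count (\<lambda>a b. (k, a, b) \<in> M)"

lemma fin_pred_sub: "finite M \<Longrightarrow> (\<And>a b. P a b \<Longrightarrow> (k, a, b) \<in> (M :: ('k \<times> int \<times> int) set)) \<Longrightarrow> fin_pred P"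
  unfolding fin_pred_def by (rule finite_subset[of _ "snd ` M"]) force+

lemma fin_pred_shift2: "fin_pred P \<Longrightarrow> fin_pred (\<lambda>a b. P (a + s) (b + t))"
  unfolding fin_pred_def
  by (rule finite_subset[of _ "(\<lambda>(a, b). (a - s, b - t)) ` {(a, b). P a b}"]) force+

lemma fin_pred_shift1: "fin_pred P \<Longrightarrow> fin_pred (\<lambda>a b. P (s - a - b) (b + t))"
  unfolding fin_pred_def
  by (rule finite_subset[of _ "(\<lambda>(a, b). (s + t - a - b, b - t)) ` {(a, b). P a b}"]) force+

lemma fin_pred_conj: "fin_pred P \<Longrightarrow> fin_pred (\<lambda>a b. P a b \<and> Q a b)" "fin_pred Q \<Longrightarrow> fin_pred (\<lambda>a b. P a b \<and> Q a b)"
  unfolding fin_pred_def by (auto elim: rev_finite_subset)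

lemma kind_count_shift2: "count (\<lambda>a b. (k, a + s, b + t) \<in> M) = kind_count k M"
  unfolding kind_count_def by (rule count_shift2)


definition full1 where "full1 M = count (\<lambda>a b. (E31, a, b) \<in> M \<and> (E51, a, b) \<in> M)"
definition full0 where "full0 M = count (\<lambda>a b. (E03, a, b) \<in> M \<and> (E05, a, b) \<in> M)"
definition num_uncov1 where "num_uncov1 G M = count (uncovered1 G M)"
definition num_uncov0 where "num_uncov0 G M = count (uncovered0 G M)"
definition num_vtx :: "vtx_kind \<Rightarrow> vtx set \<Rightarrow> int" where "num_vtx k G = count (\<lambda>a b. (k, a, b) \<in> G)"

text \<open>Each identity is the sum of a pointwise one. At \<open>Wv\<close>, \<open>Xv\<close>,
  \<open>Sv\<close>, \<open>Tv\<close> exactly one incident edge is chosen; for a renewed square the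
  six possible states give edges minus full pairs plus uncovered squares equal to one.\<close>

lemma matching_counts:
  assumes M: "M \<in> reduced_matchings G" and d: "dead_ok G" and fin: "finite G"
  shows "num_vtx Xv G = kind_count E31 M + kind_count E12 M + kind_count E51 M + kind_count E14 M - full1 M + num_uncov1 G M" (is ?g1)
    "num_vtx Wv G = kind_count E20 M + kind_count E03 M + kind_count E40 M + kind_count E05 M - full0 M + num_uncov0 G M" (is ?g2)
    "num_vtx Wv G = kind_count E03 M + kind_count E40 M + kind_count E34 M" (is ?g3)
    "num_vtx Xv G = kind_count E12 M + kind_count E51 M + kind_count E25 M" (is ?g4)
    "num_vtx Sv G = kind_count E31 M + kind_count E12 M + kind_count E20 M + kind_count E03 M" (is ?g5)
    "num_vtx Tv G = kind_count E51 M + kind_count E14 M + kind_count E40 M + kind_count E05 M" (is ?g6)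
proof -
  have M': "M \<in> matchings G" using M by (simp add: reduced_matchings_def)
  note q1 = sq1_state[OF M d] and q0 = sq0_state[OF M d]
    and p = pm_at[OF M', unfolded if_bool_eq_conj]
  note fM = matchings_finite_elem[OF fin M']
  have fe: "fin_pred (\<lambda>a b. (k, a, b) \<in> M)" "fin_pred (\<lambda>a b. (k, a + s, b + t) \<in> M)" for k s t
    by (rule fin_pred_sub[OF fM], simp) (rule fin_pred_shift2, rule fin_pred_sub[OF fM], simp)
  have fv: "fin_pred (\<lambda>a b. (k, a, b) \<in> G)" "fin_pred (\<lambda>a b. (k, a + s, b + t) \<in> G)" for k s t
    by (rule fin_pred_sub[OF fin], simp) (rule fin_pred_shift2, rule fin_pred_sub[OF fin], simp)
  have f0: "fin_pred (\<lambda>a b. (E31, a, b) \<in> M \<and> (E51, a, b) \<in> M)" "fin_pred (\<lambda>a b. (E03, a, b) \<in> M \<and> (E05, a, b) \<in> M)"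
    by (rule fin_pred_conj(1), rule fe)+
  have f1: "fin_pred (uncovered1 G M)" unfolding uncovered1_def by (rule fin_pred_conj(1)) (rule fv)
  have f2: "fin_pred (uncovered0 G M)" unfolding uncovered0_def by (rule fin_pred_conj(1)) (use fv(2)[of Wv 0 "-1"] in simp)
  have f2': "fin_pred (\<lambda>a b. uncovered0 G M a (b + 1))" "fin_pred (\<lambda>a b. (k, a, b + 1) \<in> M)" "fin_pred (\<lambda>a b. (k, a - 1, b + 1) \<in> M)"
     "fin_pred (\<lambda>a b. (E03, a, b + 1) \<in> M \<and> (E05, a, b + 1) \<in> M)" for k
    using fin_pred_shift2[OF f2, of 0 1] fe(2)[of k 0 1] fe(2)[of k "-1" 1] fin_pred_shift2[OF f0(2), of 0 1] by simp_all
  have shf: "count (\<lambda>a b. uncovered0 G M a (b + 1)) = num_uncov0 G M" "count (\<lambda>a b. (k, a, b + 1) \<in> M) = kind_count k M" "count (\<lambda>a b. (k, a - 1, b + 1) \<in> M) = kind_count k M"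
     "count (\<lambda>a b. (E03, a, b + 1) \<in> M \<and> (E05, a, b + 1) \<in> M) = full0 M" for k
    using count_shift2[of "uncovered0 G M" 0 1] count_shift2[of "\<lambda>a b. (k, a, b) \<in> M" 0 1] count_shift2[of "\<lambda>a b. (k, a, b) \<in> M" "-1" 1]
      count_shift2[of "\<lambda>a b. (E03, a, b) \<in> M \<and> (E05, a, b) \<in> M" 0 1] by (simp_all add: num_uncov0_def kind_count_def full0_def)
  have "(of_bool ((Xv, a, b) \<in> G) :: int) + - 1 * of_bool ((E31, a, b) \<in> M) + - 1 * of_bool ((E12, a, b) \<in> M) + - 1 * of_bool ((E51, a, b) \<in> M) + - 1 * of_bool ((E14, a, b) \<in> M) + 1 * of_bool ((E31, a, b) \<in> M \<and> (E51, a, b) \<in> M) + - 1 * of_bool (uncovered1 G M a b) = 0" for a b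
    using q1[of a b] unfolding uncovered1_def uncovered0_def by (cases "(Xv, a, b) \<in> G"; cases "(E31, a, b) \<in> M"; cases "(E12, a, b) \<in> M"; cases "(E51, a, b) \<in> M"; cases "(E14, a, b) \<in> M"; simp)
  note pw = this
  let ?L = "[(\<lambda>a b. (Xv, a, b) \<in> G, 1), (\<lambda>a b. (E31, a, b) \<in> M, - 1), (\<lambda>a b. (E12, a, b) \<in> M, - 1), (\<lambda>a b. (E51, a, b) \<in> M, - 1), (\<lambda>a b. (E14, a, b) \<in> M, - 1), (\<lambda>a b. (E31, a, b) \<in> M \<and> (E51, a, b) \<in> M, 1), (uncovered1 G M, - 1)]"
  have "(\<Sum>(P, c)\<leftarrow>?L. c * count P) = 0"
  proof (rule count_linear)
    fix P assume "P \<in> fst ` set ?L"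
    then show "fin_pred P" using fv fe f0 f1 f2 f2' by auto
  next
    fix a b show "(\<Sum>(P, c)\<leftarrow>?L. c * of_bool (P a b)) = (0::int)" using pw[of a b] by simp
  qed
  then show ?g1
    by (simp add: shf num_vtx_def[symmetric] kind_count_def[symmetric] full1_def[symmetric] full0_def[symmetric] num_uncov1_def[symmetric] num_uncov0_def[symmetric])
  have "(of_bool ((Wv, a, b) \<in> G) :: int) + - 1 * of_bool ((E20, a, b + 1) \<in> M) + - 1 * of_bool ((E03, a, b + 1) \<in> M) + - 1 * of_bool ((E40, a, b + 1) \<in> M) + - 1 * of_bool ((E05, a, b + 1) \<in> M) + 1 * of_bool ((E03, a, b + 1) \<in> M \<and> (E05, a, b + 1) \<in> M) + - 1 * of_bool (uncovered0 G M a (b + 1)) = 0" for a b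
    using q0[of a "b + 1"] unfolding uncovered1_def uncovered0_def by (cases "(Wv, a, b) \<in> G"; cases "(E20, a, b + 1) \<in> M"; cases "(E03, a, b + 1) \<in> M"; cases "(E40, a, b + 1) \<in> M"; cases "(E05, a, b + 1) \<in> M"; simp)
  note pw = this
  let ?L = "[(\<lambda>a b. (Wv, a, b) \<in> G, 1), (\<lambda>a b. (E20, a, b + 1) \<in> M, - 1), (\<lambda>a b. (E03, a, b + 1) \<in> M, - 1), (\<lambda>a b. (E40, a, b + 1) \<in> M, - 1), (\<lambda>a b. (E05, a, b + 1) \<in> M, - 1), (\<lambda>a b. (E03, a, b + 1) \<in> M \<and> (E05, a, b + 1) \<in> M, 1), (\<lambda>a b. uncovered0 G M a (b + 1), - 1)]"
  have "(\<Sum>(P, c)\<leftarrow>?L. c * count P) = 0"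
  proof (rule count_linear)
    fix P assume "P \<in> fst ` set ?L"
    then show "fin_pred P" using fv fe f0 f1 f2 f2' by auto
  next
    fix a b show "(\<Sum>(P, c)\<leftarrow>?L. c * of_bool (P a b)) = (0::int)" using pw[of a b] by simp
  qed
  then show ?g2
    by (simp add: shf num_vtx_def[symmetric] kind_count_def[symmetric] full1_def[symmetric] full0_def[symmetric] num_uncov1_def[symmetric] num_uncov0_def[symmetric])
  have "(of_bool ((Wv, a, b) \<in> G) :: int) + - 1 * of_bool ((E03, a, b + 1) \<in> M) + - 1 * of_bool ((E40, a, b + 1) \<in> M) + - 1 * of_bool ((E34, a, b) \<in> M) = 0" for a b
    using p[of "(Wv, a, b)", unfolded one_of_unfold if_bool_eq_conj] unfolding uncovered1_def uncovered0_def by (cases "(Wv, a, b) \<in> G"; cases "(E03, a, b + 1) \<in> M"; cases "(E40, a, b + 1) \<in> M"; cases "(E34, a, b) \<in> M"; simp)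
  note pw = this
  let ?L = "[(\<lambda>a b. (Wv, a, b) \<in> G, 1), (\<lambda>a b. (E03, a, b + 1) \<in> M, - 1), (\<lambda>a b. (E40, a, b + 1) \<in> M, - 1), (\<lambda>a b. (E34, a, b) \<in> M, - 1)]"
  have "(\<Sum>(P, c)\<leftarrow>?L. c * count P) = 0"
  proof (rule count_linear)
    fix P assume "P \<in> fst ` set ?L"
    then show "fin_pred P" using fv fe f0 f1 f2 f2' by auto
  next
    fix a b show "(\<Sum>(P, c)\<leftarrow>?L. c * of_bool (P a b)) = (0::int)" using pw[of a b] by simp
  qed
  then show ?g3
    by (simp add: shf num_vtx_def[symmetric] kind_count_def[symmetric] full1_def[symmetric] full0_def[symmetric] num_uncov1_def[symmetric] num_uncov0_def[symmetric])
  have "(of_bool ((Xv, a, b) \<in> G) :: int) + - 1 * of_bool ((E12, a, b) \<in> M) + - 1 * of_bool ((E51, a, b) \<in> M) + - 1 * of_bool ((E25, a - 1, b + 1) \<in> M) = 0" for a b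
    using p[of "(Xv, a, b)", unfolded one_of_unfold if_bool_eq_conj] unfolding uncovered1_def uncovered0_def by (cases "(Xv, a, b) \<in> G"; cases "(E12, a, b) \<in> M"; cases "(E51, a, b) \<in> M"; cases "(E25, a - 1, b + 1) \<in> M"; simp)
  note pw = this
  let ?L = "[(\<lambda>a b. (Xv, a, b) \<in> G, 1), (\<lambda>a b. (E12, a, b) \<in> M, - 1), (\<lambda>a b. (E51, a, b) \<in> M, - 1), (\<lambda>a b. (E25, a - 1, b + 1) \<in> M, - 1)]"
  have "(\<Sum>(P, c)\<leftarrow>?L. c * count P) = 0"
  proof (rule count_linear)
    fix P assume "P \<in> fst ` set ?L"
    then show "fin_pred P" using fv fe f0 f1 f2 f2' by auto
  next
    fix a b show "(\<Sum>(P, c)\<leftarrow>?L. c * of_bool (P a b)) = (0::int)" using pw[of a b] by simp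
  qed
  then show ?g4
    by (simp add: shf num_vtx_def[symmetric] kind_count_def[symmetric] full1_def[symmetric] full0_def[symmetric] num_uncov1_def[symmetric] num_uncov0_def[symmetric])
  have "(of_bool ((Sv, a, b) \<in> G) :: int) + - 1 * of_bool ((E31, a, b) \<in> M) + - 1 * of_bool ((E12, a, b) \<in> M) + - 1 * of_bool ((E20, a, b + 1) \<in> M) + - 1 * of_bool ((E03, a, b + 1) \<in> M) = 0" for a b
    using p[of "(Sv, a, b)", unfolded one_of_unfold if_bool_eq_conj] unfolding uncovered1_def uncovered0_def by (cases "(Sv, a, b) \<in> G"; cases "(E31, a, b) \<in> M"; cases "(E12, a, b) \<in> M"; cases "(E20, a, b + 1) \<in> M"; cases "(E03, a, b + 1) \<in> M"; simp)
  note pw = this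
  let ?L = "[(\<lambda>a b. (Sv, a, b) \<in> G, 1), (\<lambda>a b. (E31, a, b) \<in> M, - 1), (\<lambda>a b. (E12, a, b) \<in> M, - 1), (\<lambda>a b. (E20, a, b + 1) \<in> M, - 1), (\<lambda>a b. (E03, a, b + 1) \<in> M, - 1)]"
  have "(\<Sum>(P, c)\<leftarrow>?L. c * count P) = 0"
  proof (rule count_linear)
    fix P assume "P \<in> fst ` set ?L"
    then show "fin_pred P" using fv fe f0 f1 f2 f2' by auto
  next
    fix a b show "(\<Sum>(P, c)\<leftarrow>?L. c * of_bool (P a b)) = (0::int)" using pw[of a b] by simp
  qed
  then show ?g5
    by (simp add: shf num_vtx_def[symmetric] kind_count_def[symmetric] full1_def[symmetric] full0_def[symmetric] num_uncov1_def[symmetric] num_uncov0_def[symmetric])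
  have "(of_bool ((Tv, a, b) \<in> G) :: int) + - 1 * of_bool ((E51, a, b) \<in> M) + - 1 * of_bool ((E14, a, b) \<in> M) + - 1 * of_bool ((E40, a - 1, b + 1) \<in> M) + - 1 * of_bool ((E05, a - 1, b + 1) \<in> M) = 0" for a b
    using p[of "(Tv, a, b)", unfolded one_of_unfold if_bool_eq_conj] unfolding uncovered1_def uncovered0_def by (cases "(Tv, a, b) \<in> G"; cases "(E51, a, b) \<in> M"; cases "(E14, a, b) \<in> M"; cases "(E40, a - 1, b + 1) \<in> M"; cases "(E05, a - 1, b + 1) \<in> M"; simp)
  note pw = this
  let ?L = "[(\<lambda>a b. (Tv, a, b) \<in> G, 1), (\<lambda>a b. (E51, a, b) \<in> M, - 1), (\<lambda>a b. (E14, a, b) \<in> M, - 1), (\<lambda>a b. (E40, a - 1, b + 1) \<in> M, - 1), (\<lambda>a b. (E05, a - 1, b + 1) \<in> M, - 1)]"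
  have "(\<Sum>(P, c)\<leftarrow>?L. c * count P) = 0"
  proof (rule count_linear)
    fix P assume "P \<in> fst ` set ?L"
    then show "fin_pred P" using fv fe f0 f1 f2 f2' by auto
  next
    fix a b show "(\<Sum>(P, c)\<leftarrow>?L. c * of_bool (P a b)) = (0::int)" using pw[of a b] by simp
  qed
  then show ?g6
    by (simp add: shf num_vtx_def[symmetric] kind_count_def[symmetric] full1_def[symmetric] full0_def[symmetric] num_uncov1_def[symmetric] num_uncov0_def[symmetric])
qed

lemma shuffle_counts:
  assumes M: "M \<in> reduced_matchings G" and d: "dead_ok G" and fin: "finite G"
  shows "kind_count E20 (shuffle G M) = kind_count E14 M" "kind_count E40 (shuffle G M) = kind_count E12 M"
    "kind_count E14 (shuffle G M) = kind_count E20 M" "kind_count E12 (shuffle G M) = kind_count E40 M"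
    "kind_count E53 (shuffle G M) = kind_count E53 M" "kind_count E42 (shuffle G M) = kind_count E42 M"
    "kind_count E05 (shuffle G M) = kind_count E31 M - full1 M + num_uncov1 G M"
    "kind_count E03 (shuffle G M) = kind_count E51 M - full1 M + num_uncov1 G M"
    "kind_count E51 (shuffle G M) = kind_count E03 M - full0 M + num_uncov0 G M"
    "kind_count E31 (shuffle G M) = kind_count E05 M - full0 M + num_uncov0 G M"
    "kind_count E34 (shuffle G M) = kind_count E31 M + kind_count E14 M"
    "kind_count E25 (shuffle G M) = kind_count E20 M + kind_count E05 M"
    "full1 (shuffle G M) = num_uncov0 G M" "full0 (shuffle G M) = num_uncov1 G M"
proof -
  have M': "M \<in> matchings G" using M by (simp add: reduced_matchings_def)
  note q1 = sq1_state[OF M d] and q0 = sq0_state[OF M d]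
  note fM = matchings_finite_elem[OF fin M']
  have fe: "fin_pred (\<lambda>a b. (k, a, b) \<in> M)" for k by (rule fin_pred_sub[OF fM], simp)
  have fv: "fin_pred (\<lambda>a b. (k, a, b + t) \<in> G)" for k t
    using fin_pred_shift2[OF fin_pred_sub[OF fin, of "\<lambda>a b. (k, a, b) \<in> G" k], of 0 t] by simp
  have fem: "fin_pred (uncovered1 G M)" "fin_pred (uncovered0 G M)"
    unfolding uncovered1_def uncovered0_def by (rule fin_pred_conj(1), use fv[of _ 0] fv[of _ "-1"] in simp)+
  have dj: "count (\<lambda>a b. (x, a, b) \<in> M \<and> (y, a, b) \<notin> M \<or> E a b) = kind_count x M - count (\<lambda>a b. (x, a, b) \<in> M \<and> (y, a, b) \<in> M) + count E"
    if "fin_pred E" "\<And>a b. E a b \<Longrightarrow> (x, a, b) \<notin> M" for x y E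
  proof -
    let ?L = "[(\<lambda>a b. (x, a, b) \<in> M \<and> (y, a, b) \<notin> M \<or> E a b, 1), (\<lambda>a b. (x, a, b) \<in> M, - 1), (\<lambda>a b. (x, a, b) \<in> M \<and> (y, a, b) \<in> M, 1), (E, - 1)]"
    have "(\<Sum>(P, c)\<leftarrow>?L. c * count P) = 0"
    proof (rule count_linear)
      fix P assume "P \<in> fst ` set ?L"
      moreover have "fin_pred (\<lambda>a b. (x, a, b) \<in> M \<and> (y, a, b) \<notin> M \<or> E a b)"
        using that(1) fe[of x] unfolding fin_pred_def
        by (intro finite_subset[of "{(a, b). (x, a, b) \<in> M \<and> (y, a, b) \<notin> M \<or> E a b}" "{(a, b). (x, a, b) \<in> M} \<union> {(a, b). E a b}"]) auto
      ultimately show "fin_pred P" using fe fin_pred_conj(1)[OF fe] that(1) by auto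
    next
      fix a b show "(\<Sum>(P, c)\<leftarrow>?L. c * of_bool (P a b)) = (0::int)"
        using that(2)[of a b] by (cases "(x, a, b) \<in> M"; cases "(y, a, b) \<in> M"; cases "E a b"; simp)
    qed
    then show ?thesis by (simp add: kind_count_def)
  qed
  have dj2: "count (\<lambda>a b. (x, a, b) \<in> M \<or> (y, a, b) \<in> M) = kind_count x M + kind_count y M"
    if "\<And>a b. (x, a, b) \<in> M \<Longrightarrow> (y, a, b) \<notin> M" for x y
  proof -
    have "count (\<lambda>a b. (x, a, b) \<in> M \<and> (y, a, b) \<notin> M \<or> (y, a, b) \<in> M) = kind_count x M - count (\<lambda>a b. (x, a, b) \<in> M \<and> (y, a, b) \<in> M) + count (\<lambda>a b. (y, a, b) \<in> M)"
      by (rule dj[OF fe]) (use that in blast)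
    moreover have "(\<lambda>a b. (x, a, b) \<in> M \<and> (y, a, b) \<notin> M \<or> (y, a, b) \<in> M) = (\<lambda>a b. (x, a, b) \<in> M \<or> (y, a, b) \<in> M)"
      by blast
    moreover have "count (\<lambda>a b. (x, a, b) \<in> M \<and> (y, a, b) \<in> M) = 0"
    proof -
      have "{(a, b). (x, a, b) \<in> M \<and> (y, a, b) \<in> M} = {}" using that by auto
      then show ?thesis unfolding count_def by (simp only: card.empty of_nat_0)
    qed
    ultimately show ?thesis by (simp add: kind_count_def)
  qed
  have s: "count (\<lambda>a b. P (1 - a - b) (b - 1)) = count P" "count (\<lambda>a b. P (- a - b) (b + 1)) = count P"
     "count (\<lambda>a b. P (- a - b) b) = count P" "count (\<lambda>a b. P (1 - a - b) b) = count P" for P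
    using count_shift1[of P 1 "-1"] count_shift1[of P 0 1] count_shift1[of P 0 0] count_shift1[of P 1 0] by simp_all
  show "kind_count E20 (shuffle G M) = kind_count E14 M" "kind_count E40 (shuffle G M) = kind_count E12 M"
    "kind_count E14 (shuffle G M) = kind_count E20 M" "kind_count E12 (shuffle G M) = kind_count E40 M"
    "kind_count E53 (shuffle G M) = kind_count E53 M" "kind_count E42 (shuffle G M) = kind_count E42 M"
    unfolding kind_count_def mem_shuffle shuffle_mem.simps
    by (rule s[of "\<lambda>a b. (_, a, b) \<in> M"])+
  show "kind_count E05 (shuffle G M) = kind_count E31 M - full1 M + num_uncov1 G M"
    unfolding kind_count_def[of E05] mem_shuffle shuffle_mem.simps full1_def num_uncov1_def
    by (subst s(1)[of "\<lambda>a b. (E31, a, b) \<in> M \<and> (E51, a, b) \<notin> M \<or> uncovered1 G M a b"], rule dj[OF fem(1)]) (simp add: uncovered1_def)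
  show "kind_count E03 (shuffle G M) = kind_count E51 M - full1 M + num_uncov1 G M"
    unfolding kind_count_def[of E03] mem_shuffle shuffle_mem.simps full1_def num_uncov1_def
    by (subst s(1)[of "\<lambda>a b. (E51, a, b) \<in> M \<and> (E31, a, b) \<notin> M \<or> uncovered1 G M a b"], subst dj[OF fem(1)]) (simp_all add: uncovered1_def conj_commute)
  show "kind_count E51 (shuffle G M) = kind_count E03 M - full0 M + num_uncov0 G M"
    unfolding kind_count_def[of E51] mem_shuffle shuffle_mem.simps full0_def num_uncov0_def
    by (subst s(2)[of "\<lambda>a b. (E03, a, b) \<in> M \<and> (E05, a, b) \<notin> M \<or> uncovered0 G M a b"], rule dj[OF fem(2)]) (simp add: uncovered0_def)
  show "kind_count E31 (shuffle G M) = kind_count E05 M - full0 M + num_uncov0 G M"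
    unfolding kind_count_def[of E31] mem_shuffle shuffle_mem.simps full0_def num_uncov0_def
    by (subst s(2)[of "\<lambda>a b. (E05, a, b) \<in> M \<and> (E03, a, b) \<notin> M \<or> uncovered0 G M a b"], subst dj[OF fem(2)]) (simp_all add: uncovered0_def conj_commute)
  show "kind_count E34 (shuffle G M) = kind_count E31 M + kind_count E14 M"
    unfolding kind_count_def[of E34] mem_shuffle shuffle_mem.simps
    by (subst s(3)[of "\<lambda>a b. (E31, a, b) \<in> M \<or> (E14, a, b) \<in> M"], rule dj2) (use q1 in blast)
  show "kind_count E25 (shuffle G M) = kind_count E20 M + kind_count E05 M"
    unfolding kind_count_def[of E25] mem_shuffle shuffle_mem.simps
    by (subst s(3)[of "\<lambda>a b. (E20, a, b) \<in> M \<or> (E05, a, b) \<in> M"], rule dj2) (use q0 in blast)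
  have "(E31, a, b) \<in> shuffle G M \<and> (E51, a, b) \<in> shuffle G M \<longleftrightarrow> uncovered0 G M (- a - b) (b + 1)" for a b
    by (auto simp: mem_shuffle)
  then show "full1 (shuffle G M) = num_uncov0 G M" using s(2)[of "uncovered0 G M"] by (simp add: full1_def num_uncov0_def)
  have "(E03, a, b) \<in> shuffle G M \<and> (E05, a, b) \<in> shuffle G M \<longleftrightarrow> uncovered1 G M (1 - a - b) (b - 1)" for a b
    by (auto simp: mem_shuffle)
  then show "full0 (shuffle G M) = num_uncov1 G M" using s(1)[of "uncovered1 G M"] by (simp add: full0_def num_uncov1_def)
qed

section \<open>Weights as Laurent monomials\<close>

lemma wt_kind_count:
  assumes "finite M"
  shows "wt v M = (\<Prod>k\<in>{E31, E12, E51, E14, E20, E03, E40, E05, E53, E42, E34, E25}. edge_wt v k powi kind_count k M)"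
    (is "_ = prod _ ?K")
proof -
  have K: "k \<in> ?K" for k by (cases k) auto
  have "wt v M = (\<Prod>k\<in>?K. \<Prod>e\<in>{e \<in> M. fst e = k}. edge_wt v (fst e))"
    unfolding wt_def by (rule prod.group[symmetric]) (use assms K in auto)
  also have "\<dots> = (\<Prod>k\<in>?K. edge_wt v k powi kind_count k M)"
  proof (rule prod.cong)
    fix k
    have "bij_betw snd {e \<in> M. fst e = k} {(a, b). (k, a, b) \<in> M}"
      by (rule bij_betw_byWitness[where f' = "\<lambda>c. (k, c)"]) auto
    then have "kind_count k M = int (card {e \<in> M. fst e = k})"
      unfolding kind_count_def count_def by (simp add: bij_betw_same_card)
    then show "(\<Prod>e\<in>{e \<in> M. fst e = k}. edge_wt v (fst e)) = edge_wt v k powi kind_count k M" by simp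
  qed simp
  finally show ?thesis .
qed

lemma card_full:
  assumes "finite M"
  shows "int (card (full_in UNIV M)) = full1 M + full0 M"
proof -
  let ?A = "{(a, b). (E31, a, b) \<in> M \<and> (E51, a, b) \<in> M}" and ?B = "{(a, b). (E03, a, b) \<in> M \<and> (E05, a, b) \<in> M}"
  have fin: "finite ?A" "finite ?B"
    using fin_pred_conj(1)[OF fin_pred_sub[OF assms]] unfolding fin_pred_def by simp_all
  have "full_in UNIV M = Pair True ` ?A \<union> Pair False ` ?B"
  proof -
    have "(s, a, b) \<in> full_in UNIV M \<longleftrightarrow> (s, a, b) \<in> Pair True ` ?A \<union> Pair False ` ?B" for s a b
      by (cases s) (auto simp: full_in_def)
    then show ?thesis by auto
  qed
  moreover have "card (Pair True ` ?A \<union> Pair False ` ?B) = card ?A + card ?B"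
    by (subst card_Un_disjoint) (use fin in \<open>auto simp: card_image inj_on_def\<close>)
  ultimately show ?thesis by (simp add: full1_def full0_def count_def)
qed

definition reduced_wt :: "(nat \<Rightarrow> 'a::field) \<Rightarrow> edg set \<Rightarrow> 'a" where
  "reduced_wt v M = wt v M * (exch_num v / (v 2 * v 4)) ^ card (full_in UNIV M)"

text \<open>Each full pair brings the factor \<open>exch_num v / (v 2 * v 4)\<close>; therefore
  \<open>full1\<close> and \<open>full0\<close> enter the exponents of \<open>v 2\<close> and
  \<open>v 4\<close> as well.\<close>

lemma reduced_wt_monomial:
  fixes v :: "nat \<Rightarrow> 'a::field"
  assumes nz: "\<And>i. i < 6 \<Longrightarrow> v i \<noteq> 0" and A: "exch_num v \<noteq> 0" and fin: "finite M"
  shows "reduced_wt v M = exch_num v powi (full1 M + full0 M)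
    * v 0 powi - (kind_count E20 M + kind_count E03 M + kind_count E40 M + kind_count E05 M)
    * v 1 powi - (kind_count E31 M + kind_count E12 M + kind_count E51 M + kind_count E14 M)
    * v 2 powi - (kind_count E12 M + kind_count E20 M + kind_count E42 M + kind_count E25 M + full1 M + full0 M)
    * v 3 powi - (kind_count E31 M + kind_count E03 M + kind_count E53 M + kind_count E34 M)
    * v 4 powi - (kind_count E14 M + kind_count E40 M + kind_count E42 M + kind_count E34 M + full1 M + full0 M)
    * v 5 powi - (kind_count E51 M + kind_count E05 M + kind_count E53 M + kind_count E25 M)"
proof -
  have z: "v 0 \<noteq> 0" "v 1 \<noteq> 0" "v (Suc 0) \<noteq> 0" "v 2 \<noteq> 0" "v 3 \<noteq> 0" "v 4 \<noteq> 0" "v 5 \<noteq> 0" using nz by auto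
  have eq: "(exch_num v / (v 2 * v 4)) ^ card (full_in UNIV M) = (exch_num v / (v 2 * v 4)) powi (full1 M + full0 M)"
    by (simp flip: card_full[OF fin])
  have om: "(1 / (x * y)) powi n = x powi (- n) * y powi (- n)" "(A / (x * y)) powi n = A powi n * (x powi (- n) * y powi (- n))" for x y A :: 'a and n
    by (simp_all add: power_int_divide_distrib power_int_mult_distrib power_int_minus field_simps)
  have pr: "(\<Prod>k\<in>{E31, E12, E51, E14, E20, E03, E40, E05, E53, E42, E34, E25}. f k) =
    f E31 * f E12 * f E51 * f E14 * f E20 * f E03 * f E40 * f E05 * f E53 * f E42 * f E34 * f E25" for f :: "arrow \<Rightarrow> 'a"
    by (simp add: mult_ac)
  have pa: "x powi (m + n) = x powi m * x powi n" if "x \<noteq> 0" for x :: 'a and m n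
    using that by (simp add: power_int_add)
  show ?thesis
    unfolding reduced_wt_def wt_kind_count[OF fin] eq pr edge_wt.simps om minus_add_distrib pa[OF A] pa[OF z(1)] pa[OF z(2)] pa[OF z(4)] pa[OF z(5)] pa[OF z(6)] pa[OF z(7)]
    by (simp only: power_int_1_left mult_1_left mult_ac)
qed

text \<open>Mutation at \<open>0\<close> and \<open>1\<close>, with the two labels swapped afterwards to account for the shear.\<close>
definition shuffle_vars :: "(nat \<Rightarrow> 'a::field) \<Rightarrow> nat \<Rightarrow> 'a" where
  "shuffle_vars v = v(0 := exch_num v / v 1, 1 := exch_num v / v 0)"

text \<open>The quotient of the weights before and after shuffling. It depends on the region only
  through numbers of vertices and not on the matching, which is what allows it to be pulled out of
  the sum.\<close>

definition shuffle_factor :: "(nat \<Rightarrow> 'a::field) \<Rightarrow> vtx set \<Rightarrow> 'a" where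
  "shuffle_factor v G = exch_num v powi (num_vtx Wv G + num_vtx Xv G) * v 0 powi (- 2 * num_vtx Wv G) * v 1 powi (- 2 * num_vtx Xv G)
     * v 2 powi (num_vtx Wv G - num_vtx Sv G) * v 3 powi (num_vtx Xv G - num_vtx Sv G)
     * v 4 powi (num_vtx Xv G - num_vtx Tv G) * v 5 powi (num_vtx Wv G - num_vtx Tv G)"

text \<open>Both sides are Laurent monomials with exponents linear in the edge counts. Once the
  uncovered squares and the counts of \<open>E34\<close> and \<open>E25\<close> are eliminated by
  the vertex equations, equality of the exponents is linear arithmetic.\<close>

lemma reduced_wt_shuffle:
  fixes v :: "nat \<Rightarrow> 'a::field"
  assumes nz: "\<And>i. i < 6 \<Longrightarrow> v i \<noteq> 0" and A: "exch_num v \<noteq> 0" and fin: "finite G" "finite G'"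
    and M: "M \<in> reduced_matchings G" and R: "shuffle_rel G G'"
  shows "reduced_wt v M = shuffle_factor v G * reduced_wt (shuffle_vars v) (shuffle G M)"
proof -
  have d: "dead_ok G" using R by (simp add: shuffle_rel_def)
  have fM: "finite M" "finite (shuffle G M)"
    using matchings_finite_elem[OF fin(1)] matchings_finite_elem[OF fin(2)] shuffle_reduced_matchings[OF M R] M by (auto simp: reduced_matchings_def)
  have z: "v 0 \<noteq> 0" "v 1 \<noteq> 0" "v (Suc 0) \<noteq> 0" "v 2 \<noteq> 0" "v 3 \<noteq> 0" "v 4 \<noteq> 0" "v 5 \<noteq> 0" using nz by auto
  have nA: "exch_num (shuffle_vars v) = exch_num v" by (simp add: exch_num_def shuffle_vars_def)
  have nz': "shuffle_vars v i \<noteq> 0" if "i < 6" for i using nz[OF that] z A by (simp add: shuffle_vars_def)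
  have sv: "shuffle_vars v 0 = exch_num v / v 1" "shuffle_vars v 1 = exch_num v / v 0" "shuffle_vars v 2 = v 2" "shuffle_vars v 3 = v 3" "shuffle_vars v 4 = v 4" "shuffle_vars v 5 = v 5"
    by (simp_all add: shuffle_vars_def)
  note c = matching_counts[OF M d fin(1)] and h = shuffle_counts[OF M d fin(1)]
  have e0: "num_uncov0 G M = num_vtx Wv G - kind_count E20 M - kind_count E03 M - kind_count E40 M - kind_count E05 M + full0 M"
    and e1: "num_uncov1 G M = num_vtx Xv G - kind_count E31 M - kind_count E12 M - kind_count E51 M - kind_count E14 M + full1 M"
    and e34: "kind_count E34 M = num_vtx Wv G - kind_count E03 M - kind_count E40 M" and e25: "kind_count E25 M = num_vtx Xv G - kind_count E12 M - kind_count E51 M"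
    using c by auto
  have cong7: "x powi a * y powi b * z powi c * s powi d * t powi e * u powi f * w powi g =
      x powi a' * y powi b' * z powi c' * s powi d' * t powi e' * u powi f' * w powi g'"
    if "a = a'" "b = b'" "c = c'" "d = d'" "e = e'" "f = f'" "g = g'"
    for x y z s t u w :: 'a and a b c d e f g a' b' c' d' e' f' g'
    using that by simp
  have split: "x powi a * y powi b * z powi c * (s powi d * t powi e * u powi f * w powi g) *
     (x powi a' * (x / z) powi b' * (x / y) powi c' * s powi d' * t powi e' * u powi f' * w powi g')
     = x powi (a + a' + b' + c') * y powi (b - c') * z powi (c - b') * s powi (d + d') * t powi (e + e') * u powi (f + f') * w powi (g + g')"
    if "x \<noteq> 0" "y \<noteq> 0" "z \<noteq> 0" "s \<noteq> 0" "t \<noteq> 0" "u \<noteq> 0" "w \<noteq> 0" for x y z s t u w :: 'a and a b c d e f g a' b' c' d' e' f' g'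
    using that by (simp add: power_int_divide_distrib power_int_add power_int_diff mult_ac)
  have m1: "reduced_wt v M = exch_num v powi (full1 M + full0 M)
    * v 0 powi - (kind_count E20 M + kind_count E03 M + kind_count E40 M + kind_count E05 M)
    * v 1 powi - (kind_count E31 M + kind_count E12 M + kind_count E51 M + kind_count E14 M)
    * v 2 powi - (kind_count E12 M + kind_count E20 M + kind_count E42 M + kind_count E25 M + full1 M + full0 M)
    * v 3 powi - (kind_count E31 M + kind_count E03 M + kind_count E53 M + kind_count E34 M)
    * v 4 powi - (kind_count E14 M + kind_count E40 M + kind_count E42 M + kind_count E34 M + full1 M + full0 M)
    * v 5 powi - (kind_count E51 M + kind_count E05 M + kind_count E53 M + kind_count E25 M)"
    by (rule reduced_wt_monomial[where v = v]) (use nz A fM in auto)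
  have m2: "reduced_wt (shuffle_vars v) (shuffle G M) = exch_num v powi (full1 (shuffle G M) + full0 (shuffle G M))
    * (exch_num v / v 1) powi - (kind_count E20 (shuffle G M) + kind_count E03 (shuffle G M) + kind_count E40 (shuffle G M) + kind_count E05 (shuffle G M))
    * (exch_num v / v 0) powi - (kind_count E31 (shuffle G M) + kind_count E12 (shuffle G M) + kind_count E51 (shuffle G M) + kind_count E14 (shuffle G M))
    * v 2 powi - (kind_count E12 (shuffle G M) + kind_count E20 (shuffle G M) + kind_count E42 (shuffle G M) + kind_count E25 (shuffle G M) + full1 (shuffle G M) + full0 (shuffle G M))
    * v 3 powi - (kind_count E31 (shuffle G M) + kind_count E03 (shuffle G M) + kind_count E53 (shuffle G M) + kind_count E34 (shuffle G M))
    * v 4 powi - (kind_count E14 (shuffle G M) + kind_count E40 (shuffle G M) + kind_count E42 (shuffle G M) + kind_count E34 (shuffle G M) + full1 (shuffle G M) + full0 (shuffle G M))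
    * v 5 powi - (kind_count E51 (shuffle G M) + kind_count E05 (shuffle G M) + kind_count E53 (shuffle G M) + kind_count E25 (shuffle G M))"
    using reduced_wt_monomial[where v = "shuffle_vars v" and M = "shuffle G M", OF nz'] A fM(2) unfolding nA sv by blast
  have "shuffle_factor v G * reduced_wt (shuffle_vars v) (shuffle G M) = 
    exch_num v powi (num_vtx Wv G + num_vtx Xv G) * v 0 powi (- 2 * num_vtx Wv G) * v 1 powi (- 2 * num_vtx Xv G)
     * (v 2 powi (num_vtx Wv G - num_vtx Sv G) * v 3 powi (num_vtx Xv G - num_vtx Sv G)
     * v 4 powi (num_vtx Xv G - num_vtx Tv G) * v 5 powi (num_vtx Wv G - num_vtx Tv G)) * reduced_wt (shuffle_vars v) (shuffle G M)"
    by (simp add: shuffle_factor_def mult.assoc)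
  also have "\<dots> = reduced_wt v M"
    unfolding m1 m2 nA sv
    apply (subst split[OF A z(1,2,4-7)])
    unfolding h e0 e1 e34 e25
    by (rule cong7) (use c in linarith)+
  finally show ?thesis ..
qed

lemma wsum_shuffle:
  fixes v :: "nat \<Rightarrow> 'a::field"
  assumes nz: "\<And>i. i < 6 \<Longrightarrow> v i \<noteq> 0" and A: "exch_num v \<noteq> 0" and fin: "finite G" "finite G'"
    and R: "shuffle_rel G G'"
  shows "wsum v G = shuffle_factor v G * wsum (shuffle_vars v) G'"
proof -
  have z: "v 0 \<noteq> 0" "v (Suc 0) \<noteq> 0" using nz by auto
  have nz': "shuffle_vars v i \<noteq> 0" if "i < 6" for i using nz[OF that] z A by (simp add: shuffle_vars_def)
  have "wsum v G = (\<Sum>M\<in>reduced_matchings G. reduced_wt v M)" by (simp add: wsum_reduced_matchings[OF nz fin(1)] reduced_wt_def)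
  also have "\<dots> = (\<Sum>M\<in>reduced_matchings G. shuffle_factor v G * reduced_wt (shuffle_vars v) (shuffle G M))"
    by (rule sum.cong) (simp_all add: reduced_wt_shuffle[OF nz A fin _ R])
  also have "\<dots> = shuffle_factor v G * (\<Sum>M\<in>reduced_matchings G'. reduced_wt (shuffle_vars v) M)"
    using sum.reindex_bij_betw[OF bij_shuffle[OF R], of "reduced_wt (shuffle_vars v)"] by (simp flip: sum_distrib_left)
  also have "(\<Sum>M\<in>reduced_matchings G'. reduced_wt (shuffle_vars v) M) = wsum (shuffle_vars v) G'"
    by (simp add: wsum_reduced_matchings[OF nz' fin(2)] reduced_wt_def)
  finally show ?thesis .
qed

section \<open>Forced edges and covering monomials\<close>

fun face_edge_list :: "nat \<Rightarrow> int \<Rightarrow> int \<Rightarrow> edg list" where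
  "face_edge_list k a b = [
     [(E20, a, b), (E03, a, b), (E40, a, b), (E05, a, b)],
     [(E31, a, b), (E12, a, b), (E51, a, b), (E14, a, b)],
     [(E20, a, b), (E12, a, b - 1), (E25, a - 1, b), (E42, a, b)],
     [(E31, a, b), (E53, a, b), (E34, a, b), (E03, a, b + 1)],
     [(E14, a, b), (E40, a - 1, b + 1), (E34, a - 1, b), (E42, a, b)],
     [(E05, a, b), (E51, a + 1, b - 1), (E25, a, b), (E53, a, b)]] ! k"

declare face_edge_list.simps [simp del]

lemma face_edge_list_simps:
  "face_edge_list 0 a b = [(E20, a, b), (E03, a, b), (E40, a, b), (E05, a, b)]"
  "face_edge_list 1 a b = [(E31, a, b), (E12, a, b), (E51, a, b), (E14, a, b)]"
  "face_edge_list 2 a b = [(E20, a, b), (E12, a, b - 1), (E25, a - 1, b), (E42, a, b)]"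
  "face_edge_list 3 a b = [(E31, a, b), (E53, a, b), (E34, a, b), (E03, a, b + 1)]"
  "face_edge_list 4 a b = [(E14, a, b), (E40, a - 1, b + 1), (E34, a - 1, b), (E42, a, b)]"
  "face_edge_list 5 a b = [(E05, a, b), (E51, a + 1, b - 1), (E25, a, b), (E53, a, b)]"
  by (simp_all add: face_edge_list.simps)

definition bordered :: "vtx set \<Rightarrow> nat \<Rightarrow> int \<Rightarrow> int \<Rightarrow> bool" where
  "bordered G k a b \<longleftrightarrow> (\<exists>e\<in>set (face_edge_list k a b). white e \<in> G \<and> black e \<in> G)"

definition bordered_count :: "vtx set \<Rightarrow> nat \<Rightarrow> int" where
  "bordered_count G k = count (bordered G k)"

text \<open>Only faces on the border are counted; for regions without further enclosed faces this is
  \<open>graph_c\<close>, see \<open>graph_c_c_value\<close>. The weights range over an arbitrary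
  field so that mutated variables can be inserted.\<close>

definition c_value :: "(nat \<Rightarrow> 'a::field) \<Rightarrow> vtx set \<Rightarrow> 'a" where
  "c_value v G = wsum v G * (\<Prod>k<6. v k powi bordered_count G k)"

definition forced_at :: "edg set \<Rightarrow> nat \<Rightarrow> int \<Rightarrow> int \<Rightarrow> int" where
  "forced_at Fo k a b = (\<Sum>e\<leftarrow>face_edge_list k a b. of_bool (e \<in> Fo))"

text \<open>Forced edges are the pendant edges at black leaves; the last condition keeps two of them
  from competing for the same white vertex.\<close>

definition forced_leaves :: "vtx set \<Rightarrow> edg set \<Rightarrow> bool" where
  "forced_leaves G Fo \<longleftrightarrow> Fo \<subseteq> edges_in G \<and> (\<forall>e\<in>Fo. \<forall>e'\<in>set (incident (black e)). e' \<noteq> e \<longrightarrow> white e' \<notin> G) \<and>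
     (\<forall>v. \<forall>e\<in>Fo. \<forall>e'\<in>Fo. white e = v \<longrightarrow> white e' = v \<longrightarrow> e = e')"

definition strip :: "vtx set \<Rightarrow> edg set \<Rightarrow> vtx set" where
  "strip G Fo = {v \<in> G. \<forall>e\<in>set (incident v). e \<notin> Fo}"

lemma white_neq_black: "white e \<noteq> black e'"
  by (cases e rule: white.cases; cases e' rule: white.cases; simp)

lemma matchings_strip:
  assumes L: "forced_leaves G Fo"
  shows "bij_betw (\<lambda>M. M \<union> Fo) (matchings (strip G Fo)) (matchings G)"
proof -
  have sub: "Fo \<subseteq> edges_in G" using L by (simp add: forced_leaves_def)
  have leaf: "e' = e" if "e \<in> Fo" "e' \<in> edges_in G" "black e' = black e" for e e'
    using L that in_incident[of e' "black e"] unfolding forced_leaves_def edges_in_def by blast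
  have whinj: "e = e'" if "e \<in> Fo" "e' \<in> Fo" "white e = white e'" for e e'
    using L that unfolding forced_leaves_def by blast
  have st: "v \<in> strip G Fo \<longleftrightarrow> v \<in> G \<and> (\<forall>e\<in>Fo. \<not> ends e v)" for v
    using in_incident[of _ v] unfolding strip_def by blast
  have endsG: "ends e v \<Longrightarrow> e \<in> edges_in G \<Longrightarrow> v \<in> G" for e v
    by (auto simp: edges_in_def)
  have fwd: "M \<union> Fo \<in> matchings G" and fdj: "M \<inter> Fo = {}" if M: "M \<in> matchings (strip G Fo)" for M
  proof -
    have Me: "white e \<in> strip G Fo" "black e \<in> strip G Fo" if "e \<in> M" for e
      using M that by (auto simp: matchings_def edges_in_def)
    show dj: "M \<inter> Fo = {}" using Me st by blast
    have "\<exists>!e. e \<in> M \<union> Fo \<and> ends e v" if v: "v \<in> G" for v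
    proof (cases "v \<in> strip G Fo")
      case True
      then have "\<exists>!e. e \<in> M \<and> ends e v" using M by (simp add: matchings_def)
      moreover have "\<not> ends e v" if "e \<in> Fo" for e using True st that by blast
      ultimately show ?thesis by blast
    next
      case False
      then obtain e where e: "e \<in> Fo" "ends e v" using st v by blast
      have "e' = e" if "e' \<in> M \<union> Fo" "ends e' v" for e'
      proof -
        have "e' \<notin> M" using Me that(2) False by blast
        then have e': "e' \<in> Fo" using that by blast
        show ?thesis
        proof (cases "white e = v")
          case True then show ?thesis using whinj[OF e' e(1)] that(2) white_neq_black by metis
        next
          case False
          then have "black e = v" using e by blast
          moreover have "black e' = v" using that(2) white_neq_black calculation by metis
          ultimately show ?thesis using leaf[OF e(1)] sub e' by blast
        qed
      qed
      then show ?thesis using e by blast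
    qed
    moreover have "M \<union> Fo \<subseteq> edges_in G" using sub Me st by (auto simp: edges_in_def)
    ultimately show "M \<union> Fo \<in> matchings G" by (simp add: matchings_def)
  qed
  have bwd: "Fo \<subseteq> M" "M - Fo \<in> matchings (strip G Fo)" if M: "M \<in> matchings G" for M
  proof -
    have Me: "e \<in> edges_in G" if "e \<in> M" for e using M that by (auto simp: matchings_def)
    show FM: "Fo \<subseteq> M"
    proof
      fix e assume e: "e \<in> Fo"
      then have "black e \<in> G" using sub by (auto simp: edges_in_def)
      then obtain e' where e': "e' \<in> M" "ends e' (black e)" using M by (auto simp: matchings_def)
      then have "black e' = black e" using white_neq_black by metis
      then show "e \<in> M" using leaf[OF e Me[OF e'(1)]] e' by simp
    qed
    have no: "\<not> ends d v" if "e \<in> M - Fo" "ends e v" "d \<in> Fo" for d e v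
    proof
      assume d: "ends d v"
      have "e \<in> M" "d \<in> M" "e \<notin> Fo" using that FM by auto
      then show False using matchings_ex1[OF M _ _ that(2) d] that(3) by simp
    qed
    have "M - Fo \<subseteq> edges_in (strip G Fo)"
    proof
      fix e assume e: "e \<in> M - Fo"
      have "white e \<in> G" "black e \<in> G" using Me[of e] e by (auto simp: edges_in_def)
      moreover have "\<forall>d\<in>Fo. \<not> ends d (white e)" "\<forall>d\<in>Fo. \<not> ends d (black e)" using no[OF e] by simp_all
      ultimately show "e \<in> edges_in (strip G Fo)" unfolding edges_in_def mem_Collect_eq st by simp
    qed
    moreover have "\<exists>!e. e \<in> M - Fo \<and> ends e v" if v: "v \<in> strip G Fo" for v
    proof -
      have "\<exists>!e. e \<in> M \<and> ends e v" using M v st by (simp add: matchings_def)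
      moreover have "e \<in> M - Fo \<and> ends e v \<longleftrightarrow> e \<in> M \<and> ends e v" for e using v st by blast
      ultimately show ?thesis by simp
    qed
    ultimately show "M - Fo \<in> matchings (strip G Fo)" by (simp add: matchings_def)
  qed
  show ?thesis
  proof (rule bij_betw_byWitness[where f' = "\<lambda>M. M - Fo"])
    show "\<forall>M\<in>matchings (strip G Fo). M \<union> Fo - Fo = M" using fdj by blast
    show "\<forall>M\<in>matchings G. M - Fo \<union> Fo = M" using bwd by blast
    show "(\<lambda>M. M \<union> Fo) ` matchings (strip G Fo) \<subseteq> matchings G" using fwd by blast
    show "(\<lambda>M. M - Fo) ` matchings G \<subseteq> matchings (strip G Fo)" using bwd by blast
  qed
qed

lemma wsum_strip:
  assumes L: "forced_leaves G Fo" and fin: "finite G"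
  shows "wsum v G = wt v Fo * wsum v (strip G Fo)"
proof -
  have fF: "finite Fo" using L finite_edges_in[OF fin] by (auto simp: forced_leaves_def intro: finite_subset)
  have fin_pred: "finite (strip G Fo)" using fin by (simp add: strip_def)
  have dj: "M \<inter> Fo = {}" if M: "M \<in> matchings (strip G Fo)" for M
    using pm_ends[OF M] in_incident by (fastforce simp: strip_def)
  have "wsum v G = (\<Sum>M\<in>matchings (strip G Fo). wt v (M \<union> Fo))"
    unfolding wsum_def by (rule sum.reindex_bij_betw[OF matchings_strip[OF L], symmetric])
  also have "\<dots> = (\<Sum>M\<in>matchings (strip G Fo). wt v Fo * wt v M)"
    unfolding wt_def
    by (rule sum.cong[OF refl], subst prod.union_disjoint)
      (use matchings_finite_elem[OF fin_pred] fF dj in \<open>auto simp: mult.commute\<close>)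
  finally show ?thesis by (simp add: wsum_def sum_distrib_left)
qed

definition label_count :: "edg set \<Rightarrow> nat \<Rightarrow> int" where
  "label_count M k = [kind_count E20 M + kind_count E03 M + kind_count E40 M + kind_count E05 M,
    kind_count E31 M + kind_count E12 M + kind_count E51 M + kind_count E14 M,
    kind_count E20 M + kind_count E12 M + kind_count E25 M + kind_count E42 M,
    kind_count E31 M + kind_count E53 M + kind_count E34 M + kind_count E03 M,
    kind_count E14 M + kind_count E40 M + kind_count E34 M + kind_count E42 M,
    kind_count E05 M + kind_count E51 M + kind_count E25 M + kind_count E53 M] ! k"

lemma prod6: "(\<Prod>k<6. f k) = f 0 * f 1 * f 2 * f 3 * f 4 * f (5::nat)" for f :: "nat \<Rightarrow> 'a::comm_monoid_mult"
  by (simp add: eval_nat_numeral)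

lemma wt_label_count:
  fixes v :: "nat \<Rightarrow> 'a::field"
  assumes nz: "\<And>i. i < 6 \<Longrightarrow> v i \<noteq> 0" and fin: "finite M"
  shows "wt v M = (\<Prod>k<6. v k powi - label_count M k)"
proof -
  have z: "v 0 \<noteq> 0" "v 1 \<noteq> 0" "v 2 \<noteq> 0" "v 3 \<noteq> 0" "v 4 \<noteq> 0" "v 5 \<noteq> 0" using nz by auto
  have om: "(1 / (x * y)) powi n = x powi (- n) * y powi (- n)" for x y :: 'a and n
    by (simp_all add: power_int_divide_distrib power_int_mult_distrib power_int_minus field_simps)
  have pr: "(\<Prod>k\<in>{E31, E12, E51, E14, E20, E03, E40, E05, E53, E42, E34, E25}. f k) =
    f E31 * f E12 * f E51 * f E14 * f E20 * f E03 * f E40 * f E05 * f E53 * f E42 * f E34 * f E25" for f :: "arrow \<Rightarrow> 'a"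
    by (simp add: mult_ac)
  have pa: "x powi (m + n) = x powi m * x powi n" if "x \<noteq> 0" for x :: 'a and m n
    using that by (simp add: power_int_add)
  have f6: "label_count M 0 = kind_count E20 M + kind_count E03 M + kind_count E40 M + kind_count E05 M" "label_count M 1 = kind_count E31 M + kind_count E12 M + kind_count E51 M + kind_count E14 M"
    "label_count M 2 = kind_count E20 M + kind_count E12 M + kind_count E25 M + kind_count E42 M" "label_count M 3 = kind_count E31 M + kind_count E53 M + kind_count E34 M + kind_count E03 M"
    "label_count M 4 = kind_count E14 M + kind_count E40 M + kind_count E34 M + kind_count E42 M" "label_count M 5 = kind_count E05 M + kind_count E51 M + kind_count E25 M + kind_count E53 M"
    by (simp_all add: label_count_def)
  show ?thesis
    unfolding wt_kind_count[OF fin] pr edge_wt.simps om prod6 f6 minus_add_distrib pa[OF z(1)] pa[OF z(2)] pa[OF z(3)] pa[OF z(4)] pa[OF z(5)] pa[OF z(6)]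
    by (simp only: mult_ac)
qed

lemma lin5:
  fixes q :: "int \<Rightarrow> int \<Rightarrow> bool"
  assumes "finite M" "fin_pred p" "fin_pred q" "fin_pred r" "fin_pred t"
    and pw: "\<And>a b. of_bool (p a b) - (of_bool ((k1, a + s1, b + t1) \<in> M) + of_bool ((k2, a + s2, b + t2) \<in> M) + of_bool ((k3, a + s3, b + t3) \<in> M) + of_bool ((k4, a + s4, b + t4) \<in> M)) =
       (of_bool (q a b) :: int)"
  shows "count p - (kind_count k1 M + kind_count k2 M + kind_count k3 M + kind_count k4 M) = count q"
proof -
  have fe: "fin_pred (\<lambda>a b. (k, a + s, b + t) \<in> M)" for k s t
    by (rule fin_pred_shift2) (rule fin_pred_sub[OF assms(1)], simp)
  let ?L = "[(p, 1), (\<lambda>a b. (k1, a + s1, b + t1) \<in> M, - 1), (\<lambda>a b. (k2, a + s2, b + t2) \<in> M, - 1),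
    (\<lambda>a b. (k3, a + s3, b + t3) \<in> M, - 1), (\<lambda>a b. (k4, a + s4, b + t4) \<in> M, - 1), (q, - 1)]"
  have "(\<Sum>(P, c)\<leftarrow>?L. c * count P) = 0"
  proof (rule count_linear)
    fix P assume "P \<in> fst ` set ?L" then show "fin_pred P" using assms(2-5) fe by auto
  next
    fix a b show "(\<Sum>(P, c)\<leftarrow>?L. c * of_bool (P a b)) = (0::int)" using pw[of a b] by simp
  qed
  then show ?thesis by (simp add: kind_count_shift2)
qed

text \<open>Globalises a local identity between a region and its sheared image. Here
  \<open>k1, ..., k4\<close> are the sides of a face, and \<open>s\<close> is the shift of the shear
  on faces with its label: \<open>1\<close> for the labels \<open>2\<close> and \<open>4\<close>,
  \<open>0\<close> for \<open>3\<close> and \<open>5\<close>.\<close>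

lemma lin12:
  fixes q r :: "int \<Rightarrow> int \<Rightarrow> bool"
  assumes fin: "finite M" "finite M'" and f: "fin_pred p" "fin_pred p'" "fin_pred q" "fin_pred r"
    and pw: "\<And>a b. of_bool (p a b) - (of_bool ((k1, a + s1, b + t1) \<in> M) + of_bool ((k2, a + s2, b + t2) \<in> M) + of_bool ((k3, a + s3, b + t3) \<in> M) + of_bool ((k4, a + s4, b + t4) \<in> M))
      - of_bool (p' (s - a - b) b) + (of_bool ((k1, s - a - b + s1, b + t1) \<in> M') + of_bool ((k2, s - a - b + s2, b + t2) \<in> M') + of_bool ((k3, s - a - b + s3, b + t3) \<in> M') + of_bool ((k4, s - a - b + s4, b + t4) \<in> M'))
      = (of_bool (q a b) - of_bool (r a b) :: int)"
  shows "count p - (kind_count k1 M + kind_count k2 M + kind_count k3 M + kind_count k4 M) - (count p' - (kind_count k1 M' + kind_count k2 M' + kind_count k3 M' + kind_count k4 M')) = count q - count r"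
proof -
  have fe: "fin_pred (\<lambda>a b. (k, a + s, b + t) \<in> M)" for k s t
    by (rule fin_pred_shift2) (rule fin_pred_sub[OF fin(1)], simp)
  have fe0: "fin_pred (\<lambda>a b. (k, a + s, b + t) \<in> M')" for k s t
    by (rule fin_pred_shift2) (rule fin_pred_sub[OF fin(2)], simp)
  have fe': "fin_pred (\<lambda>a b. (k, s - a - b + t, b + u) \<in> M')" for k s t u
    using fin_pred_shift1[OF fe0[of k t u], of s 0] by simp
  have fp': "fin_pred (\<lambda>a b. p' (s - a - b) b)" using fin_pred_shift1[OF f(2), of s 0] by simp
  have c': "count (\<lambda>a b. (k, s - a - b + t, b + u) \<in> M') = kind_count k M'" for k t u
    using count_shift1[of "\<lambda>a b. (k, a + t, b + u) \<in> M'" s 0] by (simp add: kind_count_shift2)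
  have cp': "count (\<lambda>a b. p' (s - a - b) b) = count p'" using count_shift1[of p' s 0] by simp
  let ?L = "[(p, 1), (\<lambda>a b. (k1, a + s1, b + t1) \<in> M, - 1), (\<lambda>a b. (k2, a + s2, b + t2) \<in> M, - 1),
    (\<lambda>a b. (k3, a + s3, b + t3) \<in> M, - 1), (\<lambda>a b. (k4, a + s4, b + t4) \<in> M, - 1), (\<lambda>a b. p' (s - a - b) b, - 1),
    (\<lambda>a b. (k1, s - a - b + s1, b + t1) \<in> M', 1), (\<lambda>a b. (k2, s - a - b + s2, b + t2) \<in> M', 1),
    (\<lambda>a b. (k3, s - a - b + s3, b + t3) \<in> M', 1), (\<lambda>a b. (k4, s - a - b + s4, b + t4) \<in> M', 1), (q, - 1), (r, 1)]"
  have "(\<Sum>(P, c)\<leftarrow>?L. c * count P) = 0"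
  proof (rule count_linear)
    fix P assume "P \<in> fst ` set ?L" then show "fin_pred P" using f(1,3,4) fp' fe fe' by auto
  next
    fix a b show "(\<Sum>(P, c)\<leftarrow>?L. c * of_bool (P a b)) = (0::int)" using pw[of a b] by simp
  qed
  then show ?thesis by (simp add: kind_count_shift2 c' cp')
qed

text \<open>
  Local forms, face by face, of the identities between the numbers of faces, forced edges and
  vertices on which the comparison of the covering monomials rests.
\<close>
definition square_counts :: "vtx set \<Rightarrow> edg set \<Rightarrow> vtx set \<Rightarrow> bool" where
  "square_counts G Fo G0 \<longleftrightarrow> (\<forall>a b. of_bool (bordered G 1 a b) - forced_at Fo 1 a b = of_bool ((Xv, a, b) \<in> G0) \<and>
     of_bool (bordered G 0 a b) - forced_at Fo 0 a b = of_bool ((Wv, a, b - 1) \<in> G0))"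

definition face_counts :: "vtx set \<Rightarrow> edg set \<Rightarrow> vtx set \<Rightarrow> vtx set \<Rightarrow> edg set \<Rightarrow> bool" where
  "face_counts G Fo G0 G' Fo' \<longleftrightarrow> (\<forall>a b.
     of_bool (bordered G 2 a b) - forced_at Fo 2 a b - of_bool (bordered G' 2 (1 - a - b) b) + forced_at Fo' 2 (1 - a - b) b
       = of_bool ((Sv, a, b - 1) \<in> G0) - of_bool ((Wv, a, b - 1) \<in> G0) \<and>
     of_bool (bordered G 3 a b) - forced_at Fo 3 a b - of_bool (bordered G' 3 (- a - b) b) + forced_at Fo' 3 (- a - b) b
       = of_bool ((Sv, a, b) \<in> G0) - of_bool ((Xv, a, b) \<in> G0) \<and>
     of_bool (bordered G 4 a b) - forced_at Fo 4 a b - of_bool (bordered G' 4 (1 - a - b) b) + forced_at Fo' 4 (1 - a - b) b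
       = of_bool ((Tv, a, b) \<in> G0) - of_bool ((Xv, a, b) \<in> G0) \<and>
     of_bool (bordered G 5 a b) - forced_at Fo 5 a b - of_bool (bordered G' 5 (- a - b) b) + forced_at Fo' 5 (- a - b) b
       = of_bool ((Tv, a + 1, b - 1) \<in> G0) - of_bool ((Wv, a, b - 1) \<in> G0))"

lemma fin_pred_disj: "fin_pred P \<Longrightarrow> fin_pred Q \<Longrightarrow> fin_pred (\<lambda>a b. P a b \<or> Q a b)"
  unfolding fin_pred_def by (rule finite_subset[of _ "{(a, b). P a b} \<union> {(a, b). Q a b}"]) auto

lemma bordered_iff: "bordered G k a b \<longleftrightarrow> (\<exists>e\<in>set (face_edge_list k a b). e \<in> edges_in G)"
  by (simp add: bordered_def edges_in_def)

lemma fin_pred_edge: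
  assumes "finite G"
  shows "fin_pred (\<lambda>a b. (k, a + s, b + t) \<in> edges_in G)"
  by (rule fin_pred_shift2) (rule fin_pred_sub[OF finite_edges_in[OF assms]], simp)

lemma fin_pred_bordered:
  assumes "finite G" "k < 6"
  shows "fin_pred (bordered G k)"
proof -
  note e = fin_pred_edge[OF assms(1)]
  have "fin_pred (\<lambda>a b. (k, a, b) \<in> edges_in G)" "fin_pred (\<lambda>a b. (k, a, b - 1) \<in> edges_in G)" "fin_pred (\<lambda>a b. (k, a, b + 1) \<in> edges_in G)"
    "fin_pred (\<lambda>a b. (k, a - 1, b) \<in> edges_in G)" "fin_pred (\<lambda>a b. (k, a - 1, b + 1) \<in> edges_in G)" "fin_pred (\<lambda>a b. (k, a + 1, b - 1) \<in> edges_in G)" for k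
    using e[of k 0 0] e[of k 0 "-1"] e[of k 0 1] e[of k "-1" 0] e[of k "-1" 1] e[of k 1 "-1"] by simp_all
  then have "fin_pred (\<lambda>a b. \<exists>e\<in>set (face_edge_list k a b). e \<in> edges_in G)"
    using assms(2) unfolding less_6_cases by (elim disjE; simp only: face_edge_list_simps list.set bex_simps; intro fin_pred_disj; simp add: fin_pred_def)
  then show ?thesis unfolding bordered_iff[abs_def] .
qed

lemma face_counts_counts:
  assumes fin: "finite G" "finite G'" "finite Fo" "finite Fo'" "finite G0" and ok: "face_counts G Fo G0 G' Fo'"
  shows "bordered_count G 2 - label_count Fo 2 - (bordered_count G' 2 - label_count Fo' 2) = num_vtx Sv G0 - num_vtx Wv G0"
    "bordered_count G 3 - label_count Fo 3 - (bordered_count G' 3 - label_count Fo' 3) = num_vtx Sv G0 - num_vtx Xv G0"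
    "bordered_count G 4 - label_count Fo 4 - (bordered_count G' 4 - label_count Fo' 4) = num_vtx Tv G0 - num_vtx Xv G0"
    "bordered_count G 5 - label_count Fo 5 - (bordered_count G' 5 - label_count Fo' 5) = num_vtx Tv G0 - num_vtx Wv G0"
proof -
  note o = ok[unfolded face_counts_def forced_at_def, rule_format]
  have fv: "fin_pred (\<lambda>a b. (k, a + s, b + t) \<in> G0)" for k s t
    by (rule fin_pred_shift2) (rule fin_pred_sub[OF fin(5)], simp)
  have v: "fin_pred (\<lambda>a b. (k, a, b) \<in> G0)" "fin_pred (\<lambda>a b. (k, a, b - 1) \<in> G0)" "fin_pred (\<lambda>a b. (k, a + 1, b - 1) \<in> G0)" for k
    using fv[of k 0 0] fv[of k 0 "-1"] fv[of k 1 "-1"] by simp_all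
  have c: "count (\<lambda>a b. (k, a, b) \<in> G0) = num_vtx k G0" "count (\<lambda>a b. (k, a, b - 1) \<in> G0) = num_vtx k G0" "count (\<lambda>a b. (k, a + 1, b - 1) \<in> G0) = num_vtx k G0" for k
    using count_shift2[of "\<lambda>a b. (k, a, b) \<in> G0" 0 0] count_shift2[of "\<lambda>a b. (k, a, b) \<in> G0" 0 "-1"] count_shift2[of "\<lambda>a b. (k, a, b) \<in> G0" 1 "-1"] by (simp_all add: num_vtx_def)
  note fb = fin_pred_bordered[OF fin(1)] fin_pred_bordered[OF fin(2)]
  have "of_bool (bordered G 2 a b) - (of_bool ((E20, a + 0, b + 0) \<in> Fo) + of_bool ((E12, a + 0, b + - 1) \<in> Fo) + of_bool ((E25, a + - 1, b + 0) \<in> Fo) + of_bool ((E42, a + 0, b + 0) \<in> Fo)) - of_bool (bordered G' 2 (1 - a - b) b) + (of_bool ((E20, 1 - a - b + 0, b + 0) \<in> Fo') + of_bool ((E12, 1 - a - b + 0, b + - 1) \<in> Fo') + of_bool ((E25, 1 - a - b + - 1, b + 0) \<in> Fo') + of_bool ((E42, 1 - a - b + 0, b + 0) \<in> Fo')) = (of_bool ((Sv, a, b - 1) \<in> G0) - of_bool ((Wv, a, b - 1) \<in> G0) :: int)" for a b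
    using o[of a b] by (simp add: face_edge_list_simps add_ac)
  note lin12[OF fin(3,4) fb(1) fb(2) v(2)[of Sv] v(2)[of Wv], of 2 2 E20 0 0 E12 0 "- 1" E25 "- 1" 0 E42 0 0 1, OF _ _ this]
  then show "bordered_count G 2 - label_count Fo 2 - (bordered_count G' 2 - label_count Fo' 2) = num_vtx Sv G0 - num_vtx Wv G0"
    by (simp add: bordered_count_def label_count_def c)
  have "of_bool (bordered G 3 a b) - (of_bool ((E31, a + 0, b + 0) \<in> Fo) + of_bool ((E53, a + 0, b + 0) \<in> Fo) + of_bool ((E34, a + 0, b + 0) \<in> Fo) + of_bool ((E03, a + 0, b + 1) \<in> Fo)) - of_bool (bordered G' 3 (0 - a - b) b) + (of_bool ((E31, 0 - a - b + 0, b + 0) \<in> Fo') + of_bool ((E53, 0 - a - b + 0, b + 0) \<in> Fo') + of_bool ((E34, 0 - a - b + 0, b + 0) \<in> Fo') + of_bool ((E03, 0 - a - b + 0, b + 1) \<in> Fo')) = (of_bool ((Sv, a, b) \<in> G0) - of_bool ((Xv, a, b) \<in> G0) :: int)" for a b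
    using o[of a b] by (simp add: face_edge_list_simps add_ac)
  note lin12[OF fin(3,4) fb(1) fb(2) v(1)[of Sv] v(1)[of Xv], of 3 3 E31 0 0 E53 0 0 E34 0 0 E03 0 1 0, OF _ _ this]
  then show "bordered_count G 3 - label_count Fo 3 - (bordered_count G' 3 - label_count Fo' 3) = num_vtx Sv G0 - num_vtx Xv G0"
    by (simp add: bordered_count_def label_count_def c)
  have "of_bool (bordered G 4 a b) - (of_bool ((E14, a + 0, b + 0) \<in> Fo) + of_bool ((E40, a + - 1, b + 1) \<in> Fo) + of_bool ((E34, a + - 1, b + 0) \<in> Fo) + of_bool ((E42, a + 0, b + 0) \<in> Fo)) - of_bool (bordered G' 4 (1 - a - b) b) + (of_bool ((E14, 1 - a - b + 0, b + 0) \<in> Fo') + of_bool ((E40, 1 - a - b + - 1, b + 1) \<in> Fo') + of_bool ((E34, 1 - a - b + - 1, b + 0) \<in> Fo') + of_bool ((E42, 1 - a - b + 0, b + 0) \<in> Fo')) = (of_bool ((Tv, a, b) \<in> G0) - of_bool ((Xv, a, b) \<in> G0) :: int)" for a b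
    using o[of a b] by (simp add: face_edge_list_simps add_ac)
  note lin12[OF fin(3,4) fb(1) fb(2) v(1)[of Tv] v(1)[of Xv], of 4 4 E14 0 0 E40 "- 1" 1 E34 "- 1" 0 E42 0 0 1, OF _ _ this]
  then show "bordered_count G 4 - label_count Fo 4 - (bordered_count G' 4 - label_count Fo' 4) = num_vtx Tv G0 - num_vtx Xv G0"
    by (simp add: bordered_count_def label_count_def c)
  have "of_bool (bordered G 5 a b) - (of_bool ((E05, a + 0, b + 0) \<in> Fo) + of_bool ((E51, a + 1, b + - 1) \<in> Fo) + of_bool ((E25, a + 0, b + 0) \<in> Fo) + of_bool ((E53, a + 0, b + 0) \<in> Fo)) - of_bool (bordered G' 5 (0 - a - b) b) + (of_bool ((E05, 0 - a - b + 0, b + 0) \<in> Fo') + of_bool ((E51, 0 - a - b + 1, b + - 1) \<in> Fo') + of_bool ((E25, 0 - a - b + 0, b + 0) \<in> Fo') + of_bool ((E53, 0 - a - b + 0, b + 0) \<in> Fo')) = (of_bool ((Tv, a + 1, b - 1) \<in> G0) - of_bool ((Wv, a, b - 1) \<in> G0) :: int)" for a b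
    using o[of a b] by (simp add: face_edge_list_simps add_ac)
  note lin12[OF fin(3,4) fb(1) fb(2) v(3)[of Tv] v(2)[of Wv], of 5 5 E05 0 0 E51 1 "- 1" E25 0 0 E53 0 0 0, OF _ _ this]
  then show "bordered_count G 5 - label_count Fo 5 - (bordered_count G' 5 - label_count Fo' 5) = num_vtx Tv G0 - num_vtx Wv G0"
    by (simp add: bordered_count_def label_count_def c)
qed

lemma square_counts_counts:
  assumes fin: "finite G" "finite Fo" "finite G0" and ok: "square_counts G Fo G0"
  shows "bordered_count G 1 - label_count Fo 1 = num_vtx Xv G0" "bordered_count G 0 - label_count Fo 0 = num_vtx Wv G0"
proof -
  note o = ok[unfolded square_counts_def forced_at_def, rule_format]
  have v: "fin_pred (\<lambda>a b. (k, a, b) \<in> G0)" "fin_pred (\<lambda>a b. (k, a, b - 1) \<in> G0)" for k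
    using fin_pred_shift2[OF fin_pred_sub[OF fin(3), of "\<lambda>a b. (k, a, b) \<in> G0" k], of 0 0]
      fin_pred_shift2[OF fin_pred_sub[OF fin(3), of "\<lambda>a b. (k, a, b) \<in> G0" k], of 0 "-1"] by simp_all
  have c: "count (\<lambda>a b. (k, a, b) \<in> G0) = num_vtx k G0" "count (\<lambda>a b. (k, a, b - 1) \<in> G0) = num_vtx k G0" for k
    using count_shift2[of "\<lambda>a b. (k, a, b) \<in> G0" 0 0] count_shift2[of "\<lambda>a b. (k, a, b) \<in> G0" 0 "-1"] by (simp_all add: num_vtx_def)
  have f0: "fin_pred (\<lambda>a b. False)" by (simp add: fin_pred_def)
  note fb = fin_pred_bordered[OF fin(1)]
  have "of_bool (bordered G 1 a b) - (of_bool ((E31, a + 0, b + 0) \<in> Fo) + of_bool ((E12, a + 0, b + 0) \<in> Fo) + of_bool ((E51, a + 0, b + 0) \<in> Fo) + of_bool ((E14, a + 0, b + 0) \<in> Fo)) = (of_bool ((Xv, a, b) \<in> G0) :: int)" for a b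
    using o[of a b] face_edge_list_simps[of a b] by (simp add: add_ac)
  note lin5[OF fin(2) fb v(1)[of Xv] f0 f0, of 1 E31 0 0 E12 0 0 E51 0 0 E14 0 0, OF _ this]
  then show "bordered_count G 1 - label_count Fo 1 = num_vtx Xv G0"
    by (simp add: bordered_count_def label_count_def c)
  have "of_bool (bordered G 0 a b) - (of_bool ((E20, a + 0, b + 0) \<in> Fo) + of_bool ((E03, a + 0, b + 0) \<in> Fo) + of_bool ((E40, a + 0, b + 0) \<in> Fo) + of_bool ((E05, a + 0, b + 0) \<in> Fo)) = (of_bool ((Wv, a, b - 1) \<in> G0) :: int)" for a b
    using o[of a b] face_edge_list_simps[of a b] by (simp add: add_ac)
  note lin5[OF fin(2) fb v(2)[of Wv] f0 f0, of 0 E20 0 0 E03 0 0 E40 0 0 E05 0 0, OF _ this]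
  then show "bordered_count G 0 - label_count Fo 0 = num_vtx Wv G0"
    by (simp add: bordered_count_def label_count_def c)
qed

lemma num_vtx_shuffle:
  assumes "shuffle_rel G G'"
  shows "num_vtx Wv G' = num_vtx Xv G" "num_vtx Xv G' = num_vtx Wv G"
proof -
  note r = shuffle_rel_sym[OF assms, unfolded shuffle_rel_def, THEN conjunct1, rule_format]
  have "(Wv, a, b) \<in> G' \<longleftrightarrow> (Xv, - a - b, b) \<in> G" "(Xv, a, b) \<in> G' \<longleftrightarrow> (Wv, - a - b, b) \<in> G" for a b
    using r[of a b] by simp_all
  then show "num_vtx Wv G' = num_vtx Xv G" "num_vtx Xv G' = num_vtx Wv G"
    unfolding num_vtx_def using count_shift1[of "\<lambda>a b. (Xv, a, b) \<in> G" 0 0] count_shift1[of "\<lambda>a b. (Wv, a, b) \<in> G" 0 0] by simp_all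
qed

text \<open>The weights of forced edges merge with the covering monomial, leaving as exponents the
  numbers of border faces minus those of forced sides. By the local counts these change from one
  region to the other exactly so as to cancel \<open>shuffle_factor\<close>. The correction
  \<open>d\<close> covers a deviation at label \<open>1\<close>; it is \<open>1\<close> for the
  single edge that ends the recursion and \<open>0\<close> otherwise.\<close>

theorem shuffle_c_value:
  fixes v :: "nat \<Rightarrow> 'a::field"
  assumes nz: "\<And>i. i < 6 \<Longrightarrow> v i \<noteq> 0" and A: "exch_num v \<noteq> 0" and fin: "finite G" "finite G'"
    and L: "forced_leaves G Fo" "forced_leaves G' Fo'" and G0: "strip G Fo = G0" "strip G' Fo' = G0'"
    and R: "shuffle_rel G0 G0'" and ok: "face_counts G Fo G0 G' Fo'" and sq: "square_counts G Fo G0"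
    and sq': "bordered_count G' 1 - label_count Fo' 1 + d = num_vtx Xv G0'" "bordered_count G' 0 - label_count Fo' 0 = num_vtx Wv G0'"
  shows "c_value v G = c_value (shuffle_vars v) G' * (exch_num v / v 0) powi d"
proof -
  have z: "v 0 \<noteq> 0" "v 1 \<noteq> 0" "v 2 \<noteq> 0" "v 3 \<noteq> 0" "v 4 \<noteq> 0" "v 5 \<noteq> 0" using nz by auto
  have z': "shuffle_vars v i \<noteq> 0" if "i < 6" for i using nz[OF that] z A by (simp add: shuffle_vars_def)
  have fF: "finite Fo" "finite Fo'" using L finite_edges_in fin by (auto simp: forced_leaves_def intro: finite_subset)
  have f0: "finite G0" "finite G0'" using fin G0 by (auto simp: strip_def)
  have sv: "shuffle_vars v 0 = exch_num v / v 1" "shuffle_vars v 1 = exch_num v / v 0" "shuffle_vars v 2 = v 2" "shuffle_vars v 3 = v 3" "shuffle_vars v 4 = v 4" "shuffle_vars v 5 = v 5"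
    by (simp_all add: shuffle_vars_def)
  note c = face_counts_counts[OF fin fF f0(1) ok] square_counts_counts[OF fin(1) fF(1) f0(1) sq] sq' num_vtx_shuffle[OF R]
  define e e' where "e k = bordered_count G k - label_count Fo k" and "e' k = bordered_count G' k - label_count Fo' k" for k
  have cv: "c_value u H = wsum u (strip H F) * (\<Prod>k<6. u k powi (bordered_count H k - label_count F k))"
    if "forced_leaves H F" "finite H" "finite F" "\<And>i. i < 6 \<Longrightarrow> u i \<noteq> 0" for u :: "nat \<Rightarrow> 'a" and H F
  proof -
    have "(\<Prod>k<6. u k powi - label_count F k) * (\<Prod>k<6. u k powi bordered_count H k) = (\<Prod>k<6. u k powi (bordered_count H k - label_count F k))"
      unfolding prod.distrib[symmetric] by (rule prod.cong) (use that(4) in \<open>auto simp: power_int_diff power_int_minus field_simps\<close>)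
    then show ?thesis unfolding c_value_def wsum_strip[OF that(1,2)] using wt_label_count[where v = u and M = F] that(3,4)
      by (simp add: mult_ac)
  qed
  have 1: "c_value v G = wsum v G0 * (\<Prod>k<6. v k powi e k)"
    using cv[OF L(1) fin(1) fF(1), of v] nz G0 by (simp add: e_def)
  have 2: "c_value (shuffle_vars v) G' = wsum (shuffle_vars v) G0' * (\<Prod>k<6. shuffle_vars v k powi e' k)"
    using cv[OF L(2) fin(2) fF(2), of "shuffle_vars v"] z' G0 by (simp add: e'_def)
  have 3: "wsum v G0 = shuffle_factor v G0 * wsum (shuffle_vars v) G0'"
    by (rule wsum_shuffle[where v = v]) (use nz A f0 R in auto)
  have ee: "e 0 = num_vtx Wv G0" "e 1 = num_vtx Xv G0" "e 2 = e' 2 + num_vtx Sv G0 - num_vtx Wv G0" "e 3 = e' 3 + num_vtx Sv G0 - num_vtx Xv G0"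
     "e 4 = e' 4 + num_vtx Tv G0 - num_vtx Xv G0" "e 5 = e' 5 + num_vtx Tv G0 - num_vtx Wv G0" "e' 0 = num_vtx Xv G0" "e' 1 = num_vtx Wv G0 - d"
    using c by (simp_all add: e_def e'_def)
  have "shuffle_factor v G0 * (\<Prod>k<6. v k powi e k) = (\<Prod>k<6. shuffle_vars v k powi e' k) * (exch_num v / v 0) powi d"
  proof -
    have "x powi (W + X) * y powi (- 2 * W) * z powi (- 2 * X) * s powi (W - S) * t powi (X - S) * u powi (X - T) * w powi (W - T) *
      (y powi W * z powi X * s powi (s' + S - W) * t powi (t' + S - X) * u powi (u' + T - X) * w powi (w' + T - W)) =
      ((x / z) powi X * (x / y) powi (W - d) * s powi s' * t powi t' * u powi u' * w powi w') * (x / y) powi d"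
      if nz: "x \<noteq> 0" "y \<noteq> 0" "z \<noteq> 0" "s \<noteq> 0" "t \<noteq> 0" "u \<noteq> 0" "w \<noteq> 0" for x y z s t u w :: 'a and W X S T s' t' u' w'
    proof -
      have 1: "y powi (- 2 * W) * y powi W = inverse (y powi W)" "z powi (- 2 * X) * z powi X = inverse (z powi X)"
        using nz by (simp_all flip: power_int_add power_int_minus)
      have 2: "s powi (W - S) * s powi (s' + S - W) = s powi s'" "t powi (X - S) * t powi (t' + S - X) = t powi t'"
         "u powi (X - T) * u powi (u' + T - X) = u powi u'" "w powi (W - T) * w powi (w' + T - W) = w powi w'"
        using nz by (simp_all flip: power_int_add)
      have 3: "(x / y) powi (W - d) * (x / y) powi d = x powi W * inverse (y powi W)"
        using nz power_int_add[of "x / y" "W - d" d] by (simp add: power_int_divide_distrib) (simp add: divide_inverse)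
      have 4: "(x / z) powi X = x powi X * inverse (z powi X)" "x powi (W + X) = x powi W * x powi X"
        using nz by (simp_all add: power_int_divide_distrib power_int_add) (simp add: divide_inverse)
      have "x powi (W + X) * y powi (- 2 * W) * z powi (- 2 * X) * s powi (W - S) * t powi (X - S) * u powi (X - T) * w powi (W - T) *
        (y powi W * z powi X * s powi (s' + S - W) * t powi (t' + S - X) * u powi (u' + T - X) * w powi (w' + T - W)) =
        x powi (W + X) * (y powi (- 2 * W) * y powi W) * (z powi (- 2 * X) * z powi X) * (s powi (W - S) * s powi (s' + S - W)) *
        (t powi (X - S) * t powi (t' + S - X)) * (u powi (X - T) * u powi (u' + T - X)) * (w powi (W - T) * w powi (w' + T - W))"
        by (simp only: mult_ac)
      also have "\<dots> = (x powi X * inverse (z powi X)) * (x powi W * inverse (y powi W)) * s powi s' * t powi t' * u powi u' * w powi w'"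
        unfolding 1 2 4 by (simp only: mult_ac)
      also have "\<dots> = (x / z) powi X * (x / y) powi (W - d) * s powi s' * t powi t' * u powi u' * w powi w' * (x / y) powi d"
        unfolding 3[symmetric] 4(1)[symmetric] by (simp only: mult_ac)
      finally show ?thesis .
    qed
    from this[OF A z(1-6)] show ?thesis unfolding shuffle_factor_def prod6 ee sv .
  qed
  then show ?thesis unfolding 1 2 3 by (simp add: mult_ac)
qed

section \<open>The regions\<close>

text \<open>
  A strip with two notches cut out of its ends; \<open>regI\<close> and \<open>regII\<close> are bounded by the contours of the two
  types of castles, \<open>regRII\<close> and \<open>regRI\<close> are rotations of them (see \<open>rot_vtx_regII\<close>, \<open>rot_vtx_regRI\<close>), and
  the cores are what remains after the removal of forced edges.
\<close>

fun mem_regI :: "int \<Rightarrow> int \<Rightarrow> vtx \<Rightarrow> bool" where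
  "mem_regI i j (Ov, a, b) = (- i \<le> a \<and> a \<le> j - 1 \<and> \<not> (1 \<le> a + b \<and> 1 \<le> b) \<and> \<not> (a + b \<le> - i - 1 \<and> b \<le> - j - 1))"
| "mem_regI i j (Hv, a, b) = (- i - 1 \<le> a \<and> a \<le> j - 1 \<and> \<not> (0 \<le> a + b \<and> 0 \<le> b) \<and> \<not> (a + b \<le> - i - 1 \<and> b \<le> - j))"
| "mem_regI i j (Sv, a, b) = (- i - 1 \<le> a \<and> a \<le> j \<and> \<not> (0 \<le> a + b \<and> 0 \<le> b) \<and> \<not> (a + b \<le> - i - 1 \<and> b \<le> - j - 1))"
| "mem_regI i j (Tv, a, b) = (- i \<le> a \<and> a \<le> j \<and> \<not> (0 \<le> a + b \<and> 0 \<le> b) \<and> \<not> (a + b \<le> - i \<and> b \<le> - j - 1))"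
| "mem_regI i j (Wv, a, b) = (- i - 1 \<le> a \<and> a \<le> j - 1 \<and> \<not> (0 \<le> a + b \<and> 0 \<le> b) \<and> \<not> (a + b \<le> - i - 1 \<and> b \<le> - j - 1))"
| "mem_regI i j (Xv, a, b) = (- i \<le> a \<and> a \<le> j \<and> \<not> (0 \<le> a + b \<and> 0 \<le> b) \<and> \<not> (a + b \<le> - i - 1 \<and> b \<le> - j - 1))"

definition "regI i j = {v. mem_regI i j v}"

fun mem_coreI :: "int \<Rightarrow> int \<Rightarrow> vtx \<Rightarrow> bool" where
  "mem_coreI i j (Ov, a, b) = (- i \<le> a \<and> a \<le> j - 1 \<and> \<not> (1 \<le> a + b \<and> 1 \<le> b) \<and> \<not> (a + b \<le> - i - 1 \<and> b \<le> - j - 1))"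
| "mem_coreI i j (Hv, a, b) = (- i - 1 \<le> a \<and> a \<le> j - 1 \<and> \<not> (0 \<le> a + b \<and> 0 \<le> b) \<and> \<not> (a + b \<le> - i - 1 \<and> b \<le> - j))"
| "mem_coreI i j (Sv, a, b) = (- i \<le> a \<and> a \<le> j - 1 \<and> \<not> (0 \<le> a + b \<and> 0 \<le> b) \<and> \<not> (a + b \<le> - i - 1 \<and> b \<le> - j - 1))"
| "mem_coreI i j (Tv, a, b) = (- i \<le> a \<and> a \<le> j \<and> \<not> (0 \<le> a + b \<and> 0 \<le> b) \<and> \<not> (a + b \<le> - i \<and> b \<le> - j - 1))"
| "mem_coreI i j (Wv, a, b) = (- i \<le> a \<and> a \<le> j - 1 \<and> \<not> (0 \<le> a + b \<and> 0 \<le> b) \<and> \<not> (a + b \<le> - i - 1 \<and> b \<le> - j - 1))"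
| "mem_coreI i j (Xv, a, b) = (- i \<le> a \<and> a \<le> j - 1 \<and> \<not> (0 \<le> a + b \<and> 0 \<le> b) \<and> \<not> (a + b \<le> - i - 1 \<and> b \<le> - j - 1))"

definition "coreI i j = {v. mem_coreI i j v}"

fun mem_regII :: "int \<Rightarrow> int \<Rightarrow> vtx \<Rightarrow> bool" where
  "mem_regII i j (Ov, a, b) = (1 - j \<le> a + b \<and> a + b \<le> i + 1 \<and> \<not> (a \<le> 0 \<and> 0 \<le> b) \<and> \<not> (i + 1 \<le> a \<and> b \<le> - j))"
| "mem_regII i j (Hv, a, b) = (1 - j \<le> a + b \<and> a + b \<le> i \<and> \<not> (a \<le> - 1 \<and> 1 \<le> b) \<and> \<not> (i + 1 \<le> a \<and> b \<le> - j - 1))"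
| "mem_regII i j (Sv, a, b) = (1 - j \<le> a + b \<and> a + b \<le> i \<and> \<not> (a \<le> - 1 \<and> 0 \<le> b) \<and> \<not> (i + 2 \<le> a \<and> b \<le> - j - 1))"
| "mem_regII i j (Tv, a, b) = (2 - j \<le> a + b \<and> a + b \<le> i \<and> \<not> (a \<le> 0 \<and> 0 \<le> b) \<and> \<not> (i + 2 \<le> a \<and> b \<le> - j - 1))"
| "mem_regII i j (Wv, a, b) = (1 - j \<le> a + b \<and> a + b \<le> i \<and> \<not> (a \<le> - 1 \<and> 0 \<le> b) \<and> \<not> (i + 1 \<le> a \<and> b \<le> - j - 1))"
| "mem_regII i j (Xv, a, b) = (1 - j \<le> a + b \<and> a + b \<le> i \<and> \<not> (a \<le> 0 \<and> 0 \<le> b) \<and> \<not> (i + 2 \<le> a \<and> b \<le> - j - 1))"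

definition "regII i j = {v. mem_regII i j v}"

fun mem_coreII :: "int \<Rightarrow> int \<Rightarrow> vtx \<Rightarrow> bool" where
  "mem_coreII i j (Ov, a, b) = (1 - j \<le> a + b \<and> a + b \<le> i + 1 \<and> \<not> (a \<le> 0 \<and> 0 \<le> b) \<and> \<not> (i + 1 \<le> a \<and> b \<le> - j))"
| "mem_coreII i j (Hv, a, b) = (1 - j \<le> a + b \<and> a + b \<le> i \<and> \<not> (a \<le> - 1 \<and> 1 \<le> b) \<and> \<not> (i + 1 \<le> a \<and> b \<le> - j - 1))"
| "mem_coreII i j (Sv, a, b) = (1 - j \<le> a + b \<and> a + b \<le> i \<and> \<not> (a \<le> 0 \<and> 0 \<le> b) \<and> \<not> (i + 1 \<le> a \<and> b \<le> - j - 1))"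
| "mem_coreII i j (Tv, a, b) = (2 - j \<le> a + b \<and> a + b \<le> i \<and> \<not> (a \<le> 0 \<and> 0 \<le> b) \<and> \<not> (i + 2 \<le> a \<and> b \<le> - j - 1))"
| "mem_coreII i j (Wv, a, b) = (1 - j \<le> a + b \<and> a + b \<le> i \<and> \<not> (a \<le> 0 \<and> 0 \<le> b) \<and> \<not> (i + 1 \<le> a \<and> b \<le> - j - 1))"
| "mem_coreII i j (Xv, a, b) = (1 - j \<le> a + b \<and> a + b \<le> i \<and> \<not> (a \<le> 0 \<and> 0 \<le> b) \<and> \<not> (i + 1 \<le> a \<and> b \<le> - j - 1))"

definition "coreII i j = {v. mem_coreII i j v}"

fun mem_regRII :: "int \<Rightarrow> int \<Rightarrow> vtx \<Rightarrow> bool" where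
  "mem_regRII i j (Ov, a, b) = (1 - j \<le> b \<and> b \<le> i + 1 \<and> \<not> (a + b \<le> 0 \<and> a \<le> 0) \<and> \<not> (i + 1 \<le> a + b \<and> j \<le> a))"
| "mem_regRII i j (Hv, a, b) = (2 - j \<le> b \<and> b \<le> i \<and> \<not> (a + b \<le> - 1 \<and> a \<le> - 1) \<and> \<not> (i + 1 \<le> a + b \<and> j \<le> a))"
| "mem_regRII i j (Sv, a, b) = (1 - j \<le> b \<and> b \<le> i \<and> \<not> (a + b \<le> - 1 \<and> a \<le> - 1) \<and> \<not> (i + 1 \<le> a + b \<and> j + 1 \<le> a))"
| "mem_regRII i j (Tv, a, b) = (1 - j \<le> b \<and> b \<le> i \<and> \<not> (a + b \<le> - 1 \<and> a \<le> 0) \<and> \<not> (i + 2 \<le> a + b \<and> j + 1 \<le> a))"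
| "mem_regRII i j (Wv, a, b) = (1 - j \<le> b \<and> b \<le> i \<and> \<not> (a + b \<le> - 1 \<and> a \<le> - 1) \<and> \<not> (i + 1 \<le> a + b \<and> j \<le> a))"
| "mem_regRII i j (Xv, a, b) = (1 - j \<le> b \<and> b \<le> i \<and> \<not> (a + b \<le> - 1 \<and> a \<le> 0) \<and> \<not> (i + 1 \<le> a + b \<and> j + 1 \<le> a))"

definition "regRII i j = {v. mem_regRII i j v}"

fun mem_coreRII :: "int \<Rightarrow> int \<Rightarrow> vtx \<Rightarrow> bool" where
  "mem_coreRII i j (Ov, a, b) = (1 - j \<le> b \<and> b \<le> i + 1 \<and> \<not> (a + b \<le> 0 \<and> a \<le> 0) \<and> \<not> (i + 1 \<le> a + b \<and> j \<le> a))"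
| "mem_coreRII i j (Hv, a, b) = (2 - j \<le> b \<and> b \<le> i \<and> \<not> (a + b \<le> - 1 \<and> a \<le> - 1) \<and> \<not> (i + 1 \<le> a + b \<and> j \<le> a))"
| "mem_coreRII i j (Sv, a, b) = (1 - j \<le> b \<and> b \<le> i \<and> \<not> (a + b \<le> - 1 \<and> a \<le> 0) \<and> \<not> (i + 1 \<le> a + b \<and> j \<le> a))"
| "mem_coreRII i j (Tv, a, b) = (1 - j \<le> b \<and> b \<le> i \<and> \<not> (a + b \<le> 0 \<and> a \<le> 0) \<and> \<not> (i + 1 \<le> a + b \<and> j + 1 \<le> a))"
| "mem_coreRII i j (Wv, a, b) = (1 - j \<le> b \<and> b \<le> i \<and> \<not> (a + b \<le> - 1 \<and> a \<le> 0) \<and> \<not> (i \<le> a + b \<and> j \<le> a))"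
| "mem_coreRII i j (Xv, a, b) = (1 - j \<le> b \<and> b \<le> i \<and> \<not> (a + b \<le> 0 \<and> a \<le> 0) \<and> \<not> (i + 1 \<le> a + b \<and> j \<le> a))"

definition "coreRII i j = {v. mem_coreRII i j v}"

fun mem_regRI :: "int \<Rightarrow> int \<Rightarrow> vtx \<Rightarrow> bool" where
  "mem_regRI i j (Ov, a, b) = (2 - j \<le> b \<and> b \<le> i \<and> \<not> (1 \<le> a \<and> 1 \<le> a + b) \<and> \<not> (a \<le> - i - 1 \<and> a + b \<le> - j))"
| "mem_regRI i j (Hv, a, b) = (1 - j \<le> b \<and> b \<le> i + 1 \<and> \<not> (0 \<le> a \<and> 0 \<le> a + b) \<and> \<not> (a \<le> - i - 1 \<and> a + b \<le> - j))"
| "mem_regRI i j (Sv, a, b) = (1 - j \<le> b \<and> b \<le> i \<and> \<not> (0 \<le> a \<and> 0 \<le> a + b) \<and> \<not> (a \<le> - i \<and> a + b \<le> - j))"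
| "mem_regRI i j (Tv, a, b) = (1 - j \<le> b \<and> b \<le> i \<and> \<not> (1 \<le> a \<and> 0 \<le> a + b) \<and> \<not> (a \<le> - i \<and> a + b \<le> 1 - j))"
| "mem_regRI i j (Wv, a, b) = (1 - j \<le> b \<and> b \<le> i \<and> \<not> (0 \<le> a \<and> 0 \<le> a + b) \<and> \<not> (a \<le> - i - 1 \<and> a + b \<le> - j))"
| "mem_regRI i j (Xv, a, b) = (1 - j \<le> b \<and> b \<le> i \<and> \<not> (1 \<le> a \<and> 0 \<le> a + b) \<and> \<not> (a \<le> - i \<and> a + b \<le> - j))"

definition "regRI i j = {v. mem_regRI i j v}"

lemmas reg_defs = regI_def coreI_def regII_def coreII_def regRII_def coreRII_def regRI_def

text \<open>The pendant edges on the boundary: along the outermost columns \<open>a = j\<close> and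
  \<open>a = - i - 1\<close> for \<open>regI\<close>, along the sides of the two notches for
  \<open>regII\<close> and \<open>regRII\<close>.\<close>

fun mem_forcedI :: "int \<Rightarrow> int \<Rightarrow> edg \<Rightarrow> bool" where
  "mem_forcedI i j (k, a, b) = (k = E12 \<and> a = j \<and> mem_regI i j (Sv, a, b) \<or> k = E03 \<and> a = - i - 1 \<and> mem_regI i j (Sv, a, b - 1))"
fun mem_forcedII :: "int \<Rightarrow> int \<Rightarrow> edg \<Rightarrow> bool" where
  "mem_forcedII i j (k, a, b) = (k = E03 \<and> a = 0 \<and> b \<ge> 1 \<and> mem_regII i j (Sv, a, b - 1) \<or> k = E12 \<and> a = i + 1 \<and> b \<le> - j - 1 \<and> mem_regII i j (Sv, a, b))"
fun mem_forcedRII :: "int \<Rightarrow> int \<Rightarrow> edg \<Rightarrow> bool" where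
  "mem_forcedRII i j (k, a, b) = (k = E51 \<and> a + b = 0 \<and> b \<ge> 0 \<and> mem_regRII i j (Tv, a, b) \<or> k = E03 \<and> a = 0 \<and> b \<le> 0 \<and> mem_regRII i j (Sv, a, b - 1)
     \<or> k = E12 \<and> a = j \<and> a + b \<ge> i + 1 \<and> mem_regRII i j (Sv, a, b) \<or> k = E40 \<and> a + b = i + 1 \<and> a \<ge> j \<and> mem_regRII i j (Tv, a + 1, b - 1))"

definition "FoA i j = {e. mem_forcedI i j e}"
definition "FoA' i j = {e. mem_forcedII i j e}"
definition "FoB i j = {e. mem_forcedRII i j e}"

lemmas mem_defs = FoA_def FoA'_def FoB_def reg_defs mem_Collect_eq

lemma strip_iff: "v \<in> strip G Fo \<longleftrightarrow> v \<in> G \<and> list_all (\<lambda>e. e \<notin> Fo) (incident v)"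
  by (simp add: strip_def list_all_iff)

lemma finite_cells:
  assumes "\<And>k a b. (k, a, b) \<in> G \<Longrightarrow> \<bar>a\<bar> \<le> N \<and> \<bar>b\<bar> \<le> N"
  shows "finite (G :: vtx set)"
proof -
  have "G \<subseteq> {Ov, Hv, Sv, Tv, Wv, Xv} \<times> {-N..N} \<times> {-N..N}"
  proof
    fix v assume "v \<in> G"
    moreover obtain k a b where "v = (k, a, b)" by (cases v)
    ultimately show "v \<in> {Ov, Hv, Sv, Tv, Wv, Xv} \<times> {-N..N} \<times> {-N..N}"
      using assms[of k a b] by (cases k) auto
  qed
  then show ?thesis by (rule finite_subset) simp
qed

lemma finite_regI: "finite (regI i j)"
  by (rule finite_cells[of _ "2 * \<bar>i\<bar> + 2 * \<bar>j\<bar> + 5"]) (case_tac k; simp add: mem_defs; linarith)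
lemma finite_regII: "finite (regII i j)"
  by (rule finite_cells[of _ "2 * \<bar>i\<bar> + 2 * \<bar>j\<bar> + 5"]) (case_tac k; simp add: mem_defs; linarith)
lemma finite_regRII: "finite (regRII i j)"
  by (rule finite_cells[of _ "2 * \<bar>i\<bar> + 2 * \<bar>j\<bar> + 5"]) (case_tac k; simp add: mem_defs; linarith)
lemma finite_regRI: "finite (regRI i j)"
  by (rule finite_cells[of _ "2 * \<bar>i\<bar> + 2 * \<bar>j\<bar> + 5"]) (case_tac k; simp add: mem_defs; linarith)


section \<open>Forced edges and cores of the regions\<close>

lemma forced_leaves_regI: assumes ij: "i \<ge> 0" "j \<ge> 1" shows "forced_leaves (regI i j) (FoA i j)"
proof -
  have 1: "white e \<in> regI i j \<and> black e \<in> regI i j" if "e \<in> FoA i j" for e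
    using that ij by (cases e; auto simp: mem_defs)
  have 2: "white e' \<notin> regI i j" if "e \<in> FoA i j" "e' \<in> set (incident (black e))" "e' \<noteq> e" for e e'
    using that ij by (cases e; auto simp: mem_defs)
  have 3: "e = e'" if "e \<in> FoA i j" "e' \<in> FoA i j" "white e = white e'" for e e'
    using that ij by (cases e; cases e'; auto simp: mem_defs)
  show ?thesis using 1 2 3 unfolding forced_leaves_def edges_in_def by (intro conjI subsetI ballI allI impI; simp)
qed

lemma forced_leaves_regII: assumes ij: "i \<ge> 0" "j \<ge> 1" shows "forced_leaves (regII i j) (FoA' i j)"
proof -
  have 1: "white e \<in> regII i j \<and> black e \<in> regII i j" if "e \<in> FoA' i j" for e
    using that ij by (cases e; auto simp: mem_defs)
  have 2: "white e' \<notin> regII i j" if "e \<in> FoA' i j" "e' \<in> set (incident (black e))" "e' \<noteq> e" for e e'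
    using that ij by (cases e; auto simp: mem_defs)
  have 3: "e = e'" if "e \<in> FoA' i j" "e' \<in> FoA' i j" "white e = white e'" for e e'
    using that ij by (cases e; cases e'; auto simp: mem_defs)
  show ?thesis using 1 2 3 unfolding forced_leaves_def edges_in_def by (intro conjI subsetI ballI allI impI; simp)
qed

lemma forced_leaves_regRII: assumes ij: "i \<ge> 0" "j \<ge> 1" shows "forced_leaves (regRII i j) (FoB i j)"
proof -
  have 1: "white e \<in> regRII i j \<and> black e \<in> regRII i j" if "e \<in> FoB i j" for e
    using that ij by (cases e; auto simp: mem_defs)
  have 2: "white e' \<notin> regRII i j" if "e \<in> FoB i j" "e' \<in> set (incident (black e))" "e' \<noteq> e" for e e'
    using that ij by (cases e; auto simp: mem_defs)
  have 3: "e = e'" if "e \<in> FoB i j" "e' \<in> FoB i j" "white e = white e'" for e e'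
    using that ij by (cases e; cases e'; auto simp: mem_defs)
  show ?thesis using 1 2 3 unfolding forced_leaves_def edges_in_def by (intro conjI subsetI ballI allI impI; simp)
qed

lemma leaf_empty: "forced_leaves G {}"
  by (simp add: forced_leaves_def)

lemma set_eqI_cells: "(\<And>k a b. (k, a, b) \<in> A \<longleftrightarrow> (k, a, b) \<in> B) \<Longrightarrow> A = (B :: ('k \<times> int \<times> int) set)"
  by auto

lemma strip_regI: assumes "i \<ge> 0" "j \<ge> 1" shows "strip (regI i j) (FoA i j) = coreI i j"
  by (rule set_eqI_cells, case_tac k; insert assms; simp add: strip_iff mem_defs; smt (z3))

lemma strip_regII: assumes "i \<ge> 0" "j \<ge> 1" shows "strip (regII i j) (FoA' i j) = coreII i j"
  by (rule set_eqI_cells, case_tac k; insert assms; simp add: strip_iff mem_defs; smt (z3))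

lemma strip_regRII: assumes "i \<ge> 0" "j \<ge> 1" shows "strip (regRII i j) (FoB i j) = coreRII i j"
  by (rule set_eqI_cells, case_tac k; insert assms; simp add: strip_iff mem_defs; smt (z3))

lemma strip_empty: "strip G {} = G"
  by (simp add: strip_def)

section \<open>Renewal of the cores\<close>

lemma srelA_0: assumes "i \<ge> 0" "j \<ge> 1" shows "(Wv, a, b) \<in> coreI i j \<longleftrightarrow> (Xv, - a - b, b) \<in> coreII i j"
  using assms by (simp add: reg_defs compat_def; smt (z3))
lemma srelA_1: assumes "i \<ge> 0" "j \<ge> 1" shows "(Xv, a, b) \<in> coreI i j \<longleftrightarrow> (Wv, - a - b, b) \<in> coreII i j"
  using assms by (simp add: reg_defs compat_def; smt (z3))
lemma srelA_2: assumes "i \<ge> 0" "j \<ge> 1" shows "(Ov, a, b) \<in> coreI i j \<longleftrightarrow> (Hv, - a - b, b) \<in> coreII i j"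
  using assms by (simp add: reg_defs compat_def; smt (z3))
lemma srelA_3: assumes "i \<ge> 0" "j \<ge> 1" shows "(Hv, a, b) \<in> coreI i j \<longleftrightarrow> (Ov, - a - b, b) \<in> coreII i j"
  using assms by (simp add: reg_defs compat_def; smt (z3))
lemma srelA_4: assumes "i \<ge> 0" "j \<ge> 1" shows "compat ((Xv, a, b) \<in> coreI i j) ((Wv, a, b) \<in> coreI i j) ((Sv, a, b) \<in> coreI i j) ((Sv, - a - b, b) \<in> coreII i j)"
  using assms by (simp add: reg_defs compat_def; smt (z3))
lemma srelA_5: assumes "i \<ge> 0" "j \<ge> 1" shows "compat ((Xv, a, b) \<in> coreI i j) ((Wv, a - 1, b) \<in> coreI i j) ((Tv, a, b) \<in> coreI i j) ((Tv, 1 - a - b, b) \<in> coreII i j)"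
  using assms by (simp add: reg_defs compat_def; smt (z3))
lemma srelB_0: assumes "i \<ge> 0" "j \<ge> 1" shows "(Wv, a, b) \<in> coreRII i j \<longleftrightarrow> (Xv, - a - b, b) \<in> regRI i j"
  using assms by (simp add: reg_defs compat_def; smt (z3))
lemma srelB_1: assumes "i \<ge> 0" "j \<ge> 1" shows "(Xv, a, b) \<in> coreRII i j \<longleftrightarrow> (Wv, - a - b, b) \<in> regRI i j"
  using assms by (simp add: reg_defs compat_def; smt (z3))
lemma srelB_2: assumes "i \<ge> 0" "j \<ge> 1" shows "(Ov, a, b) \<in> coreRII i j \<longleftrightarrow> (Hv, - a - b, b) \<in> regRI i j"
  using assms by (simp add: reg_defs compat_def; smt (z3))
lemma srelB_3: assumes "i \<ge> 0" "j \<ge> 1" shows "(Hv, a, b) \<in> coreRII i j \<longleftrightarrow> (Ov, - a - b, b) \<in> regRI i j"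
  using assms by (simp add: reg_defs compat_def; smt (z3))
lemma srelB_4: assumes "i \<ge> 0" "j \<ge> 1" shows "compat ((Xv, a, b) \<in> coreRII i j) ((Wv, a, b) \<in> coreRII i j) ((Sv, a, b) \<in> coreRII i j) ((Sv, - a - b, b) \<in> regRI i j)"
  using assms by (simp add: reg_defs compat_def; smt (z3))
lemma srelB_5: assumes "i \<ge> 0" "j \<ge> 1" shows "compat ((Xv, a, b) \<in> coreRII i j) ((Wv, a - 1, b) \<in> coreRII i j) ((Tv, a, b) \<in> coreRII i j) ((Tv, 1 - a - b, b) \<in> regRI i j)"
  using assms by (simp add: reg_defs compat_def; smt (z3))

lemma dead_coreI: "i \<ge> 0 \<Longrightarrow> j \<ge> 1 \<Longrightarrow> dead_ok (coreI i j)"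
  unfolding dead_ok_def by (intro conjI allI; simp add: reg_defs; smt (z3))
lemma dead_coreII: "i \<ge> 0 \<Longrightarrow> j \<ge> 1 \<Longrightarrow> dead_ok (coreII i j)"
  unfolding dead_ok_def by (intro conjI allI; simp add: reg_defs; smt (z3))
lemma dead_coreRII: "i \<ge> 0 \<Longrightarrow> j \<ge> 1 \<Longrightarrow> dead_ok (coreRII i j)"
  unfolding dead_ok_def by (intro conjI allI; simp add: reg_defs; smt (z3))
lemma dead_regRI: "i \<ge> 0 \<Longrightarrow> j \<ge> 1 \<Longrightarrow> dead_ok (regRI i j)"
  unfolding dead_ok_def by (intro conjI allI; simp add: reg_defs; smt (z3))

lemma srelA: "i \<ge> 0 \<Longrightarrow> j \<ge> 1 \<Longrightarrow> shuffle_rel (coreI i j) (coreII i j)"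
  unfolding shuffle_rel_def by (intro conjI allI srelA_0 srelA_1 srelA_2 srelA_3 srelA_4 srelA_5 dead_coreI dead_coreII)
lemma srelB: "i \<ge> 0 \<Longrightarrow> j \<ge> 1 \<Longrightarrow> shuffle_rel (coreRII i j) (regRI i j)"
  unfolding shuffle_rel_def by (intro conjI allI srelB_0 srelB_1 srelB_2 srelB_3 srelB_4 srelB_5 dead_coreRII dead_regRI)

section \<open>Border faces of the regions\<close>

lemma bordered_simps:
  "bordered G 0 a b \<longleftrightarrow> ((Ov, a, b) \<in> G \<or> (Wv, a, b - 1) \<in> G) \<and> ((Sv, a, b - 1) \<in> G \<or> (Tv, a + 1, b - 1) \<in> G)"
  "bordered G (Suc 0) a b \<longleftrightarrow> ((Ov, a, b) \<in> G \<or> (Xv, a, b) \<in> G) \<and> ((Sv, a, b) \<in> G \<or> (Tv, a, b) \<in> G)"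
  "bordered G 2 a b \<longleftrightarrow> ((Ov, a, b) \<in> G \<or> (Xv, a, b - 1) \<in> G) \<and> ((Sv, a, b - 1) \<in> G \<or> (Hv, a - 1, b) \<in> G)"
  "bordered G 3 a b \<longleftrightarrow> ((Ov, a, b) \<in> G \<or> (Wv, a, b) \<in> G) \<and> ((Sv, a, b) \<in> G \<or> (Hv, a, b) \<in> G)"
  "bordered G 4 a b \<longleftrightarrow> ((Ov, a, b) \<in> G \<or> (Wv, a - 1, b) \<in> G) \<and> ((Tv, a, b) \<in> G \<or> (Hv, a - 1, b) \<in> G)"
  "bordered G 5 a b \<longleftrightarrow> ((Ov, a, b) \<in> G \<or> (Xv, a + 1, b - 1) \<in> G) \<and> ((Tv, a + 1, b - 1) \<in> G \<or> (Hv, a, b) \<in> G)"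
  using face_edge_list_simps(2)[of a b] by (auto simp: bordered_def face_edge_list_simps)

text \<open>\<open>eq3\<close> says that equally many of \<open>p, q, r\<close> and of \<open>p', q', r'\<close> hold.\<close>
definition eq3 :: "bool \<Rightarrow> bool \<Rightarrow> bool \<Rightarrow> bool \<Rightarrow> bool \<Rightarrow> bool \<Rightarrow> bool" where
  "eq3 p q r p' q' r' \<longleftrightarrow> (p \<or> q \<or> r \<longleftrightarrow> p' \<or> q' \<or> r') \<and>
     (p \<and> q \<or> q \<and> r \<or> p \<and> r \<longleftrightarrow> p' \<and> q' \<or> q' \<and> r' \<or> p' \<and> r') \<and> (p \<and> q \<and> r \<longleftrightarrow> p' \<and> q' \<and> r')"

lemma eq3_sum:
  "eq3 p q r p' q' r' \<Longrightarrow> of_bool p + of_bool q + of_bool r = (of_bool p' + of_bool q' + of_bool r' :: int)"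
  by (cases p; cases q; cases r; cases p'; cases q'; cases r'; simp add: eq3_def)

text \<open>The negative terms of \<open>face_counts\<close> are moved across, so that three
  indicators stand on either side. In the form \<open>eq3\<close> the claim is a Boolean combination
  of linear inequalities, fit for the solver; \<open>eq3_sum\<close> recovers the integer
  identity.\<close>

lemma fokA2: assumes "i \<ge> 0" "j \<ge> 1"
  shows "eq3 (bordered (regI i j) 2 a b) ((E12, 1 - a - b, b - 1) \<in> FoA' i j) ((Wv, a, b - 1) \<in> coreI i j) (bordered (regII i j) 2 (1 - a - b) b) ((E12, a, b - 1) \<in> FoA i j) ((Sv, a, b - 1) \<in> coreI i j)"
  using assms unfolding eq3_def
  by (intro conjI; simp add: bordered_simps mem_defs; smt (z3))

lemma fokA3: assumes "i \<ge> 0" "j \<ge> 1"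
  shows "eq3 (bordered (regI i j) 3 a b) ((E03, - a - b, b + 1) \<in> FoA' i j) ((Xv, a, b) \<in> coreI i j) (bordered (regII i j) 3 (- a - b) b) ((E03, a, b + 1) \<in> FoA i j) ((Sv, a, b) \<in> coreI i j)"
  using assms unfolding eq3_def
  by (intro conjI; simp add: bordered_simps mem_defs; smt (z3))

lemma fokA4: assumes "i \<ge> 0" "j \<ge> 1"
  shows "eq3 (bordered (regI i j) 4 a b) (False) ((Xv, a, b) \<in> coreI i j) (bordered (regII i j) 4 (1 - a - b) b) (False) ((Tv, a, b) \<in> coreI i j)"
  using assms unfolding eq3_def
  by (intro conjI; simp add: bordered_simps mem_defs; smt (z3))

lemma fokA5: assumes "i \<ge> 0" "j \<ge> 1"
  shows "eq3 (bordered (regI i j) 5 a b) (False) ((Wv, a, b - 1) \<in> coreI i j) (bordered (regII i j) 5 (- a - b) b) (False) ((Tv, a + 1, b - 1) \<in> coreI i j)"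
  using assms unfolding eq3_def
  by (intro conjI; simp add: bordered_simps mem_defs; smt (z3))

lemma fokB2: assumes "i \<ge> 0" "j \<ge> 1"
  shows "eq3 (bordered (regRII i j) 2 a b) (False) ((Wv, a, b - 1) \<in> coreRII i j) (bordered (regRI i j) 2 (1 - a - b) b) ((E12, a, b - 1) \<in> FoB i j) ((Sv, a, b - 1) \<in> coreRII i j)"
  using assms unfolding eq3_def
  by (intro conjI; simp add: bordered_simps mem_defs; smt (z3))

lemma fokB3: assumes "i \<ge> 0" "j \<ge> 1"
  shows "eq3 (bordered (regRII i j) 3 a b) (False) ((Xv, a, b) \<in> coreRII i j) (bordered (regRI i j) 3 (- a - b) b) ((E03, a, b + 1) \<in> FoB i j) ((Sv, a, b) \<in> coreRII i j)"
  using assms unfolding eq3_def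
  by (intro conjI; simp add: bordered_simps mem_defs; smt (z3))

lemma fokB4: assumes "i \<ge> 0" "j \<ge> 1"
  shows "eq3 (bordered (regRII i j) 4 a b) (False) ((Xv, a, b) \<in> coreRII i j) (bordered (regRI i j) 4 (1 - a - b) b) ((E40, a - 1, b + 1) \<in> FoB i j) ((Tv, a, b) \<in> coreRII i j)"
  using assms unfolding eq3_def
  by (intro conjI; simp add: bordered_simps mem_defs; smt (z3))

lemma fokB5: assumes "i \<ge> 0" "j \<ge> 1"
  shows "eq3 (bordered (regRII i j) 5 a b) (False) ((Wv, a, b - 1) \<in> coreRII i j) (bordered (regRI i j) 5 (- a - b) b) ((E51, a + 1, b - 1) \<in> FoB i j) ((Tv, a + 1, b - 1) \<in> coreRII i j)"
  using assms unfolding eq3_def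
  by (intro conjI; simp add: bordered_simps mem_defs; smt (z3))

lemma sqA1: assumes "i \<ge> 0" "j \<ge> 1"
  shows "eq3 (bordered (regI i j) (Suc 0) a b) False False ((Xv, a, b) \<in> coreI i j) ((E12, a, b) \<in> FoA i j) (False)"
  using assms unfolding eq3_def
  by (intro conjI; simp add: bordered_simps mem_defs; smt (z3))

lemma sqA0: assumes "i \<ge> 0" "j \<ge> 1"
  shows "eq3 (bordered (regI i j) 0 a b) False False ((Wv, a, b - 1) \<in> coreI i j) ((E03, a, b) \<in> FoA i j) (False)"
  using assms unfolding eq3_def
  by (intro conjI; simp add: bordered_simps mem_defs; smt (z3))

lemma sqA'1: assumes "i \<ge> 0" "j \<ge> 1"
  shows "eq3 (bordered (regII i j) (Suc 0) a b) False False ((Xv, a, b) \<in> coreII i j) ((E12, a, b) \<in> FoA' i j) (False)"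
  using assms unfolding eq3_def
  by (intro conjI; simp add: bordered_simps mem_defs; smt (z3))

lemma sqA'0: assumes "i \<ge> 0" "j \<ge> 1"
  shows "eq3 (bordered (regII i j) 0 a b) False False ((Wv, a, b - 1) \<in> coreII i j) ((E03, a, b) \<in> FoA' i j) (False)"
  using assms unfolding eq3_def
  by (intro conjI; simp add: bordered_simps mem_defs; smt (z3))

lemma sqB1: assumes "i \<ge> 0" "j \<ge> 1"
  shows "eq3 (bordered (regRII i j) (Suc 0) a b) False False ((Xv, a, b) \<in> coreRII i j) ((E12, a, b) \<in> FoB i j) ((E51, a, b) \<in> FoB i j)"
  using assms unfolding eq3_def
  by (intro conjI; simp add: bordered_simps mem_defs; smt (z3))

lemma sqB0: assumes "i \<ge> 0" "j \<ge> 1"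
  shows "eq3 (bordered (regRII i j) 0 a b) False False ((Wv, a, b - 1) \<in> coreRII i j) ((E03, a, b) \<in> FoB i j) ((E40, a, b) \<in> FoB i j)"
  using assms unfolding eq3_def
  by (intro conjI; simp add: bordered_simps mem_defs; smt (z3))

text \<open>The exception is the single edge of \<open>regRI_0_1\<close>: it contains an
  \<open>Xv\<close>, but its only edge is no side of the face labelled \<open>1\<close>
  there.\<close>

lemma sqRI1: assumes "i \<ge> 0" "j \<ge> 1" "(i, j) \<noteq> (0, 1)"
  shows "bordered (regRI i j) (Suc 0) a b \<longleftrightarrow> (Xv, a, b) \<in> regRI i j"
  using assms by (simp add: bordered_simps mem_defs; smt (z3))
lemma sqRI0: assumes "i \<ge> 0" "j \<ge> 1"
  shows "bordered (regRI i j) 0 a b \<longleftrightarrow> (Wv, a, b - 1) \<in> regRI i j"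
  using assms by (simp add: bordered_simps mem_defs; smt (z3))

lemma forced_at_A:
  "forced_at (FoA i j) 0 a b = of_bool ((E03, a, b) \<in> FoA i j)" "forced_at (FoA i j) (Suc 0) a b = of_bool ((E12, a, b) \<in> FoA i j)"
  "forced_at (FoA i j) 2 a b = of_bool ((E12, a, b - 1) \<in> FoA i j)" "forced_at (FoA i j) 3 a b = of_bool ((E03, a, b + 1) \<in> FoA i j)"
  "forced_at (FoA i j) 4 a b = 0" "forced_at (FoA i j) 5 a b = 0"
  using face_edge_list_simps(2)[of a b] by (simp_all add: forced_at_def face_edge_list_simps FoA_def)

lemma forced_at_A':
  "forced_at (FoA' i j) 0 a b = of_bool ((E03, a, b) \<in> FoA' i j)" "forced_at (FoA' i j) (Suc 0) a b = of_bool ((E12, a, b) \<in> FoA' i j)"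
  "forced_at (FoA' i j) 2 a b = of_bool ((E12, a, b - 1) \<in> FoA' i j)" "forced_at (FoA' i j) 3 a b = of_bool ((E03, a, b + 1) \<in> FoA' i j)"
  "forced_at (FoA' i j) 4 a b = 0" "forced_at (FoA' i j) 5 a b = 0"
  using face_edge_list_simps(2)[of a b] by (simp_all add: forced_at_def face_edge_list_simps FoA'_def)

lemma forced_at_B:
  "forced_at (FoB i j) 0 a b = of_bool ((E03, a, b) \<in> FoB i j) + of_bool ((E40, a, b) \<in> FoB i j)"
  "forced_at (FoB i j) (Suc 0) a b = of_bool ((E12, a, b) \<in> FoB i j) + of_bool ((E51, a, b) \<in> FoB i j)"
  "forced_at (FoB i j) 2 a b = of_bool ((E12, a, b - 1) \<in> FoB i j)" "forced_at (FoB i j) 3 a b = of_bool ((E03, a, b + 1) \<in> FoB i j)"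
  "forced_at (FoB i j) 4 a b = of_bool ((E40, a - 1, b + 1) \<in> FoB i j)" "forced_at (FoB i j) 5 a b = of_bool ((E51, a + 1, b - 1) \<in> FoB i j)"
  using face_edge_list_simps(2)[of a b] by (simp_all add: forced_at_def face_edge_list_simps FoB_def)

lemma forced_at_empty: "forced_at {} k a b = 0"
  by (simp add: forced_at_def)

lemma sqokA: assumes "i \<ge> 0" "j \<ge> 1" shows "square_counts (regI i j) (FoA i j) (coreI i j)"
  unfolding square_counts_def One_nat_def
proof (intro allI conjI)
  fix a b
  show "of_bool (bordered (regI i j) (Suc 0) a b) - forced_at (FoA i j) (Suc 0) a b = of_bool ((Xv, a, b) \<in> coreI i j)"
    using eq3_sum[OF sqA1[OF assms, of a b]] unfolding forced_at_A by simp
  show "of_bool (bordered (regI i j) 0 a b) - forced_at (FoA i j) 0 a b = of_bool ((Wv, a, b - 1) \<in> coreI i j)"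
    using eq3_sum[OF sqA0[OF assms, of a b]] unfolding forced_at_A by simp
qed

lemma sqokA': assumes "i \<ge> 0" "j \<ge> 1" shows "square_counts (regII i j) (FoA' i j) (coreII i j)"
  unfolding square_counts_def One_nat_def
proof (intro allI conjI)
  fix a b
  show "of_bool (bordered (regII i j) (Suc 0) a b) - forced_at (FoA' i j) (Suc 0) a b = of_bool ((Xv, a, b) \<in> coreII i j)"
    using eq3_sum[OF sqA'1[OF assms, of a b]] unfolding forced_at_A' by simp
  show "of_bool (bordered (regII i j) 0 a b) - forced_at (FoA' i j) 0 a b = of_bool ((Wv, a, b - 1) \<in> coreII i j)"
    using eq3_sum[OF sqA'0[OF assms, of a b]] unfolding forced_at_A' by simp
qed

lemma sqokB: assumes "i \<ge> 0" "j \<ge> 1" shows "square_counts (regRII i j) (FoB i j) (coreRII i j)"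
  unfolding square_counts_def One_nat_def
proof (intro allI conjI)
  fix a b
  show "of_bool (bordered (regRII i j) (Suc 0) a b) - forced_at (FoB i j) (Suc 0) a b = of_bool ((Xv, a, b) \<in> coreRII i j)"
    using eq3_sum[OF sqB1[OF assms, of a b]] unfolding forced_at_B by simp
  show "of_bool (bordered (regRII i j) 0 a b) - forced_at (FoB i j) 0 a b = of_bool ((Wv, a, b - 1) \<in> coreRII i j)"
    using eq3_sum[OF sqB0[OF assms, of a b]] unfolding forced_at_B by simp
qed

lemma fokA: assumes "i \<ge> 0" "j \<ge> 1" shows "face_counts (regI i j) (FoA i j) (coreI i j) (regII i j) (FoA' i j)"
  unfolding face_counts_def
proof (intro allI, goal_cases)
  case (1 a b)
  show ?case
    using eq3_sum[OF fokA2[OF assms, of a b]] eq3_sum[OF fokA3[OF assms, of a b]]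
      eq3_sum[OF fokA4[OF assms, of a b]] eq3_sum[OF fokA5[OF assms, of a b]]
    unfolding forced_at_A forced_at_A' by simp
qed

lemma fokB: assumes "i \<ge> 0" "j \<ge> 1" shows "face_counts (regRII i j) (FoB i j) (coreRII i j) (regRI i j) {}"
  unfolding face_counts_def
proof (intro allI, goal_cases)
  case (1 a b)
  show ?case
    using eq3_sum[OF fokB2[OF assms, of a b]] eq3_sum[OF fokB3[OF assms, of a b]]
      eq3_sum[OF fokB4[OF assms, of a b]] eq3_sum[OF fokB5[OF assms, of a b]]
    unfolding forced_at_B forced_at_empty by simp
qed

lemma fin_strip: "finite G \<Longrightarrow> finite (strip G F)"
  by (simp add: strip_def)

lemma fin_leaf: "forced_leaves G F \<Longrightarrow> finite G \<Longrightarrow> finite F"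
  using finite_edges_in by (auto simp: forced_leaves_def intro: finite_subset)

theorem c_value_regI_regII:
  fixes v :: "nat \<Rightarrow> 'a::field"
  assumes nz: "\<And>i. i < 6 \<Longrightarrow> v i \<noteq> 0" and A: "exch_num v \<noteq> 0" and ij: "i \<ge> 0" "j \<ge> 1"
  shows "c_value v (regI i j) = c_value (shuffle_vars v) (regII i j)"
proof -
  note fin = finite_regI[of i j] finite_regII[of i j]
  have fin0: "finite (coreII i j)" using fin_strip[OF fin(2)] strip_regII[OF ij] by metis
  note sq = square_counts_counts[OF fin(2) fin_leaf[OF forced_leaves_regII[OF ij] fin(2)] fin0 sqokA'[OF ij]]
  have "c_value v (regI i j) = c_value (shuffle_vars v) (regII i j) * (exch_num v / v 0) powi 0"
    by (rule shuffle_c_value[where v = v, OF _ A fin forced_leaves_regI[OF ij] forced_leaves_regII[OF ij] strip_regI[OF ij] strip_regII[OF ij]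
        srelA[OF ij] fokA[OF ij] sqokA[OF ij]]) (use nz sq in auto)
  then show ?thesis by simp
qed

lemma label_count_empty: "k < 6 \<Longrightarrow> label_count {} k = 0"
  unfolding less_6_cases by (auto simp: label_count_def kind_count_def count_def)

text \<open>The extra factor is \<open>shuffle_vars v 1\<close>, the variable of the one face
  labelled \<open>1\<close> that renewal accounts for although the single edge does not border
  it.\<close>

theorem c_value_regRII_regRI:
  fixes v :: "nat \<Rightarrow> 'a::field"
  assumes nz: "\<And>i. i < 6 \<Longrightarrow> v i \<noteq> 0" and A: "exch_num v \<noteq> 0" and ij: "i \<ge> 0" "j \<ge> 1"
  shows "c_value v (regRII i j) = c_value (shuffle_vars v) (regRI i j) * (if (i, j) = (0, 1) then exch_num v / v 0 else 1)"
proof -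
  note fin = finite_regRII[of i j] finite_regRI[of i j]
  have c0: "count (\<lambda>a b. (k, a, b - 1) \<in> G) = num_vtx k G" for k G
    using count_shift2[of "\<lambda>a b. (k, a, b) \<in> G" 0 "-1"] by (simp add: num_vtx_def)
  have s0: "bordered_count (regRI i j) 0 - label_count {} 0 = num_vtx Wv (regRI i j)"
  proof -
    have "bordered (regRI i j) 0 = (\<lambda>a b. (Wv, a, b - 1) \<in> regRI i j)"
      by (intro ext) (rule sqRI0[OF ij])
    then show ?thesis using c0[of Wv "regRI i j"] label_count_empty[of 0] by (simp add: bordered_count_def)
  qed
  have s1: "bordered_count (regRI i j) 1 - label_count {} 1 + (if (i, j) = (0, 1) then 1 else 0) = num_vtx Xv (regRI i j)"
  proof (cases "(i, j) = (0, 1)")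
    case False
    have "bordered (regRI i j) (Suc 0) = (\<lambda>a b. (Xv, a, b) \<in> regRI i j)"
      by (intro ext) (rule sqRI1[OF ij False])
    then show ?thesis using False label_count_empty[of 1] by (auto simp: bordered_count_def num_vtx_def)
  next
    case True
    have "bordered (regRI 0 1) (Suc 0) a b = False" for a b
      by (simp add: bordered_simps mem_defs; smt (z3))
    then have "bordered_count (regRI i j) 1 = 0" using True by (simp add: bordered_count_def count_def)
    moreover have "(Xv, a, b) \<in> regRI 0 1 \<longleftrightarrow> a = 0 \<and> b = 0" for a b
      by (simp add: mem_defs; smt (z3))
    then have "{(a, b). (Xv, a, b) \<in> regRI 0 1} = {(0, 0)}" by auto
    then have "num_vtx Xv (regRI i j) = 1" using True by (simp add: num_vtx_def count_def)
    ultimately show ?thesis using True label_count_empty[of 1] by simp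
  qed
  have "c_value v (regRII i j) = c_value (shuffle_vars v) (regRI i j) * (exch_num v / v 0) powi (if (i, j) = (0, 1) then 1 else 0)"
    by (rule shuffle_c_value[where v = v, OF _ A fin forced_leaves_regRII[OF ij] leaf_empty strip_regRII[OF ij] strip_empty
        srelB[OF ij] fokB[OF ij] sqokB[OF ij]]) (use nz s0 s1 in auto)
  then show ?thesis by simp
qed

section \<open>Symmetries of the tiling\<close>

text \<open>The counterclockwise turn by 60 degrees about the origin. On cells it is
  \<open>(a, b) \<mapsto> (- b, a + b)\<close>; the offset \<open>- 1\<close> occurs where the
  turned vertex is named after a neighbouring cell.\<close>

fun rot_vtx :: "vtx \<Rightarrow> vtx" where
  "rot_vtx (Ov, a, b) = (Ov, - b, a + b)"
| "rot_vtx (Hv, a, b) = (Sv, - b, a + b)"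
| "rot_vtx (Sv, a, b) = (Tv, - b, a + b)"
| "rot_vtx (Tv, a, b) = (Hv, - b - 1, a + b)"
| "rot_vtx (Wv, a, b) = (Xv, - b, a + b)"
| "rot_vtx (Xv, a, b) = (Wv, - b - 1, a + b)"

fun rot_vtx' :: "vtx \<Rightarrow> vtx" where
  "rot_vtx' (Ov, a, b) = (Ov, a + b, - a)"
| "rot_vtx' (Sv, a, b) = (Hv, a + b, - a)"
| "rot_vtx' (Tv, a, b) = (Sv, a + b, - a)"
| "rot_vtx' (Hv, a, b) = (Tv, a + b + 1, - a - 1)"
| "rot_vtx' (Xv, a, b) = (Wv, a + b, - a)"
| "rot_vtx' (Wv, a, b) = (Xv, a + b + 1, - a - 1)"

fun rot_edg :: "edg \<Rightarrow> edg" where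
  "rot_edg (E31, a, b) = (E14, - b, a + b)"
| "rot_edg (E14, a, b) = (E42, - b, a + b)"
| "rot_edg (E42, a, b) = (E20, - b, a + b)"
| "rot_edg (E20, a, b) = (E05, - b, a + b)"
| "rot_edg (E05, a, b) = (E53, - b, a + b)"
| "rot_edg (E53, a, b) = (E31, - b, a + b)"
| "rot_edg (E12, a, b) = (E40, - b - 1, a + b + 1)"
| "rot_edg (E51, a, b) = (E34, - b - 1, a + b)"
| "rot_edg (E03, a, b) = (E51, - b + 1, a + b - 1)"
| "rot_edg (E40, a, b) = (E25, - b, a + b)"
| "rot_edg (E34, a, b) = (E12, - b, a + b)"
| "rot_edg (E25, a, b) = (E03, - b, a + b + 1)"

fun rot_edg' :: "edg \<Rightarrow> edg" where
  "rot_edg' (E14, a, b) = (E31, a + b, - a)"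
| "rot_edg' (E42, a, b) = (E14, a + b, - a)"
| "rot_edg' (E20, a, b) = (E42, a + b, - a)"
| "rot_edg' (E05, a, b) = (E20, a + b, - a)"
| "rot_edg' (E53, a, b) = (E05, a + b, - a)"
| "rot_edg' (E31, a, b) = (E53, a + b, - a)"
| "rot_edg' (E40, a, b) = (E12, a + b, - a - 1)"
| "rot_edg' (E34, a, b) = (E51, a + b + 1, - a - 1)"
| "rot_edg' (E51, a, b) = (E03, a + b, - a + 1)"
| "rot_edg' (E25, a, b) = (E40, a + b, - a)"
| "rot_edg' (E12, a, b) = (E34, a + b, - a)"
| "rot_edg' (E03, a, b) = (E25, a + b - 1, - a)"

text \<open>The reflection that reverses the second basis vector. It preserves the colours and
  reverses the arrows of the quiver, to which the edge weights are insensitive.\<close>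

fun mir_vtx :: "vtx \<Rightarrow> vtx" where
  "mir_vtx (Ov, a, b) = (Ov, a, - a - b)"
| "mir_vtx (Sv, a, b) = (Sv, a, - a - b - 1)"
| "mir_vtx (Hv, a, b) = (Tv, a + 1, - a - b - 1)"
| "mir_vtx (Tv, a, b) = (Hv, a - 1, - a - b)"
| "mir_vtx (Wv, a, b) = (Wv, a, - a - b - 1)"
| "mir_vtx (Xv, a, b) = (Xv, a, - a - b - 1)"

fun mir_edg :: "edg \<Rightarrow> edg" where
  "mir_edg (E31, a, b) = (E20, a, - a - b)"
| "mir_edg (E20, a, b) = (E31, a, - a - b)"
| "mir_edg (E12, a, b) = (E12, a, - a - b - 1)"
| "mir_edg (E51, a, b) = (E25, a - 1, - a - b)"
| "mir_edg (E14, a, b) = (E42, a, - a - b)"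
| "mir_edg (E42, a, b) = (E14, a, - a - b)"
| "mir_edg (E03, a, b) = (E03, a, - a - b + 1)"
| "mir_edg (E40, a, b) = (E34, a, - a - b)"
| "mir_edg (E34, a, b) = (E40, a, - a - b)"
| "mir_edg (E05, a, b) = (E53, a, - a - b)"
| "mir_edg (E53, a, b) = (E05, a, - a - b)"
| "mir_edg (E25, a, b) = (E51, a + 1, - a - b - 1)"

definition rot_label :: "nat \<Rightarrow> nat" where "rot_label k = [5, 4, 0, 1, 2, 3] ! k"
definition rot_label' :: "nat \<Rightarrow> nat" where "rot_label' k = [2, 3, 4, 5, 1, 0] ! k"
definition mir_label :: "nat \<Rightarrow> nat" where "mir_label k = [3, 2, 1, 0, 4, 5] ! k"

lemma rot_label_simps: "rot_label 0 = 5" "rot_label (Suc 0) = 4" "rot_label 2 = 0" "rot_label 3 = 1" "rot_label 4 = 2" "rot_label 5 = 3"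
  "rot_label' 0 = 2" "rot_label' (Suc 0) = 3" "rot_label' 2 = 4" "rot_label' 3 = 5" "rot_label' 4 = 1" "rot_label' 5 = 0"
  "mir_label 0 = 3" "mir_label (Suc 0) = 2" "mir_label 2 = 1" "mir_label 3 = 0" "mir_label 4 = 4" "mir_label 5 = 5"
  by (simp_all add: rot_label_def rot_label'_def mir_label_def)

text \<open>One notion for turns, the reflection and translations: \<open>f\<close> acts on
  vertices, \<open>g\<close> on edges, \<open>l\<close> on the labels of faces and \<open>c\<close>
  on their cells.\<close>

definition automorphism :: "(vtx \<Rightarrow> vtx) \<Rightarrow> (edg \<Rightarrow> edg) \<Rightarrow> (nat \<Rightarrow> nat) \<Rightarrow> (int \<times> int \<Rightarrow> int \<times> int) \<Rightarrow> bool" where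
  "automorphism f g l c \<longleftrightarrow> bij f \<and> bij g \<and> bij c \<and> bij_betw l {..<6} {..<6} \<and>
     (\<forall>e. white (g e) = f (white e) \<and> black (g e) = f (black e)) \<and>
     (\<forall>k<6. \<forall>a b. set (case c (a, b) of (a', b') \<Rightarrow> face_edge_list (l k) a' b') = g ` set (face_edge_list k a b))"

lemma bij_inv: "(\<And>x. g (f x) = x) \<Longrightarrow> (\<And>y. f (g y) = y) \<Longrightarrow> bij f"
  by (metis bijI')

lemma rot_vtx_rot_vtx': "rot_vtx (rot_vtx' x) = x" "rot_vtx' (rot_vtx x) = x"
  by (cases x rule: rot_vtx.cases; simp)+

lemma rot_edg_rot_edg': "rot_edg (rot_edg' x) = x" "rot_edg' (rot_edg x) = x"
  by (cases x rule: rot_edg.cases; simp)+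

lemma mir_vtx_mir_vtx: "mir_vtx (mir_vtx x) = x"
  by (cases x rule: mir_vtx.cases; simp)

lemma mir_edg_mir_edg: "mir_edg (mir_edg x) = x"
  by (cases x rule: mir_edg.cases; simp)

lemma bij6: "(\<And>k. k < 6 \<Longrightarrow> f k < 6 \<and> g k < 6 \<and> g (f k) = k \<and> f (g k) = (k::nat)) \<Longrightarrow> bij_betw f {..<6} {..<6}"
  by (rule bij_betw_byWitness[where f' = g]) auto

lemma automorphism_rot: "automorphism rot_vtx rot_edg rot_label (\<lambda>(a, b). (- b, a + b))"
  unfolding automorphism_def
proof (intro conjI allI impI)
  show "bij rot_vtx" by (rule bij_inv[of rot_vtx' rot_vtx]) (simp_all add: rot_vtx_rot_vtx')
  show "bij rot_edg" by (rule bij_inv[of rot_edg' rot_edg]) (simp_all add: rot_edg_rot_edg')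
  show "bij (\<lambda>(a, b). (- b, a + b :: int))"
    by (rule bij_inv[of "\<lambda>(a, b). (a + b, - a)"]) auto
  show "bij_betw rot_label {..<6} {..<6}"
    by (rule bij6[of rot_label rot_label']) (auto simp: less_6_cases rot_label_simps)
  fix e show "white (rot_edg e) = rot_vtx (white e)" "black (rot_edg e) = rot_vtx (black e)" by (cases e rule: rot_edg.cases; simp)+
next
  fix k :: nat and a b :: int assume "k < 6"
  then show "set (case case (a, b) of (a, b) \<Rightarrow> (- b, a + b) of (a', b') \<Rightarrow> face_edge_list (rot_label k) a' b') = rot_edg ` set (face_edge_list k a b)"
    unfolding less_6_cases using face_edge_list_simps(2)
    by (elim disjE; simp add: rot_label_simps face_edge_list_simps; fastforce)
qed

lemma automorphism_mir: "automorphism mir_vtx mir_edg mir_label (\<lambda>(a, b). (a, - a - b))"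
  unfolding automorphism_def
proof (intro conjI allI impI)
  show "bij mir_vtx" by (rule bij_inv[of mir_vtx mir_vtx]) (simp_all add: mir_vtx_mir_vtx)
  show "bij mir_edg" by (rule bij_inv[of mir_edg mir_edg]) (simp_all add: mir_edg_mir_edg)
  show "bij (\<lambda>(a, b). (a, - a - b :: int))"
    by (rule bij_inv[of "\<lambda>(a, b). (a, - a - b)"]) auto
  show "bij_betw mir_label {..<6} {..<6}"
    by (rule bij6[of mir_label mir_label]) (auto simp: less_6_cases rot_label_simps)
  fix e show "white (mir_edg e) = mir_vtx (white e)" "black (mir_edg e) = mir_vtx (black e)" by (cases e rule: mir_edg.cases; simp)+
next
  fix k :: nat and a b :: int assume "k < 6"
  then show "set (case case (a, b) of (a, b) \<Rightarrow> (a, - a - b) of (a', b') \<Rightarrow> face_edge_list (mir_label k) a' b') = mir_edg ` set (face_edge_list k a b)"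
    unfolding less_6_cases using face_edge_list_simps(2)
    by (elim disjE; simp add: rot_label_simps face_edge_list_simps; fastforce)
qed

lemma automorphismD:
  assumes "automorphism f g l c"
  shows "inj f" "surj f" "inj g" "surj g" "bij c" "bij_betw l {..<6} {..<6}"
    "white (g e) = f (white e)" "black (g e) = f (black e)"
proof -
  note A = assms[unfolded automorphism_def]
  show "inj f" "surj f" using A[THEN conjunct1] by (simp_all add: bij_def)
  show "inj g" "surj g" using A[THEN conjunct2, THEN conjunct1] by (simp_all add: bij_def)
  show "bij c" by (rule A[THEN conjunct2, THEN conjunct2, THEN conjunct1])
  show "bij_betw l {..<6} {..<6}" by (rule A[THEN conjunct2, THEN conjunct2, THEN conjunct2, THEN conjunct1])
  show "white (g e) = f (white e)" "black (g e) = f (black e)"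
    using A[THEN conjunct2, THEN conjunct2, THEN conjunct2, THEN conjunct2, THEN conjunct1, THEN spec, of e] by (rule conjunct1, rule conjunct2)
qed

lemma automorphism_face_edge_list:
  assumes "automorphism f g l c" "k < 6" "c (a, b) = (a', b')"
  shows "set (face_edge_list (l k) a' b') = g ` set (face_edge_list k a b)"
  using assms(1)[unfolded automorphism_def, THEN conjunct2, THEN conjunct2, THEN conjunct2, THEN conjunct2, THEN conjunct2, rule_format, OF assms(2), of a b]
  by (simp add: assms(3))

lemma automorphism_edges_in:
  assumes "automorphism f g l c"
  shows "g e \<in> edges_in (f ` V) \<longleftrightarrow> e \<in> edges_in V"
  unfolding edges_in_def mem_Collect_eq automorphismD(7,8)[OF assms] inj_image_mem_iff[OF automorphismD(1)[OF assms]] ..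

lemma ex1_bij:
  assumes "inj g" "surj g" "\<And>d. P (g d) \<longleftrightarrow> Q d"
  shows "(\<exists>!d. P d) \<longleftrightarrow> (\<exists>!d. Q d)"
proof -
  have "(\<forall>d. P d \<longrightarrow> R d) \<longleftrightarrow> (\<forall>d. Q d \<longrightarrow> R (g d))" for R using assms(2,3) by (metis surjD)
  moreover have "(\<exists>d. P d \<and> R d) \<longleftrightarrow> (\<exists>d. Q d \<and> R (g d))" for R using assms(2,3) by (metis surjD)
  ultimately show ?thesis using assms(1) unfolding Ex1_def by (simp add: inj_eq)
qed

lemma automorphism_matchings:
  assumes A: "automorphism f g l c"
  shows "bij_betw ((`) g) (matchings V) (matchings (f ` V))"
proof -
  have bf: "inj f" "surj f" "inj g" "surj g" and e: "white (g e) = f (white e)" "black (g e) = f (black e)" for e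
    by (rule automorphismD[OF A])+
  have iff: "g ` M \<in> matchings (f ` V) \<longleftrightarrow> M \<in> matchings V" for M
  proof -
    have 1: "g ` M \<subseteq> edges_in (f ` V) \<longleftrightarrow> M \<subseteq> edges_in V" using automorphism_edges_in[OF A] by blast
    have "(\<exists>!d. d \<in> g ` M \<and> ends d (f v)) \<longleftrightarrow> (\<exists>!d. d \<in> M \<and> ends d v)" for v
    proof -
      have *: "g d \<in> g ` M \<and> ends (g d) (f v) \<longleftrightarrow> d \<in> M \<and> ends d v" for d
        using bf e by (simp add: inj_image_mem_iff inj_eq)
      show ?thesis by (rule ex1_bij[OF bf(3,4)]) (rule *)
    qed
    then show ?thesis unfolding matchings_def mem_Collect_eq 1 by simp
  qed
  show ?thesis
  proof (rule bij_betw_imageI)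
    show "inj_on ((`) g) (matchings V)" using bf(3) by (simp add: inj_on_def inj_image_eq_iff)
    show "(`) g ` matchings V = matchings (f ` V)"
    proof
      show "(`) g ` matchings V \<subseteq> matchings (f ` V)" using iff by blast
      show "matchings (f ` V) \<subseteq> (`) g ` matchings V"
      proof
        fix M assume M: "M \<in> matchings (f ` V)"
        have "g ` (g -` M) = M" using bf(4) by (simp add: surj_image_vimage_eq)
        then show "M \<in> (`) g ` matchings V" using iff M by (metis image_eqI)
      qed
    qed
  qed
qed

lemma automorphism_bordered:
  assumes A: "automorphism f g l c" and k: "k < 6"
  shows "(case c (a, b) of (a', b') \<Rightarrow> bordered (f ` V) (l k) a' b') \<longleftrightarrow> bordered V k a b"
proof -
  obtain a' b' where c: "c (a, b) = (a', b')" by (cases "c (a, b)")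
  note automorphism_face_edge_list[OF A k c]
  then show ?thesis unfolding bordered_iff c prod.case by (simp only: ball_simps bex_simps automorphism_edges_in[OF A])
qed

lemma automorphism_bordered_count:
  assumes A: "automorphism f g l c" and k: "k < 6"
  shows "bordered_count (f ` V) (l k) = bordered_count V k"
proof -
  note bc = automorphismD(5)[OF A]
  have "bij_betw c {(a, b). bordered V k a b} {(a, b). bordered (f ` V) (l k) a b}"
  proof (rule bij_betw_imageI)
    show "inj_on c {(a, b). bordered V k a b}" using bc by (meson bij_def inj_on_subset subset_UNIV)
    show "c ` {(a, b). bordered V k a b} = {(a, b). bordered (f ` V) (l k) a b}"
    proof (intro subset_antisym subsetI)
      fix x assume "x \<in> c ` {(a, b). bordered V k a b}"
      then obtain a b where "x = c (a, b)" "bordered V k a b" by auto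
      then show "x \<in> {(a, b). bordered (f ` V) (l k) a b}" using automorphism_bordered[OF A k, where a = a and b = b and V = V] by (auto split: prod.splits)
    next
      fix x assume x: "x \<in> {(a, b). bordered (f ` V) (l k) a b}"
      obtain a b where c: "x = c (a, b)" using bc by (metis bij_pointE prod.exhaust)
      then have "bordered V k a b" using x automorphism_bordered[OF A k, where a = a and b = b and V = V] by (auto split: prod.splits)
      then show "x \<in> c ` {(a, b). bordered V k a b}" using c by auto
    qed
  qed
  then show ?thesis by (simp add: bordered_count_def count_def bij_betw_same_card)
qed

lemma c_value_automorphism:
  fixes v :: "nat \<Rightarrow> 'a::field"
  assumes A: "automorphism f g l c" and om: "\<And>e. edge_wt v (fst (g e)) = edge_wt (v \<circ> l) (fst e)"
  shows "c_value v (f ` V) = c_value (v \<circ> l) V"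
proof -
  note ig = automorphismD(3)[OF A] and black = automorphismD(6)[OF A]
  have wt: "wt v (g ` M) = wt (v \<circ> l) M" for M
    unfolding wt_def using om inj_on_subset[OF ig subset_UNIV] by (subst prod.reindex) auto
  have "wsum v (f ` V) = wsum (v \<circ> l) V"
    unfolding wsum_def using sum.reindex_bij_betw[OF automorphism_matchings[OF A], of "wt v"] wt by simp
  moreover have "(\<Prod>k<6. v k powi bordered_count (f ` V) k) = (\<Prod>k<6. (v \<circ> l) k powi bordered_count V k)"
    unfolding prod.reindex_bij_betw[OF black, of "\<lambda>k. v k powi bordered_count (f ` V) k", symmetric]
    by (rule prod.cong) (auto simp: automorphism_bordered_count[OF A])
  ultimately show ?thesis by (simp add: c_value_def)
qed

lemma c_value_rot_vtx: "c_value v (rot_vtx ` V) = c_value (v \<circ> rot_label) V"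
proof (rule c_value_automorphism[OF automorphism_rot])
  fix e show "edge_wt v (fst (rot_edg e)) = edge_wt (v \<circ> rot_label) (fst e)"
    by (cases e rule: rot_edg.cases) (simp_all add: rot_label_simps mult.commute)
qed

lemma c_value_mir_vtx: "c_value v (mir_vtx ` V) = c_value (v \<circ> mir_label) V"
proof (rule c_value_automorphism[OF automorphism_mir])
  fix e show "edge_wt v (fst (mir_edg e)) = edge_wt (v \<circ> mir_label) (fst e)"
    by (cases e rule: mir_edg.cases) (simp_all add: rot_label_simps mult.commute)
qed

lemma rot_vtx_image_iff: "v \<in> rot_vtx ` V \<longleftrightarrow> rot_vtx' v \<in> V"
  using rot_vtx_rot_vtx' by (metis image_iff)

lemma mir_vtx_image_iff: "v \<in> mir_vtx ` V \<longleftrightarrow> mir_vtx v \<in> V"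
  using mir_vtx_mir_vtx by (metis image_iff)

lemma rot_vtx_regII: "rot_vtx ` regII i j = regRII i j"
  by (rule set_eqI_cells, case_tac k; simp add: rot_vtx_image_iff reg_defs; smt (z3))

text \<open>The source of the recursion: after two renewals, with turns in between, the region is
  back in the first family with \<open>j\<close> lowered by one.\<close>

lemma rot_vtx_regRI: "rot_vtx ` regRI i j = regI i (j - 1)"
  by (rule set_eqI_cells, case_tac k; simp add: rot_vtx_image_iff reg_defs; smt (z3))

definition shift_cell :: "int \<Rightarrow> int \<Rightarrow> 'k \<times> int \<times> int \<Rightarrow> 'k \<times> int \<times> int" where
  "shift_cell s t = (\<lambda>(k, a, b). (k, a + s, b + t))"

lemma shift_cell_simp: "shift_cell s t (k, a, b) = (k, a + s, b + t)"
  by (simp add: shift_cell_def)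

lemma shift_cell_shift_cell: "shift_cell s t (shift_cell (- s) (- t) x) = x" "shift_cell (- s) (- t) (shift_cell s t x) = x"
  by (cases x; simp add: shift_cell_simp)+

lemma automorphism_shift: "automorphism (shift_cell s t) (shift_cell s t) id (\<lambda>(a, b). (a + s, b + t))"
  unfolding automorphism_def
proof (intro conjI allI impI)
  show "bij (shift_cell s t :: vtx \<Rightarrow> vtx)" by (rule bij_inv[of "shift_cell (- s) (- t)"]) (simp_all only: shift_cell_shift_cell)
  show "bij (shift_cell s t :: edg \<Rightarrow> edg)" by (rule bij_inv[of "shift_cell (- s) (- t)"]) (simp_all only: shift_cell_shift_cell)
  show "bij (\<lambda>(a, b). (a + s, b + t))"
    by (rule bij_inv[of "\<lambda>(a, b). (a - s, b - t)"]) auto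
  fix e show "white (shift_cell s t e) = shift_cell s t (white e)" "black (shift_cell s t e) = shift_cell s t (black e)"
    by (cases e rule: white.cases; simp add: shift_cell_simp)+
next
  fix k :: nat and a b :: int assume "k < 6"
  then show "set (case case (a, b) of (a, b) \<Rightarrow> (a + s, b + t) of (a', b') \<Rightarrow> face_edge_list (id k) a' b') = shift_cell s t ` set (face_edge_list k a b)"
    unfolding less_6_cases using face_edge_list_simps(2)
    by (elim disjE; simp add: shift_cell_simp face_edge_list_simps algebra_simps)
qed simp

lemma c_value_shift_cell: "c_value v (shift_cell s t ` V) = c_value v V"
proof -
  have "c_value v (shift_cell s t ` V) = c_value (v \<circ> id) V"
    by (rule c_value_automorphism[OF automorphism_shift]) (simp add: shift_cell_def split_def)
  then show ?thesis by simp
qed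

lemma shift_cell_image_iff: "(k, a, b) \<in> shift_cell s t ` V \<longleftrightarrow> (k, a - s, b - t) \<in> V"
  by (force simp: shift_cell_def image_iff)

text \<open>Exchanges the parameters, which lets the recursion continue where
  \<open>j = 0\<close>.\<close>

lemma mir_vtx_regI: "mir_vtx ` regI i j = shift_cell (j - i) i ` regI j i"
  by (rule set_eqI_cells, case_tac k; simp add: mir_vtx_image_iff shift_cell_image_iff reg_defs; smt (z3))

section \<open>Values of the regions\<close>

text \<open>The norm form of the Eisenstein integers, i.e. the squared distance in the triangular
  lattice.\<close>

definition eis_norm :: "int \<Rightarrow> int \<Rightarrow> int" where
  "eis_norm x y = x * x + x * y + y * y"

definition hA :: "(nat \<Rightarrow> 'a::field) \<Rightarrow> 'a" where "hA v = (v 2 * v 4 + v 3 * v 5) / (v 0 * v 1)"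
definition hB :: "(nat \<Rightarrow> 'a::field) \<Rightarrow> 'a" where "hB v = (v 1 * v 4 + v 0 * v 5) / (v 2 * v 3)"
definition hC :: "(nat \<Rightarrow> 'a::field) \<Rightarrow> 'a" where "hC v = (v 1 * v 3 + v 0 * v 2) / (v 4 * v 5)"

text \<open>The points \<open>(0, 0)\<close>, \<open>(1, 0)\<close>, \<open>(0, 1)\<close> are the
  corners of the initial triangle. Each exponent is a third, rounded down, of the squared distance
  to the corner belonging to that ratio.\<close>

definition lattice_val :: "(nat \<Rightarrow> 'a::field) \<Rightarrow> int \<Rightarrow> int \<Rightarrow> 'a" where
  "lattice_val v x y = hA v powi (eis_norm x y div 3) * hB v powi (eis_norm (x - 1) y div 3) * hC v powi (eis_norm x (y - 1) div 3)"

text \<open>This class of weights is closed under mutation and relabelling, see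
  \<open>shuffle_vars_hats\<close> and \<open>nondegen_comp\<close>, as the recursion
  requires.\<close>

definition nondegen :: "(nat \<Rightarrow> 'a::field) \<Rightarrow> bool" where
  "nondegen v \<longleftrightarrow> (\<forall>i<6. v i \<noteq> 0) \<and> hA v \<noteq> 0 \<and> hB v \<noteq> 0 \<and> hC v \<noteq> 0"

lemma nondegenD:
  assumes "nondegen v"
  shows "v 0 \<noteq> 0" "v 1 \<noteq> 0" "v (Suc 0) \<noteq> 0" "v 2 \<noteq> 0" "v 3 \<noteq> 0" "v 4 \<noteq> 0" "v 5 \<noteq> 0" "hA v \<noteq> 0" "hB v \<noteq> 0" "hC v \<noteq> 0"
    "exch_num v \<noteq> 0" "i < 6 \<Longrightarrow> v i \<noteq> 0"
  using assms by (auto simp: nondegen_def hA_def exch_num_def)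

text \<open>The form equals \<open>(x - y) * (x - y)\<close> modulo \<open>3\<close>, so the
  rounding in the exponents is governed by the colour \<open>(x - y) mod 3\<close> alone.\<close>

lemma eis_norm_mod3: "eis_norm x y mod 3 = (if (x - y) mod 3 = 0 then 0 else 1)"
proof -
  have *: "eis_norm x y = (x - y) * (x - y) + 3 * (x * y)" by (simp add: eis_norm_def algebra_simps)
  have "eis_norm x y mod 3 = ((x - y) mod 3) * ((x - y) mod 3) mod 3"
    unfolding * by (simp add: mod_mult_eq)
  moreover have "(x - y) mod 3 = 0 \<or> (x - y) mod 3 = 1 \<or> (x - y) mod 3 = 2" by presburger
  ultimately show ?thesis by (elim disjE) simp_all
qed

lemma eis_norm_div3: "3 * (eis_norm x y div 3) = eis_norm x y - (if (x - y) mod 3 = 0 then 0 else 1)"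
  using eis_norm_mod3[of x y] by (simp split: if_splits) presburger+

text \<open>The exchange relation of the exponents: \<open>(1 - y, 1 - x)\<close> is the reflection of \<open>(x, y)\<close> in the wall opposite to the origin.\<close>
lemma eis_norm_reflect:
  "eis_norm x y div 3 + eis_norm (1 - y) (1 - x) div 3 = eis_norm (x - 1) y div 3 + eis_norm x (y - 1) div 3 + (if (x - y) mod 3 = 0 then 1 else 0)"
proof -
  have s: "eis_norm x y + eis_norm (1 - y) (1 - x) = eis_norm (x - 1) y + eis_norm x (y - 1) + 1" by (simp add: eis_norm_def algebra_simps)
  have m: "(x - y) mod 3 = 0 \<or> (x - y) mod 3 = 1 \<or> (x - y) mod 3 = 2" by presburger
  have m2: "(1 - y - (1 - x)) mod 3 = (x - y) mod 3" "(x - 1 - y) mod 3 = ((x - y) mod 3 + 2) mod 3" "(x - (y - 1)) mod 3 = ((x - y) mod 3 + 1) mod 3"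
    by presburger+
  show ?thesis
    using eis_norm_div3[of x y] eis_norm_div3[of "1 - y" "1 - x"] eis_norm_div3[of "x - 1" y] eis_norm_div3[of x "y - 1"] s m unfolding m2
    by (elim disjE) simp_all
qed

lemma shuffle_vars_simps: "shuffle_vars v 0 = exch_num v / v 1" "shuffle_vars v (Suc 0) = exch_num v / v 0" "shuffle_vars v 2 = v 2" "shuffle_vars v 3 = v 3" "shuffle_vars v 4 = v 4" "shuffle_vars v 5 = v 5"
  by (simp_all add: shuffle_vars_def)

section \<open>Values under mutation and under symmetries\<close>

lemma shuffle_vars_hats:
  assumes "nondegen v"
  shows "hA (shuffle_vars v) = inverse (hA v)" "hB (shuffle_vars v) = hA v * hB v" "hC (shuffle_vars v) = hA v * hC v" "nondegen (shuffle_vars v)"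
proof -
  note z = nondegenD[OF assms]
  have n: "exch_num (shuffle_vars v) = exch_num v" by (simp add: exch_num_def shuffle_vars_simps)
  have h: "hA u = exch_num u / (u 0 * u 1)" for u :: "nat \<Rightarrow> 'a" by (simp add: hA_def exch_num_def)
  show 1: "hA (shuffle_vars v) = inverse (hA v)"
    using z(1-7,11) unfolding h n shuffle_vars_simps One_nat_def by (simp add: field_simps)
  show 2: "hB (shuffle_vars v) = hA v * hB v" "hC (shuffle_vars v) = hA v * hC v"
    using z(1-7,11) unfolding hA_def hB_def hC_def shuffle_vars_simps One_nat_def exch_num_def[symmetric] by (simp_all add: field_simps)
  have "shuffle_vars v i \<noteq> 0" if "i < 6" for i using z(12)[OF that] z(1,2,11) by (simp add: shuffle_vars_def)
  then show "nondegen (shuffle_vars v)" unfolding nondegen_def 1 2 using z by simp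
qed

lemma shuffle_vars_lab:
  assumes "nondegen v" "l < 6"
  shows "shuffle_vars v l = v l * (if l div 2 = 0 then hA v else 1)"
  using assms(2) nondegenD(1,2)[OF assms(1)] unfolding less_6_cases
  by (auto simp: shuffle_vars_simps hA_def exch_num_def)

text \<open>Mutating the initial variables reflects lattice points in the wall opposite the origin.
  The factor \<open>hA v\<close> is the one that the prefactor picks up in
  \<open>shuffle_vars_lab\<close> when its label is \<open>0\<close> or \<open>1\<close>.\<close>

lemma lattice_val_shuffle_vars:
  assumes "nondegen v"
  shows "(if (x - y) mod 3 = 0 then hA v else 1) * lattice_val (shuffle_vars v) x y = lattice_val v (1 - y) (1 - x)"
proof -
  note z = nondegenD[OF assms]
  have e: "eis_norm (1 - y) (1 - x) div 3 = (if (x - y) mod 3 = 0 then 1 else 0) - eis_norm x y div 3 + eis_norm (x - 1) y div 3 + eis_norm x (y - 1) div 3"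
    using eis_norm_reflect[of x y] by simp
  have n: "eis_norm (1 - y - 1) (1 - x) = eis_norm (x - 1) y" "eis_norm (1 - y) (1 - x - 1) = eis_norm x (y - 1)"
    by (simp_all add: eis_norm_def algebra_simps)
  have pa: "hA v powi (c - a + b + d) = hA v powi c * inverse (hA v powi a) * hA v powi b * hA v powi d" for a b c d
    using z(8) by (simp add: power_int_add power_int_diff divide_inverse)
  have "inverse (hA v) powi n = inverse (hA v powi n)" for n by (simp add: power_int_inverse)
  then show ?thesis
    unfolding lattice_val_def shuffle_vars_hats(1-3)[OF assms] e n pa power_int_mult_distrib by (simp add: mult_ac)
qed

text \<open>Quantified over all nondegenerate weights because the recursion inserts
  \<open>shuffle_vars v\<close>. Only the pair of the label \<open>l\<close> is recorded: a half
  turn of the region exchanges the two candidates. The argument \<open>T\<close> fixes the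
  field.\<close>

definition has_value :: "'a::field itself \<Rightarrow> vtx set \<Rightarrow> int \<Rightarrow> int \<Rightarrow> bool" where
  "has_value T V x y \<longleftrightarrow> (\<exists>l<6. int (l div 2) = (x - y) mod 3 \<and> (\<forall>v :: nat \<Rightarrow> 'a. nondegen v \<longrightarrow> c_value v V = v l * lattice_val v x y))"

lemma has_value_shuffle_vars:
  assumes "has_value T V' x y" "\<And>v :: nat \<Rightarrow> 'a::field. nondegen v \<Longrightarrow> c_value v V = c_value (shuffle_vars v) V'"
  shows "has_value (T :: 'a itself) V (1 - y) (1 - x)"
proof -
  obtain l where l: "l < 6" "int (l div 2) = (x - y) mod 3" "\<And>v :: nat \<Rightarrow> 'a. nondegen v \<Longrightarrow> c_value v V' = v l * lattice_val v x y"
    using assms(1) unfolding has_value_def by blast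
  have "c_value v V = v l * lattice_val v (1 - y) (1 - x)" if g: "nondegen v" for v :: "nat \<Rightarrow> 'a"
  proof -
    have "(l div 2 = 0) = ((x - y) mod 3 = 0)" using l(2) by linarith
    then show ?thesis
      using assms(2)[OF g] l(3)[OF shuffle_vars_hats(4)[OF g]] lattice_val_shuffle_vars[OF g, of x y] shuffle_vars_lab[OF g l(1)]
      by (simp add: mult_ac split: if_splits)
  qed
  moreover have "(1 - y - (1 - x)) mod 3 = (x - y) mod 3" by simp
  ultimately show ?thesis using l unfolding has_value_def by metis
qed

lemma rot_hats: "hA (v \<circ> rot_label) = hC v" "hB (v \<circ> rot_label) = hA v" "hC (v \<circ> rot_label) = hB v"
  unfolding hA_def hB_def hC_def One_nat_def by (simp_all add: rot_label_simps mult.commute add.commute)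

lemma rot'_hats: "hA (v \<circ> rot_label') = hB v" "hB (v \<circ> rot_label') = hC v" "hC (v \<circ> rot_label') = hA v"
  unfolding hA_def hB_def hC_def One_nat_def by (simp_all add: rot_label_simps mult.commute add.commute)

lemma mir_hats: "hA (v \<circ> mir_label) = hB v" "hB (v \<circ> mir_label) = hA v" "hC (v \<circ> mir_label) = hC v"
  unfolding hA_def hB_def hC_def One_nat_def by (simp_all add: rot_label_simps mult.commute add.commute)

lemma nondegen_comp:
  assumes "nondegen v" shows "nondegen (v \<circ> rot_label)" "nondegen (v \<circ> rot_label')" "nondegen (v \<circ> mir_label)"
  using assms unfolding nondegen_def rot_hats rot'_hats mir_hats by (auto simp: less_6_cases rot_label_simps)

lemma rot_label_inv: "i < 6 \<Longrightarrow> rot_label (rot_label' i) = i" "i < 6 \<Longrightarrow> rot_label' (rot_label i) = i"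
  unfolding less_6_cases by (auto simp: rot_label_simps)

text \<open>The relabelling permutes the three ratios cyclically, and
  \<open>(x, y) \<mapsto> (y, 1 - x - y)\<close> permutes the corners of the initial triangle
  accordingly; it has order three.\<close>

lemma lattice_val_rot: "lattice_val (v \<circ> rot_label) x y = lattice_val v y (1 - x - y)"
proof -
  have "eis_norm y (1 - x - y) = eis_norm (x - 1) y" "eis_norm (y - 1) (1 - x - y) = eis_norm x (y - 1)" "eis_norm y (1 - x - y - 1) = eis_norm x y"
    by (simp_all add: eis_norm_def algebra_simps)
  then show ?thesis unfolding lattice_val_def rot_hats by (simp add: mult_ac)
qed

lemma lattice_val_mir: "lattice_val (v \<circ> mir_label) x y = lattice_val v (1 - x - y) y"
proof -
  have "eis_norm (1 - x - y) y = eis_norm (x - 1) y" "eis_norm (1 - x - y - 1) y = eis_norm x y" "eis_norm (1 - x - y) (y - 1) = eis_norm x (y - 1)"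
    by (simp_all add: eis_norm_def algebra_simps)
  then show ?thesis unfolding lattice_val_def mir_hats by (simp add: mult_ac)
qed

lemma lab_div: 
  "l < 6 \<Longrightarrow> int (rot_label l div 2) = (int (l div 2) + 2) mod 3"
  "l < 6 \<Longrightarrow> int (rot_label' l div 2) = (int (l div 2) + 1) mod 3"
  "l < 6 \<Longrightarrow> int (mir_label l div 2) = (1 - int (l div 2)) mod 3"
  "l < 6 \<Longrightarrow> rot_label l < 6" "l < 6 \<Longrightarrow> rot_label' l < 6" "l < 6 \<Longrightarrow> mir_label l < 6"
  unfolding less_6_cases by (auto simp: rot_label_simps)

lemma has_value_rot: "has_value T V x y \<Longrightarrow> has_value T (rot_vtx ` V) y (1 - x - y)"
proof -
  assume "has_value T V x y"
  then obtain l where l: "l < 6" "int (l div 2) = (x - y) mod 3" "\<And>v :: nat \<Rightarrow> 'a. nondegen v \<Longrightarrow> c_value v V = v l * lattice_val v x y"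
    unfolding has_value_def by blast
  have "c_value v (rot_vtx ` V) = v (rot_label l) * lattice_val v y (1 - x - y)" if "nondegen v" for v :: "nat \<Rightarrow> 'a"
    unfolding c_value_rot_vtx l(3)[OF nondegen_comp(1)[OF that]] lattice_val_rot by simp
  moreover have "int (rot_label l div 2) = (y - (1 - x - y)) mod 3"
    unfolding lab_div(1)[OF l(1)] l(2) by presburger
  ultimately show ?thesis unfolding has_value_def using lab_div(4)[OF l(1)] by blast
qed

text \<open>Serves to compose relabellings, as \<open>rot_label'\<close> inverts
  \<open>rot_label\<close> on the labels below \<open>6\<close> only.\<close>

lemma c_value_cong:
  assumes "\<And>i. i < 6 \<Longrightarrow> v i = w i"
  shows "c_value v V = c_value w V"
proof -
  have "edge_wt v k = edge_wt w k" for k by (cases k) (simp_all add: assms)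
  then show ?thesis unfolding c_value_def wsum_def wt_def by (simp add: assms)
qed

lemma has_value_rot': "has_value T (rot_vtx ` V) x y \<Longrightarrow> has_value T V (1 - x - y) x"
proof -
  assume "has_value T (rot_vtx ` V) x y"
  then obtain l where l: "l < 6" "int (l div 2) = (x - y) mod 3" "\<And>v :: nat \<Rightarrow> 'a. nondegen v \<Longrightarrow> c_value v (rot_vtx ` V) = v l * lattice_val v x y"
    unfolding has_value_def by blast
  have "c_value v V = v (rot_label' l) * lattice_val v (1 - x - y) x" if "nondegen v" for v :: "nat \<Rightarrow> 'a"
  proof -
    have F: "lattice_val v (1 - x - y) x = lattice_val (v \<circ> rot_label') x y"
    proof -
      have "eis_norm (1 - x - y) x = eis_norm x (y - 1)" "eis_norm (1 - x - y - 1) x = eis_norm x y" "eis_norm (1 - x - y) (x - 1) = eis_norm (x - 1) y"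
        by (simp_all add: eis_norm_def algebra_simps)
      then show ?thesis unfolding lattice_val_def rot'_hats by (simp add: mult_ac)
    qed
    have "c_value v V = c_value (v \<circ> rot_label' \<circ> rot_label) V" by (rule c_value_cong) (simp add: rot_label_inv)
    also have "\<dots> = c_value (v \<circ> rot_label') (rot_vtx ` V)" by (simp add: c_value_rot_vtx)
    also have "\<dots> = v (rot_label' l) * lattice_val v (1 - x - y) x" unfolding l(3)[OF nondegen_comp(2)[OF that]] F by simp
    finally show ?thesis .
  qed
  moreover have "int (rot_label' l div 2) = (1 - x - y - x) mod 3"
    unfolding lab_div(2)[OF l(1)] l(2) by presburger
  ultimately show ?thesis unfolding has_value_def using lab_div(5)[OF l(1)] by blast
qed

lemma has_value_mir: "has_value T V x y \<Longrightarrow> has_value T (mir_vtx ` V) (1 - x - y) y"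
proof -
  assume "has_value T V x y"
  then obtain l where l: "l < 6" "int (l div 2) = (x - y) mod 3" "\<And>v :: nat \<Rightarrow> 'a. nondegen v \<Longrightarrow> c_value v V = v l * lattice_val v x y"
    unfolding has_value_def by blast
  have "c_value v (mir_vtx ` V) = v (mir_label l) * lattice_val v (1 - x - y) y" if "nondegen v" for v :: "nat \<Rightarrow> 'a"
    unfolding c_value_mir_vtx l(3)[OF nondegen_comp(3)[OF that]] lattice_val_mir by simp
  moreover have "int (mir_label l div 2) = (1 - x - y - y) mod 3"
    unfolding lab_div(3)[OF l(1)] l(2) by presburger
  ultimately show ?thesis unfolding has_value_def using lab_div(6)[OF l(1)] by blast
qed

lemma has_value_shift_cell: "has_value T (shift_cell s t ` V) x y \<longleftrightarrow> has_value T V x y"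
  unfolding has_value_def c_value_shift_cell ..

lemma regRI_0_1: "regRI 0 1 = {(Hv, - 1, 1), (Xv, 0, 0)}"
  by (rule set_eqI_cells, case_tac k; simp add: mem_defs; smt (z3))

text \<open>The weight of the edge is cancelled by the two faces beside it, so no variable is left.
  Hence the smallest member of the first family does not realise the lattice point
  \<open>(0, 1)\<close>.\<close>

lemma c_value_edge:
  fixes v :: "nat \<Rightarrow> 'a::field"
  assumes "nondegen v"
  shows "c_value v (regRI 0 1) = 1"
proof -
  let ?e = "(E25, - 1, 1) :: edg"
  have E: "edges_in (regRI 0 1) = {?e}"
  proof -
    have "e \<in> edges_in (regRI 0 1) \<longleftrightarrow> e = ?e" for e
      unfolding edges_in_def regRI_0_1 by (cases e rule: white.cases) auto
    then show ?thesis by blast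
  qed
  have "M \<in> matchings (regRI 0 1) \<longleftrightarrow> M = {?e}" for M
  proof
    assume M: "M \<in> matchings (regRI 0 1)"
    then have "M \<subseteq> {?e}" by (simp add: matchings_def E)
    moreover have "\<exists>e. e \<in> M" using M unfolding matchings_def regRI_0_1 by blast
    ultimately show "M = {?e}" by blast
  next
    assume "M = {?e}"
    then show "M \<in> matchings (regRI 0 1)" by (auto simp: matchings_def E[unfolded regRI_0_1] regRI_0_1)
  qed
  then have "matchings (regRI 0 1) = {{?e}}" by blast
  then have w: "wsum v (regRI 0 1) = 1 / (v 2 * v 5)" by (simp add: wsum_def wt_def)
  have b: "{(a, b). bordered (regRI 0 1) k a b} = (if k = 2 then {(0, 1)} else if k = 5 then {(- 1, 1)} else {})" if "k < 6" for k
    using that unfolding less_6_cases by (elim disjE; simp add: bordered_simps regRI_0_1; auto)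
  have "bordered_count (regRI 0 1) k = (if k = 2 \<or> k = 5 then 1 else 0)" if "k < 6" for k
    using b[OF that] by (auto simp: bordered_count_def count_def)
  then have "c_value v (regRI 0 1) = 1 / (v 2 * v 5) * (v 2 * v 5)"
    unfolding c_value_def w prod6 by simp
  then show ?thesis using nondegenD[OF assms] by simp
qed

text \<open>The base case: since the single edge has value \<open>1\<close>, the correction factor
  of \<open>c_value_regRII_regRI\<close> is the whole value. It is the mutated variable at the
  vertex \<open>0\<close>, attached to the reflected corner \<open>(1, 1)\<close>.\<close>

lemma has_value_II01: "has_value (T :: 'a::field itself) (regII 0 1) (- 1) 1"
proof -
  have "c_value v (regRII 0 1) = v 1 * lattice_val v 1 1" if g: "nondegen v" for v :: "nat \<Rightarrow> 'a"
  proof -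
    have "c_value v (regRII 0 1) = exch_num v / v 0"
      using c_value_regRII_regRI[where v = v and i = 0 and j = 1] nondegenD[OF g] c_value_edge[OF shuffle_vars_hats(4)[OF g]] by simp
    also have "\<dots> = v 1 * hA v" using nondegenD[OF g] by (simp add: hA_def exch_num_def)
    also have "hA v = lattice_val v 1 1" by (simp add: lattice_val_def eis_norm_def)
    finally show ?thesis .
  qed
  then have "has_value T (regRII 0 1) 1 1" unfolding has_value_def by (intro exI[of _ 1]) simp
  then show ?thesis using has_value_rot'[of T "regII 0 1" 1 1] by (simp add: rot_vtx_regII)
qed

lemma has_value_A:
  assumes "has_value (T :: 'a::field itself) (regII i j) (- i - j) (1 + i)" "i \<ge> 0" "j \<ge> 1"
  shows "has_value T (regI i j) (- i) (1 + i + j)"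
proof -
  have "c_value v (regI i j) = c_value (shuffle_vars v) (regII i j)" if "nondegen v" for v :: "nat \<Rightarrow> 'a"
    using c_value_regI_regII[where v = v and i = i and j = j] nondegenD[OF that] assms(2,3) by auto
  then have "has_value T (regI i j) (1 - (1 + i)) (1 - (- i - j))" by (rule has_value_shuffle_vars[OF assms(1)])
  then show ?thesis by (simp add: algebra_simps)
qed

lemma has_value_B:
  assumes "has_value (T :: 'a::field itself) (regI i (j - 1)) (- i) (i + j)" "i \<ge> 0" "j \<ge> 1" "(i, j) \<noteq> (0, 1)"
  shows "has_value T (regII i j) (- i - j) (1 + i)"
proof -
  have "has_value T (regRI i j) (1 - j) (- i)"
    using has_value_rot'[of T "regRI i j" "- i" "i + j"] assms(1) by (simp add: rot_vtx_regRI)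
  moreover have "c_value v (regRII i j) = c_value (shuffle_vars v) (regRI i j)" if "nondegen v" for v :: "nat \<Rightarrow> 'a"
    using c_value_regRII_regRI[where v = v and i = i and j = j] nondegenD[OF that] assms(2-4) by auto
  ultimately have "has_value T (regRII i j) (1 - (- i)) (1 - (1 - j))" by (rule has_value_shuffle_vars)
  then show ?thesis using has_value_rot'[of T "regII i j" "1 + i" j] by (simp add: rot_vtx_regII algebra_simps)
qed

theorem has_value_reg:
  assumes "i \<ge> 0" "j \<ge> 0" "(i, j) \<noteq> (0, 0)"
  shows "has_value (T :: 'a::field itself) (regI i j) (- i) (1 + i + j) \<and> (j \<ge> 1 \<longrightarrow> has_value T (regII i j) (- i - j) (1 + i))"
  using assms
proof (induction "nat (i + j)" arbitrary: i j rule: less_induct)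
  case less
  \<comment> \<open>Stated for all pairs with sum \<open>s\<close> because the case
    \<open>j = 0\<close> applies it to the mirrored pair \<open>(0, i)\<close>, which has the same
    size and is out of reach of the induction hypothesis.\<close>
  have main: "has_value T (regI i j) (- i) (1 + i + j) \<and> has_value T (regII i j) (- i - j) (1 + i)"
    if ij: "i \<ge> 0" "j \<ge> 1" "i + j = s" and IH: "\<And>i' j'. i' \<ge> 0 \<Longrightarrow> j' \<ge> 0 \<Longrightarrow> i' + j' < s \<Longrightarrow> (i', j') \<noteq> (0, 0) \<Longrightarrow> has_value T (regI i' j') (- i') (1 + i' + j')" for i j s
  proof -
    have "has_value T (regII i j) (- i - j) (1 + i)"
    proof (cases "(i, j) = (0, 1)")
      case True then show ?thesis using has_value_II01 by auto
    next
      case False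
      have "has_value T (regI i (j - 1)) (- i) (1 + i + (j - 1))" by (rule IH) (use ij False in auto)
      then show ?thesis using has_value_B[of T i j] ij False by (simp add: algebra_simps)
    qed
    then show ?thesis using has_value_A ij by blast
  qed
  have IH: "has_value T (regI i' j') (- i') (1 + i' + j')" if "i' \<ge> 0" "j' \<ge> 0" "i' + j' < i + j" "(i', j') \<noteq> (0, 0)" for i' j'
    using less(1)[of i' j'] that by auto
  show ?case
  proof (cases "j \<ge> 1")
    case True then show ?thesis using main[OF less(2) True refl IH] by blast
  next
    case False
    then have j: "j = 0" "i \<ge> 1" using less by auto
    have "has_value T (regI 0 i) (- 0) (1 + 0 + i)" using main[of 0 i "i + j"] IH j by auto
    then have "has_value T (mir_vtx ` regI 0 i) (1 - 0 - (1 + i)) (1 + i)" using has_value_mir[of T "regI 0 i" 0 "1 + i"] by simp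
    then show ?thesis using j by (simp add: mir_vtx_regI has_value_shift_cell algebra_simps)
  qed
qed

section \<open>Comparison with the drawing\<close>

fun point_of :: "vtx \<Rightarrow> point" where
  "point_of (Ov, a, b) = (6 * a, 6 * b)"
| "point_of (Hv, a, b) = (6 * a + 3, 6 * b)"
| "point_of (Sv, a, b) = (6 * a, 6 * b + 3)"
| "point_of (Tv, a, b) = (6 * a - 3, 6 * b + 3)"
| "point_of (Wv, a, b) = (6 * a + 2, 6 * b + 2)"
| "point_of (Xv, a, b) = (6 * a - 2, 6 * b + 4)"

definition edge_of :: "edg \<Rightarrow> point set" where
  "edge_of e = {point_of (white e), point_of (black e)}"

lemma point_of_eq_iff: "point_of u = point_of v \<longleftrightarrow> u = v"
  by (cases u rule: point_of.cases; cases v rule: point_of.cases; simp; presburger)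

lemma white_black_inj: "white e = white e' \<Longrightarrow> black e = black e' \<Longrightarrow> e = e'"
  by (cases e rule: white.cases; cases e' rule: white.cases; simp)

lemma edge_of_eq_iff: "edge_of e = edge_of e' \<longleftrightarrow> e = e'"
  unfolding edge_of_def doubleton_eq_iff point_of_eq_iff using white_neq_black white_black_inj by metis

lemma point_of_in_edge_of: "point_of v \<in> edge_of e \<longleftrightarrow> ends e v"
  by (auto simp: edge_of_def point_of_eq_iff)

lemma face_edges_face_edge_list:
  assumes "k < 6"
  shows "face_edges (k, a, b) = edge_of ` set (face_edge_list k a b)"
  using assms unfolding less_6_cases using face_edge_list_simps(2)[of a b]
  by (elim disjE; simp add: face_edges_def nth_kite translate_def face_edge_list_simps edge_of_def algebra_simps insert_commute)

lemma mem_face_edges: "k < 6 \<Longrightarrow> edge_of e \<in> face_edges (k, a, b) \<longleftrightarrow> e \<in> set (face_edge_list k a b)"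
  by (auto simp: face_edges_face_edge_list image_iff edge_of_eq_iff)

lemma in_some_face: "\<exists>k<6. \<exists>a b. e \<in> set (face_edge_list k a b)"
proof -
  have "\<exists>k a b. (k = 3 \<or> k = 5 \<or> k = 2 \<or> k = 4 \<or> k = 0) \<and> e \<in> set (face_edge_list k a b)"
  proof (cases e rule: white.cases)
    case (1 a b) then show ?thesis by (intro exI[of _ 3] exI[of _ a] exI[of _ b]) (simp add: face_edge_list_simps)
  next
    case (2 a b) then show ?thesis by (intro exI[of _ 2] exI[of _ a] exI[of _ "b + 1"]) (simp add: face_edge_list_simps)
  next
    case (3 a b) then show ?thesis by (intro exI[of _ 5] exI[of _ "a - 1"] exI[of _ "b + 1"]) (simp add: face_edge_list_simps)
  next
    case (4 a b) then show ?thesis by (intro exI[of _ 4] exI[of _ a] exI[of _ b]) (simp add: face_edge_list_simps)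
  next
    case (5 a b) then show ?thesis by (intro exI[of _ 2] exI[of _ a] exI[of _ b]) (simp add: face_edge_list_simps)
  next
    case (6 a b) then show ?thesis by (intro exI[of _ 0] exI[of _ a] exI[of _ b]) (simp add: face_edge_list_simps)
  next
    case (7 a b) then show ?thesis by (intro exI[of _ 0] exI[of _ a] exI[of _ b]) (simp add: face_edge_list_simps)
  next
    case (8 a b) then show ?thesis by (intro exI[of _ 0] exI[of _ a] exI[of _ b]) (simp add: face_edge_list_simps)
  next
    case (9 a b) then show ?thesis by (intro exI[of _ 3] exI[of _ a] exI[of _ b]) (simp add: face_edge_list_simps)
  next
    case (10 a b) then show ?thesis by (intro exI[of _ 4] exI[of _ a] exI[of _ b]) (simp add: face_edge_list_simps)
  next
    case (11 a b) then show ?thesis by (intro exI[of _ 3] exI[of _ a] exI[of _ b]) (simp add: face_edge_list_simps)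
  next
    case (12 a b) then show ?thesis by (intro exI[of _ 5] exI[of _ a] exI[of _ b]) (simp add: face_edge_list_simps)
  qed
  then obtain k a b where "k = 3 \<or> k = 5 \<or> k = 2 \<or> k = 4 \<or> k = (0::nat)" "e \<in> set (face_edge_list k a b)" by blast
  moreover from this(1) have "k < 6" by auto
  ultimately show ?thesis by blast
qed

lemma tiling_edges_edge_of: "tiling_edges = range edge_of"
proof
  show "tiling_edges \<subseteq> range edge_of"
    unfolding tiling_edges_def faces_def using face_edges_face_edge_list by fastforce
  show "range edge_of \<subseteq> tiling_edges"
  proof (rule image_subsetI)
    fix e
    obtain k a b where k: "k < 6" "e \<in> set (face_edge_list k a b)" using in_some_face by blast
    then have "edge_of e \<in> face_edges (k, a, b)" "(k, a, b) \<in> faces" by (simp_all add: mem_face_edges faces_def)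
    then show "edge_of e \<in> tiling_edges" unfolding tiling_edges_def by blast
  qed
qed

lemma point_of_vertices: "point_of v \<in> tiling_vertices"
proof -
  have t: "translate a b p \<in> tiling_vertices" if "p \<in> {(0, 0), (2, 2), (-2, 4), (-3, 3), (3, 0), (0, 3)}" for a b p
    unfolding tiling_vertices_eq using that by blast
  show ?thesis
  proof (cases v rule: point_of.cases)
    case (1 a b) then show ?thesis using t[of "(0, 0)" a b] by (simp add: translate_def)
  next
    case (2 a b) then show ?thesis using t[of "(3, 0)" a b] by (simp add: translate_def add.commute)
  next
    case (3 a b) then show ?thesis using t[of "(0, 3)" a b] by (simp add: translate_def add.commute)
  next
    case (4 a b) then show ?thesis using t[of "(-3, 3)" a b] by (simp add: translate_def add.commute)
  next
    case (5 a b) then show ?thesis using t[of "(2, 2)" a b] by (simp add: translate_def add.commute)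
  next
    case (6 a b) then show ?thesis using t[of "(-2, 4)" a b] by (simp add: translate_def add.commute)
  qed
qed

lemma induced_edge_of: "induced_edges (point_of ` V) = edge_of ` edges_in V"
proof -
  have "edge_of e \<subseteq> point_of ` V \<longleftrightarrow> e \<in> edges_in V" for e
    by (auto simp: edge_of_def edges_in_def point_of_eq_iff)
  then show ?thesis unfolding induced_edges_def tiling_edges_edge_of by blast
qed

lemma perfect_matchings_edge_of: "perfect_matchings (point_of ` V) = (`) edge_of ` matchings V"
proof -
  have ie: "inj edge_of" by (rule injI) (simp add: edge_of_eq_iff)
  have iff: "edge_of ` M \<in> perfect_matchings (point_of ` V) \<longleftrightarrow> M \<in> matchings V" for M
  proof -
    have 1: "edge_of ` M \<subseteq> edge_of ` edges_in V \<longleftrightarrow> M \<subseteq> edges_in V" using ie by (simp add: inj_image_subset_iff)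
    have "(\<exists>!e. e \<in> edge_of ` M \<and> point_of v \<in> e) \<longleftrightarrow> (\<exists>!e. e \<in> M \<and> ends e v)" for v
    proof
      assume "\<exists>!e. e \<in> M \<and> ends e v"
      then obtain e where e: "e \<in> M" "ends e v" "\<And>e'. e' \<in> M \<Longrightarrow> ends e' v \<Longrightarrow> e' = e" by blast
      show "\<exists>!e. e \<in> edge_of ` M \<and> point_of v \<in> e"
      proof (rule ex1I[of _ "edge_of e"])
        show "edge_of e \<in> edge_of ` M \<and> point_of v \<in> edge_of e" using e(1,2) by (simp add: point_of_in_edge_of)
        fix d assume d: "d \<in> edge_of ` M \<and> point_of v \<in> d"
        then obtain d' where d': "d = edge_of d'" "d' \<in> M" by blast
        then have "ends d' v" using d by (simp add: point_of_in_edge_of)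
        then show "d = edge_of e" using e(3)[of d'] d' by simp
      qed
    next
      assume "\<exists>!e. e \<in> edge_of ` M \<and> point_of v \<in> e"
      then obtain x where x: "x \<in> edge_of ` M" "point_of v \<in> x" and u': "\<And>d. d \<in> edge_of ` M \<Longrightarrow> point_of v \<in> d \<Longrightarrow> d = x" by (elim ex1E conjE) blast
      from x(1) obtain e where xe: "x = edge_of e" and "e \<in> M" by (rule imageE)
      then have e: "e \<in> M" "ends e v" using x(2) by (simp_all add: point_of_in_edge_of)
      note u = u'[unfolded xe]
      show "\<exists>!e. e \<in> M \<and> ends e v"
      proof (rule ex1I[of _ e])
        show "e \<in> M \<and> ends e v" using e(1,2) by simp
        fix d assume "d \<in> M \<and> ends d v"
        then have "edge_of d = edge_of e" using u[of "edge_of d"] by (simp add: point_of_in_edge_of)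
        then show "d = e" by (simp add: edge_of_eq_iff)
      qed
    qed
    then show ?thesis unfolding perfect_matchings_def matchings_def induced_edge_of mem_Collect_eq 1 by simp
  qed
  show ?thesis
  proof
    show "(`) edge_of ` matchings V \<subseteq> perfect_matchings (point_of ` V)" using iff by blast
    show "perfect_matchings (point_of ` V) \<subseteq> (`) edge_of ` matchings V"
    proof
      fix M assume M: "M \<in> perfect_matchings (point_of ` V)"
      then have "M \<subseteq> range edge_of" unfolding perfect_matchings_def induced_edge_of by blast
      then obtain M' where "M = edge_of ` M'" by (metis subset_imageE)
      then show "M \<in> (`) edge_of ` matchings V" using iff M by blast
    qed
  qed
qed

fun faces_of :: "edg \<Rightarrow> face set" where
  "faces_of (E31, a, b) = {(3, a, b), (1, a, b)}"
| "faces_of (E12, a, b) = {(1, a, b), (2, a, b + 1)}"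
| "faces_of (E51, a, b) = {(1, a, b), (5, a - 1, b + 1)}"
| "faces_of (E14, a, b) = {(1, a, b), (4, a, b)}"
| "faces_of (E20, a, b) = {(0, a, b), (2, a, b)}"
| "faces_of (E03, a, b) = {(0, a, b), (3, a, b - 1)}"
| "faces_of (E40, a, b) = {(0, a, b), (4, a + 1, b - 1)}"
| "faces_of (E05, a, b) = {(0, a, b), (5, a, b)}"
| "faces_of (E53, a, b) = {(5, a, b), (3, a, b)}"
| "faces_of (E42, a, b) = {(4, a, b), (2, a, b)}"
| "faces_of (E34, a, b) = {(3, a, b), (4, a + 1, b)}"
| "faces_of (E25, a, b) = {(5, a, b), (2, a + 1, b)}"

lemma mem_faces_of: "(k, a, b) \<in> faces_of e \<longleftrightarrow> k < 6 \<and> e \<in> set (face_edge_list k a b)"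
proof -
  have "e \<in> set (face_edge_list k a b) \<longleftrightarrow> (k, a, b) \<in> faces_of e" if "k < 6"
    using that face_edge_list_simps(2)[of a b] unfolding less_6_cases
    by (elim disjE; cases e rule: faces_of.cases; simp add: face_edge_list_simps; linarith)
  moreover have "k < 6" if "(k, a, b) \<in> faces_of e" using that by (cases e rule: faces_of.cases) auto
  ultimately show ?thesis by blast
qed

lemma edge_weight_edge_of: "edge_weight (edge_of e) = edge_wt var (fst e)"
proof -
  have "{f \<in> faces. edge_of e \<in> face_edges f} = faces_of e"
  proof -
    have "(k, a, b) \<in> {f \<in> faces. edge_of e \<in> face_edges f} \<longleftrightarrow> (k, a, b) \<in> faces_of e" for k a b
      unfolding mem_faces_of by (auto simp: faces_def mem_face_edges)
    then show ?thesis by auto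
  qed
  then show ?thesis unfolding edge_weight_def
    by (cases e rule: faces_of.cases) (simp_all add: mult.commute)
qed

definition cross :: "vtx set \<Rightarrow> (face \<times> face) set" where
  "cross V = {(f, g). \<exists>e. f \<in> faces_of e \<and> g \<in> faces_of e \<and> e \<notin> edges_in V}"

lemma crossing_cross: "crossing (point_of ` V) = cross V"
proof -
  have m: "f \<in> faces \<and> edge_of e \<in> face_edges f \<longleftrightarrow> f \<in> faces_of e" for e f
    by (cases f) (auto simp: faces_def mem_faces_of mem_face_edges)
  have i: "edge_of e \<in> induced_edges (point_of ` V) \<longleftrightarrow> e \<in> edges_in V" for e
    by (auto simp: induced_edge_of edge_of_eq_iff)
  have r: "x \<in> range edge_of" if "x \<in> face_edges f" "f \<in> faces" for x f
    using that unfolding tiling_edges_edge_of[symmetric] tiling_edges_def by blast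
  show ?thesis
  proof (intro set_eqI iffI)
    fix p assume "p \<in> crossing (point_of ` V)"
    then obtain f g x where p: "p = (f, g)" "f \<in> faces" "g \<in> faces" "x \<in> face_edges f" "x \<in> face_edges g" "x \<notin> induced_edges (point_of ` V)"
      unfolding crossing_def by blast
    obtain e where "x = edge_of e" using r p by blast
    then show "p \<in> cross V" unfolding cross_def using p m i by blast
  next
    fix p assume "p \<in> cross V"
    then obtain f g e where p: "p = (f, g)" "f \<in> faces_of e" "g \<in> faces_of e" "e \<notin> edges_in V"
      unfolding cross_def by blast
    then show "p \<in> crossing (point_of ` V)" unfolding crossing_def using m i by blast
  qed
qed

definition bordered_face :: "vtx set \<Rightarrow> face \<Rightarrow> bool" where
  "bordered_face V f \<longleftrightarrow> (\<exists>e\<in>edges_in V. f \<in> faces_of e)"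

text \<open>Faces on the border are left out: they enter the covering monomial whether enclosed or
  not.\<close>

definition no_enclosed :: "vtx set \<Rightarrow> bool" where
  "no_enclosed V \<longleftrightarrow> (\<forall>f\<in>faces. \<not> bordered_face V f \<longrightarrow> infinite {g. (f, g) \<in> (cross V)\<^sup>*})"

lemma bordered_face_bordered: "k < 6 \<Longrightarrow> bordered_face V (k, a, b) \<longleftrightarrow> bordered V k a b"
  unfolding bordered_face_def bordered_iff mem_faces_of by blast

lemma borders_bordered_face: "f \<in> faces \<Longrightarrow> borders f (point_of ` V) \<longleftrightarrow> bordered_face V f"
proof -
  assume f: "f \<in> faces"
  obtain k a b where fk: "f = (k, a, b)" by (cases f)
  have "edge_of e \<in> face_edges f \<longleftrightarrow> f \<in> faces_of e" for e
    using f by (simp add: fk faces_def mem_faces_of mem_face_edges)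
  then show ?thesis unfolding borders_def bordered_face_def induced_edge_of by blast
qed

lemma covering_exponent_bordered_count:
  assumes "no_enclosed V" "k < 6"
  shows "int (covering_exponent (point_of ` V) k) = bordered_count V k"
proof -
  have "{f \<in> faces. label f = k \<and> (enclosed f (point_of ` V) \<or> borders f (point_of ` V))} = {f \<in> faces. label f = k \<and> bordered_face V f}"
    using assms(1) unfolding no_enclosed_def enclosed_def crossing_cross by (auto simp: borders_bordered_face)
  also have "\<dots> = Pair k ` {(a, b). bordered V k a b}"
    using assms(2) by (auto simp: faces_def bordered_face_bordered)
  finally show ?thesis
    by (simp add: covering_exponent_def bordered_count_def count_def card_image inj_on_def)
qed

lemma graph_c_c_value:
  assumes "no_enclosed V"
  shows "graph_c (point_of ` V) = c_value var V"
proof -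
  have ie: "inj edge_of" by (rule injI) (simp add: edge_of_eq_iff)
  have "(\<Prod>e\<in>edge_of ` M. edge_weight e) = (\<Prod>e\<in>M. edge_wt var (fst e))" for M
    using prod.reindex[where h = edge_of and A = M and g = edge_weight, OF inj_on_subset[OF ie subset_UNIV]] by (simp add: edge_weight_edge_of comp_def)
  moreover have "inj_on ((`) edge_of) (matchings V)" by (simp add: inj_on_def inj_image_eq_iff[OF ie])
  ultimately have "graph_weight (point_of ` V) = wsum var V"
    unfolding graph_weight_def perfect_matchings_edge_of wsum_def wt_def
    by (subst sum.reindex) simp_all
  moreover have "covering_monomial (point_of ` V) = (\<Prod>k<6. var k powi bordered_count V k)"
    unfolding covering_monomial_def
    by (rule prod.cong) (auto simp: covering_exponent_bordered_count[OF assms, symmetric])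
  ultimately show ?thesis by (simp add: graph_c_def c_value_def)
qed

section \<open>Absence of enclosed faces\<close>

fun faces_at_vtx :: "vtx \<Rightarrow> face list" where
  "faces_at_vtx (Ov, a, b) = [(3, a, b), (1, a, b), (4, a, b), (2, a, b), (0, a, b), (5, a, b)]"
| "faces_at_vtx (Hv, a, b) = [(3, a, b), (4, a + 1, b), (2, a + 1, b), (5, a, b)]"
| "faces_at_vtx (Sv, a, b) = [(3, a, b), (1, a, b), (2, a, b + 1), (0, a, b + 1)]"
| "faces_at_vtx (Tv, a, b) = [(1, a, b), (4, a, b), (0, a - 1, b + 1), (5, a - 1, b + 1)]"
| "faces_at_vtx (Wv, a, b) = [(3, a, b), (4, a + 1, b), (0, a, b + 1)]"
| "faces_at_vtx (Xv, a, b) = [(1, a, b), (2, a, b + 1), (5, a - 1, b + 1)]"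

text \<open>All faces around an absent vertex are joined by crossing its edges, so the first one may
  represent them; see \<open>escapes_iff\<close>.\<close>

definition escapes :: "vtx set \<Rightarrow> vtx \<Rightarrow> bool" where
  "escapes V v \<longleftrightarrow> v \<notin> V \<and> infinite {g. (hd (faces_at_vtx v), g) \<in> (cross V)\<^sup>*}"

lemma sym_cross: "sym ((cross V)\<^sup>*)"
  by (rule sym_rtrancl) (auto simp: sym_def cross_def)

lemma cross_vertex:
  assumes "v \<notin> V" "ends e v" "f \<in> faces_of e" "g \<in> faces_of e"
  shows "(f, g) \<in> cross V"
proof -
  have "e \<notin> edges_in V" using assms(1,2) by (auto simp: edges_in_def)
  then show ?thesis using assms(3,4) unfolding cross_def by blast
qed

lemma faces_at_connected_hd:
  assumes v: "v \<notin> V" and f: "f \<in> set (faces_at_vtx v)"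
  shows "(hd (faces_at_vtx v), f) \<in> (cross V)\<^sup>*"
proof -
  have step: "(x, g) \<in> (cross V)\<^sup>* \<Longrightarrow> (x, h) \<in> (cross V)\<^sup>*"
    if "ends e v" "g \<in> faces_of e" "h \<in> faces_of e" for e g h and x :: face
    using cross_vertex[OF v that] by (rule rtrancl_into_rtrancl[rotated])
  show ?thesis
  proof (cases v rule: faces_at_vtx.cases)
    case (1 a b)
    have "((3, a, b), (3, a, b)) \<in> (cross V)\<^sup>*" by simp
    moreover from this have s1: "((3, a, b), (1, a, b)) \<in> (cross V)\<^sup>*" by (rule step[of "(E31, a, b)", rotated -1]) (simp_all add: 1)
    moreover from this have s2: "((3, a, b), (4, a, b)) \<in> (cross V)\<^sup>*" by (rule step[of "(E14, a, b)", rotated -1]) (simp_all add: 1)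
    moreover from this have s3: "((3, a, b), (2, a, b)) \<in> (cross V)\<^sup>*" by (rule step[of "(E42, a, b)", rotated -1]) (simp_all add: 1)
    moreover from this have s4: "((3, a, b), (0, a, b)) \<in> (cross V)\<^sup>*" by (rule step[of "(E20, a, b)", rotated -1]) (simp_all add: 1)
    moreover from this have s5: "((3, a, b), (5, a, b)) \<in> (cross V)\<^sup>*" by (rule step[of "(E05, a, b)", rotated -1]) (simp_all add: 1)
    ultimately show ?thesis using f by (auto simp: 1)
  next
    case (2 a b)
    have "((3, a, b), (3, a, b)) \<in> (cross V)\<^sup>*" by simp
    moreover from this have s1: "((3, a, b), (4, a + 1, b)) \<in> (cross V)\<^sup>*" by (rule step[of "(E34, a, b)", rotated -1]) (simp_all add: 2)
    moreover from this have s2: "((3, a, b), (2, a + 1, b)) \<in> (cross V)\<^sup>*" by (rule step[of "(E42, a + 1, b)", rotated -1]) (simp_all add: 2)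
    moreover from this have s3: "((3, a, b), (5, a, b)) \<in> (cross V)\<^sup>*" by (rule step[of "(E25, a, b)", rotated -1]) (simp_all add: 2)
    ultimately show ?thesis using f by (auto simp: 2)
  next
    case (3 a b)
    have "((3, a, b), (3, a, b)) \<in> (cross V)\<^sup>*" by simp
    moreover from this have s1: "((3, a, b), (1, a, b)) \<in> (cross V)\<^sup>*" by (rule step[of "(E31, a, b)", rotated -1]) (simp_all add: 3)
    moreover from this have s2: "((3, a, b), (2, a, b + 1)) \<in> (cross V)\<^sup>*" by (rule step[of "(E12, a, b)", rotated -1]) (simp_all add: 3)
    moreover from this have s3: "((3, a, b), (0, a, b + 1)) \<in> (cross V)\<^sup>*" by (rule step[of "(E20, a, b + 1)", rotated -1]) (simp_all add: 3)
    ultimately show ?thesis using f by (auto simp: 3)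
  next
    case (4 a b)
    have "((1, a, b), (1, a, b)) \<in> (cross V)\<^sup>*" by simp
    moreover from this have s1: "((1, a, b), (4, a, b)) \<in> (cross V)\<^sup>*" by (rule step[of "(E14, a, b)", rotated -1]) (simp_all add: 4)
    moreover from this have s2: "((1, a, b), (0, a - 1, b + 1)) \<in> (cross V)\<^sup>*" by (rule step[of "(E40, a - 1, b + 1)", rotated -1]) (simp_all add: 4)
    moreover from this have s3: "((1, a, b), (5, a - 1, b + 1)) \<in> (cross V)\<^sup>*" by (rule step[of "(E05, a - 1, b + 1)", rotated -1]) (simp_all add: 4)
    ultimately show ?thesis using f by (auto simp: 4)
  next
    case (5 a b)
    have "((3, a, b), (3, a, b)) \<in> (cross V)\<^sup>*" by simp
    moreover from this have s1: "((3, a, b), (4, a + 1, b)) \<in> (cross V)\<^sup>*" by (rule step[of "(E34, a, b)", rotated -1]) (simp_all add: 5)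
    moreover from this have s2: "((3, a, b), (0, a, b + 1)) \<in> (cross V)\<^sup>*" by (rule step[of "(E40, a, b + 1)", rotated -1]) (simp_all add: 5)
    ultimately show ?thesis using f by (auto simp: 5)
  next
    case (6 a b)
    have "((1, a, b), (1, a, b)) \<in> (cross V)\<^sup>*" by simp
    moreover from this have s1: "((1, a, b), (2, a, b + 1)) \<in> (cross V)\<^sup>*" by (rule step[of "(E12, a, b)", rotated -1]) (simp_all add: 6)
    moreover from this have s2: "((1, a, b), (5, a - 1, b + 1)) \<in> (cross V)\<^sup>*" by (rule step[of "(E25, a - 1, b + 1)", rotated -1]) (simp_all add: 6)
    ultimately show ?thesis using f by (auto simp: 6)
  qed
qed

lemma escapes_iff:
  assumes "v \<notin> V" "f \<in> set (faces_at_vtx v)"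
  shows "escapes V v \<longleftrightarrow> infinite {g. (f, g) \<in> (cross V)\<^sup>*}"
proof -
  have "(hd (faces_at_vtx v), f) \<in> (cross V)\<^sup>*" by (rule faces_at_connected_hd[OF assms])
  moreover from this have "(f, hd (faces_at_vtx v)) \<in> (cross V)\<^sup>*" by (rule symD[OF sym_cross])
  ultimately have "{g. (hd (faces_at_vtx v), g) \<in> (cross V)\<^sup>*} = {g. (f, g) \<in> (cross V)\<^sup>*}"
    by (blast intro: rtrancl_trans)
  then show ?thesis using assms(1) by (simp add: escapes_def)
qed

lemma escapes_share:
  assumes "v \<notin> V" "escapes V v'" "f \<in> set (faces_at_vtx v)" "f \<in> set (faces_at_vtx v')"
  shows "escapes V v"
  using assms escapes_iff[of v V f] escapes_iff[of v' V f] by (simp add: escapes_def)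

text \<open>Every vertex shares a face labelled \<open>3\<close> or \<open>1\<close> with the
  \<open>Sv\<close> of its cell. This reduces most of the work to the vertices \<open>Sv\<close>;
  what remains are the cells whose \<open>Sv\<close> belongs to the region.\<close>

lemma escapes_cell: "(k, a, b) \<notin> V \<Longrightarrow> escapes V (Sv, a, b) \<Longrightarrow> escapes V (k, a, b)"
  by (rule escapes_share[of _ _ "(Sv, a, b)" "(if k = Tv \<or> k = Xv then 1 else 3, a, b)"]; cases k; simp)

text \<open>An endless walk through faces labelled \<open>3\<close> and \<open>0\<close> in turn,
  passing the absent vertices \<open>Sv\<close> and \<open>Ov\<close> of one column
  alternately.\<close>

lemma escapes_up:
  assumes "\<And>b'. b \<le> b' \<Longrightarrow> (Sv, a, b') \<notin> V \<and> (Ov, a, b' + 1) \<notin> V"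
  shows "escapes V (Sv, a, b)"
proof -
  have r: "((3, a, b), (3, a, b + int n)) \<in> (cross V)\<^sup>*" for n
  proof (induction n)
    case (Suc n)
    have 1: "(Sv, a, b + int n) \<notin> V" "(Ov, a, b + int n + 1) \<notin> V" using assms[of "b + int n"] by simp_all
    have "((3, a, b + int n), (0, a, b + int n + 1)) \<in> (cross V)\<^sup>*"
      using faces_at_connected_hd[OF 1(1), of "(0, a, b + int n + 1)"] by simp
    also have "((0, a, b + int n + 1), (3, a, b + int n + 1)) \<in> (cross V)\<^sup>*"
      using faces_at_connected_hd[OF 1(2), of "(0, a, b + int n + 1)"] symD[OF sym_cross] by force
    finally show ?case using Suc.IH by (simp add: add.assoc add.commute[of 1])
  qed simp
  have "inj (\<lambda>n. (3 :: nat, a, b + int n))" by (rule injI) simp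
  then have "infinite (range (\<lambda>n. (3 :: nat, a, b + int n)))" by (metis finite_imageD infinite_UNIV_nat)
  moreover have "range (\<lambda>n. (3, a, b + int n)) \<subseteq> {g. ((3, a, b), g) \<in> (cross V)\<^sup>*}" using r by blast
  ultimately have "infinite {g. ((3, a, b), g) \<in> (cross V)\<^sup>*}" using finite_subset by blast
  then show ?thesis using assms[of b] by (simp add: escapes_def)
qed

lemma escapes_down:
  assumes "\<And>b'. b' \<le> b \<Longrightarrow> (Sv, a, b') \<notin> V \<and> (Ov, a, b') \<notin> V"
  shows "escapes V (Sv, a, b)"
proof -
  have r: "((3, a, b), (3, a, b - int n)) \<in> (cross V)\<^sup>*" for n
  proof (induction n)
    case (Suc n)
    have 1: "(Ov, a, b - int n) \<notin> V" "(Sv, a, b - int n - 1) \<notin> V" using assms[of "b - int n"] assms[of "b - int n - 1"] by simp_all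
    have "((3, a, b - int n), (0, a, b - int n)) \<in> (cross V)\<^sup>*"
      using faces_at_connected_hd[OF 1(1), of "(0, a, b - int n)"] by simp
    also have "((0, a, b - int n), (3, a, b - int n - 1)) \<in> (cross V)\<^sup>*"
      using faces_at_connected_hd[OF 1(2), of "(0, a, b - int n)"] symD[OF sym_cross] by force
    finally show ?case using Suc.IH by (simp add: diff_diff_eq add.commute[of 1])
  qed simp
  have "inj (\<lambda>n. (3 :: nat, a, b - int n))" by (rule injI) simp
  then have "infinite (range (\<lambda>n. (3 :: nat, a, b - int n)))" by (metis finite_imageD infinite_UNIV_nat)
  moreover have "range (\<lambda>n. (3, a, b - int n)) \<subseteq> {g. ((3, a, b), g) \<in> (cross V)\<^sup>*}" using r by blast
  ultimately have "infinite {g. ((3, a, b), g) \<in> (cross V)\<^sup>*}" using finite_subset by blast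
  then show ?thesis using assms[of b] by (simp add: escapes_def)
qed

lemma face_has_corner: "k < 6 \<Longrightarrow> e \<in> set (face_edge_list k a b) \<Longrightarrow> (k, a, b) \<in> set (faces_at_vtx (white e)) \<and> (k, a, b) \<in> set (faces_at_vtx (black e))"
  unfolding less_6_cases using face_edge_list_simps(2)[of a b] by (elim disjE; simp add: face_edge_list_simps; elim disjE; simp)

text \<open>The subgraph is induced, so an absent side of a face has an absent end, and this end is
  a corner of the face.\<close>

lemma no_enclosedI:
  assumes "\<And>v. v \<notin> V \<Longrightarrow> escapes V v"
  shows "no_enclosed V"
  unfolding no_enclosed_def
proof (intro ballI impI)
  fix f assume f: "f \<in> faces" "\<not> bordered_face V f"
  obtain k a b where fk: "f = (k, a, b)" by (cases f)
  have k: "k < 6" using f by (simp add: fk faces_def)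
  have "face_edge_list k a b \<noteq> []" using k face_edge_list_simps(2)[of a b] unfolding less_6_cases by (elim disjE; simp add: face_edge_list_simps)
  then obtain e where e: "e \<in> set (face_edge_list k a b)" by (cases "face_edge_list k a b") auto
  then have "e \<notin> edges_in V" using f(2) k by (auto simp: bordered_face_def fk mem_faces_of)
  then have "white e \<notin> V \<or> black e \<notin> V" by (auto simp: edges_in_def)
  then obtain v where v: "v = white e \<or> v = black e" "v \<notin> V" by blast
  then have "f \<in> set (faces_at_vtx v)" using face_has_corner[OF k e] by (auto simp: fk)
  then show "infinite {g. (f, g) \<in> (cross V)\<^sup>*}" using escapes_iff[OF v(2)] assms[OF v(2)] by blast
qed

lemma no_enclosed_regI: "no_enclosed (regI i j)" if ij: "i \<ge> 0" "j \<ge> 0"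
proof (rule no_enclosedI)
  let ?V = "regI i j"
  have S: "escapes ?V (Sv, a, b)" if v: "(Sv, a, b) \<notin> ?V" for a b
  proof -
    \<comment> \<open>Beside the strip and in the upper notch the way out leads upwards, in the
      lower notch downwards.\<close>
    consider "a \<le> - i - 2 \<or> a \<ge> j + 1 \<or> 0 \<le> a + b \<and> 0 \<le> b" | "a + b \<le> - i - 1 \<and> b \<le> - j - 1"
      using v by (simp add: reg_defs) (smt (z3))
    then show ?thesis
    proof cases
      case 1 show ?thesis by (rule escapes_up) (use 1 ij in \<open>simp add: reg_defs; linarith\<close>)
    next
      case 2 show ?thesis by (rule escapes_down) (use 2 ij in \<open>simp add: reg_defs; linarith\<close>)
    qed
  qed
  have cell: "escapes ?V (k, a, b)" if "(k, a, b) \<notin> ?V" "(Sv, a, b) \<notin> ?V" for k a b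
    using escapes_cell[OF that(1) S[OF that(2)]] .
  \<comment> \<open>For a vertex in a cell whose own \<open>Sv\<close> is present: it escapes
    through a face shared with an absent vertex of another cell whose \<open>Sv\<close> is
    absent.\<close>
  have nb: "escapes ?V v" if "v \<notin> ?V" "f \<in> set (faces_at_vtx v)" "f \<in> set (faces_at_vtx (k, a, b))" "(k, a, b) \<notin> ?V" "(Sv, a, b) \<notin> ?V" for v f k a b
    using escapes_share[OF that(1) cell[OF that(4,5)] that(2,3)] .
  have H: "escapes ?V (Hv, a, b)" if v: "(Hv, a, b) \<notin> ?V" for a b
  proof (cases "(Sv, a, b) \<in> ?V")
    case True
    then consider "a = j" | "a + b \<le> - i - 1 \<and> b \<le> - j"
      using v by (simp add: reg_defs) linarith
    then show ?thesis
    proof cases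
      case 1 show ?thesis
        by (rule nb[OF v, of "(4, a + 1, b)" Ov "a + 1" b]) (use 1 in \<open>simp_all add: reg_defs\<close>)
    next
      case 2 show ?thesis
        by (rule nb[OF v, of "(5, a, b)" Xv "a + 1" "b - 1"]) (use 2 in \<open>simp_all add: reg_defs\<close>)
    qed
  qed (rule cell[OF v])
  have T: "escapes ?V (Tv, a, b)" if v: "(Tv, a, b) \<notin> ?V" for a b
  proof (cases "(Sv, a, b) \<in> ?V")
    case True
    then have "a \<le> - i - 1 \<or> a + b \<le> - i \<and> b \<le> - j - 1"
      using v by (simp add: reg_defs) linarith
    then show ?thesis
      by (intro nb[OF v, of "(4, a, b)" Wv "a - 1" b]) (simp_all add: reg_defs, linarith+)
  qed (rule cell[OF v])
  have O: "escapes ?V (Ov, a, b)" if v: "(Ov, a, b) \<notin> ?V" for a b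
  proof (cases "(Sv, a, b) \<in> ?V")
    case True
    then consider "a = j" | "a \<le> - i - 1"
      using v by (simp add: reg_defs) linarith
    then show ?thesis
    proof cases
      case 1
      then have h: "(Hv, a, b) \<notin> ?V" by (simp add: reg_defs)
      show ?thesis by (rule escapes_share[OF v H[OF h], of "(3, a, b)"]) simp_all
    next
      case 2 show ?thesis
        by (rule nb[OF v, of "(4, a, b)" Wv "a - 1" b]) (use 2 in \<open>simp_all add: reg_defs\<close>)
    qed
  qed (rule cell[OF v])
  have W: "escapes ?V (Wv, a, b)" if v: "(Wv, a, b) \<notin> ?V" for a b
  proof (cases "(Sv, a, b) \<in> ?V")
    case True
    then have "a = j" using v by (simp add: reg_defs)
    then show ?thesis
      by (intro nb[OF v, of "(4, a + 1, b)" Ov "a + 1" b]) (simp_all add: reg_defs)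
  qed (rule cell[OF v])
  have X: "escapes ?V (Xv, a, b)" if v: "(Xv, a, b) \<notin> ?V" for a b
  proof (cases "(Sv, a, b) \<in> ?V")
    case True
    then have "a \<le> - i - 1" using v by (simp add: reg_defs)
    then show ?thesis
      by (intro nb[OF v, of "(2, a, b + 1)" Hv "a - 1" "b + 1"]) (simp_all add: reg_defs)
  qed (rule cell[OF v])
  show "escapes ?V v" if "v \<notin> ?V" for v
  proof (cases v)
    case (fields k a b)
    show ?thesis using that S[of a b] H[of a b] T[of a b] O[of a b] W[of a b] X[of a b]
      unfolding fields by (cases k) simp_all
  qed
qed

lemma no_enclosed_regII: "no_enclosed (regII i j)" if ij: "i \<ge> 0" "j \<ge> 1"
proof (rule no_enclosedI)
  let ?V = "regII i j"
  have S: "escapes ?V (Sv, a, b)" if v: "(Sv, a, b) \<notin> ?V" for a b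
  proof -
    \<comment> \<open>This strip is bounded by two lines of constant \<open>a + b\<close>. Beyond
      the upper line and in the notch cut into it the way leads upwards, on the other side
      downwards.\<close>
    consider "a + b \<ge> i + 1 \<or> a \<le> - 1 \<and> 0 \<le> b" | "a + b \<le> - j \<or> i + 2 \<le> a \<and> b \<le> - j - 1"
      using v by (simp add: reg_defs) (smt (z3))
    then show ?thesis
    proof cases
      case 1 show ?thesis by (rule escapes_up) (use 1 ij in \<open>simp add: reg_defs; linarith\<close>)
    next
      case 2 show ?thesis by (rule escapes_down) (use 2 ij in \<open>simp add: reg_defs; linarith\<close>)
    qed
  qed
  have cell: "escapes ?V (k, a, b)" if "(k, a, b) \<notin> ?V" "(Sv, a, b) \<notin> ?V" for k a b
    using escapes_cell[OF that(1) S[OF that(2)]] .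
  have nb: "escapes ?V v" if "v \<notin> ?V" "f \<in> set (faces_at_vtx v)" "f \<in> set (faces_at_vtx (k, a, b))" "(k, a, b) \<notin> ?V" "(Sv, a, b) \<notin> ?V" for v f k a b
    using escapes_share[OF that(1) cell[OF that(4,5)] that(2,3)] .
  have H: "escapes ?V (Hv, a, b)" if v: "(Hv, a, b) \<notin> ?V" for a b
  proof (cases "(Sv, a, b) \<in> ?V")
    case True
    then have "i + 1 \<le> a \<and> b \<le> - j - 1"
      using v by (simp add: reg_defs) linarith
    then show ?thesis
      by (intro nb[OF v, of "(5, a, b)" Xv "a + 1" "b - 1"]) (simp_all add: reg_defs)
  qed (rule cell[OF v])
  have T: "escapes ?V (Tv, a, b)" if v: "(Tv, a, b) \<notin> ?V" for a b
  proof (cases "(Sv, a, b) \<in> ?V")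
    case True
    then have "a + b \<le> 1 - j \<or> a \<le> 0 \<and> 0 \<le> b"
      using v by (simp add: reg_defs) linarith
    then show ?thesis
      by (intro nb[OF v, of "(4, a, b)" Wv "a - 1" b]) (simp_all add: reg_defs, linarith+)
  qed (rule cell[OF v])
  have O: "escapes ?V (Ov, a, b)" if v: "(Ov, a, b) \<notin> ?V" for a b
  proof (cases "(Sv, a, b) \<in> ?V")
    case True
    then consider "a \<le> 0 \<and> 0 \<le> b" | "i + 1 \<le> a \<and> b \<le> - j"
      using v by (simp add: reg_defs) linarith
    then show ?thesis
    proof cases
      case 1 show ?thesis
        by (rule nb[OF v, of "(4, a, b)" Wv "a - 1" b]) (use 1 in \<open>simp_all add: reg_defs\<close>)
    next
      case 2 show ?thesis
        by (rule nb[OF v, of "(5, a, b)" Xv "a + 1" "b - 1"]) (use 2 in \<open>simp_all add: reg_defs\<close>)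
    qed
  qed (rule cell[OF v])
  have W: "escapes ?V (Wv, a, b)" if v: "(Wv, a, b) \<notin> ?V" for a b
  proof (cases "(Sv, a, b) \<in> ?V")
    case True
    then have "i + 1 \<le> a \<and> b \<le> - j - 1" using v by (simp add: reg_defs)
    then show ?thesis
      by (intro nb[OF v, of "(4, a + 1, b)" Tv "a + 1" b]) (simp_all add: reg_defs)
  qed (rule cell[OF v])
  have X: "escapes ?V (Xv, a, b)" if v: "(Xv, a, b) \<notin> ?V" for a b
  proof (cases "(Sv, a, b) \<in> ?V")
    case True
    then have "a \<le> 0 \<and> 0 \<le> b" using v by (simp add: reg_defs)
    then show ?thesis
      by (intro nb[OF v, of "(2, a, b + 1)" Hv "a - 1" "b + 1"]) (simp_all add: reg_defs)
  qed (rule cell[OF v])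
  show "escapes ?V v" if "v \<notin> ?V" for v
  proof (cases v)
    case (fields k a b)
    show ?thesis using that S[of a b] H[of a b] T[of a b] O[of a b] W[of a b] X[of a b]
      unfolding fields by (cases k) simp_all
  qed
qed

text \<open>The lattice point \<open>(0, 1)\<close> is the only one that the two families miss, up to rotation.\<close>
definition path4 :: "vtx set" where
  "path4 = {(Sv, 0, 0), (Ov, 0, 0), (Hv, 0, 0), (Ov, 1, 0)}"

lemma no_enclosed_path4: "no_enclosed path4"
proof (rule no_enclosedI)
  let ?V = path4
  have S: "escapes ?V (Sv, a, b)" if v: "(Sv, a, b) \<notin> ?V" for a b
  proof -
    consider "b \<ge> 1 \<or> (a \<noteq> 0 \<and> b \<ge> 0)" | "b \<le> - 1"
      using v by (simp add: path4_def) (smt (z3))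
    then show ?thesis
    proof cases
      case 1 show ?thesis by (rule escapes_up) (use 1 in \<open>simp add: path4_def; linarith\<close>)
    next
      case 2 show ?thesis by (rule escapes_down) (use 2 in \<open>simp add: path4_def\<close>)
    qed
  qed
  have cell: "escapes ?V (k, a, b)" if "(k, a, b) \<notin> ?V" "(Sv, a, b) \<notin> ?V" for k a b
    using escapes_cell[OF that(1) S[OF that(2)]] .
  have nb: "escapes ?V v" if "v \<notin> ?V" "f \<in> set (faces_at_vtx v)" "f \<in> set (faces_at_vtx (k, a, b))" "(k, a, b) \<notin> ?V" "(Sv, a, b) \<notin> ?V" for v f k a b
    using escapes_share[OF that(1) cell[OF that(4,5)] that(2,3)] .
  have T: "escapes ?V (Tv, 0, 0)" and W: "escapes ?V (Wv, 0, 0)" and X: "escapes ?V (Xv, 0, 0)"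
    by (rule nb[of _ "(4, 0, 0)" Wv "- 1" 0] nb[of _ "(0, 0, 1)" Ov 0 1] nb[of _ "(2, 0, 1)" Ov 0 1]; simp add: path4_def)+
  show "escapes ?V v" if "v \<notin> ?V" for v
  proof (cases v)
    case (fields k a b)
    show ?thesis
    proof (cases "(Sv, a, b) \<in> ?V")
      case True
      then have "a = 0" "b = 0" by (simp_all add: path4_def)
      then show ?thesis using that T W X True unfolding fields by (cases k) (simp_all add: path4_def)
    next
      case False then show ?thesis using cell that unfolding fields by blast
    qed
  qed
qed

section \<open>Turning regions preserves the absence of enclosed faces\<close>

fun rot_face :: "face \<Rightarrow> face" where
  "rot_face (k, a, b) = (rot_label k, - b, a + b)"

fun rot_face' :: "face \<Rightarrow> face" where
  "rot_face' (k, a, b) = (rot_label' k, a + b, - a)"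

lemma rot_face_rot_face': "f \<in> faces \<Longrightarrow> rot_face' f \<in> faces \<and> rot_face (rot_face' f) = f"
  by (cases f) (auto simp: faces_def less_6_cases rot_label_simps)

lemma faces_of_rot_face: "faces_of (rot_edg e) = rot_face ` faces_of e"
  by (cases e rule: rot_edg.cases; simp add: rot_label_simps insert_commute algebra_simps)

lemma inj_rot_face: "inj_on rot_face faces"
  by (rule inj_onI) (auto simp: faces_def less_6_cases rot_label_simps)

lemma cross_faces: "(f, g) \<in> cross V \<Longrightarrow> f \<in> faces \<and> g \<in> faces"
  by (cases f; cases g) (auto simp: cross_def mem_faces_of faces_def)

lemma no_enclosed_rot_vtx:
  assumes "no_enclosed V"
  shows "no_enclosed (rot_vtx ` V)"
  unfolding no_enclosed_def
proof (intro ballI impI)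
  fix f assume f: "f \<in> faces" "\<not> bordered_face (rot_vtx ` V) f"
  define f' where "f' = rot_face' f"
  have f': "f' \<in> faces" "f = rot_face f'" using rot_face_rot_face'[OF f(1)] by (simp_all add: f'_def)
  have ed: "rot_edg e \<in> edges_in (rot_vtx ` V) \<longleftrightarrow> e \<in> edges_in V" for e
    by (rule automorphism_edges_in[OF automorphism_rot])
  have "\<not> bordered_face V f'"
    using f(2) unfolding bordered_face_def f'(2) using ed faces_of_rot_face by blast
  then have inf: "infinite {g. (f', g) \<in> (cross V)\<^sup>*}" using assms f' unfolding no_enclosed_def by blast
  have step: "(rot_face x, rot_face y) \<in> cross (rot_vtx ` V)" if "(x, y) \<in> cross V" for x y
    using that ed faces_of_rot_face unfolding cross_def by blast
  have path: "(rot_face f', rot_face g) \<in> (cross (rot_vtx ` V))\<^sup>*" if "(f', g) \<in> (cross V)\<^sup>*" for g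
    using that by (induction rule: rtrancl_induct) (auto intro: step rtrancl_into_rtrancl)
  have "g \<in> faces" if "(f', g) \<in> (cross V)\<^sup>*" for g
    using that f'(1) by (cases rule: rtranclE) (use cross_faces in blast)+
  then have "inj_on rot_face {g. (f', g) \<in> (cross V)\<^sup>*}" using inj_rot_face by (blast intro: inj_on_subset)
  then have "infinite (rot_face ` {g. (f', g) \<in> (cross V)\<^sup>*})" using inf finite_imageD by blast
  moreover have "rot_face ` {g. (f', g) \<in> (cross V)\<^sup>*} \<subseteq> {g. (f, g) \<in> (cross (rot_vtx ` V))\<^sup>*}"
    using path f'(2) by blast
  ultimately show "infinite {g. (f, g) \<in> (cross (rot_vtx ` V))\<^sup>*}" using finite_subset by blast
qed

section \<open>Every lattice point is realised\<close>

lemma edges_in_path4: "edges_in path4 = {(E31, 0, 0), (E53, 0, 0), (E42, 1, 0)}"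
proof -
  have "e \<in> edges_in path4 \<longleftrightarrow> e \<in> {(E31, 0, 0), (E53, 0, 0), (E42, 1, 0)}" for e
    unfolding edges_in_def path4_def by (cases e rule: white.cases) auto
  then show ?thesis by blast
qed

lemma ex1_unique: "\<exists>!x. P x \<Longrightarrow> P a \<Longrightarrow> P b \<Longrightarrow> a = b"
  by blast

lemma matchings_path4: "matchings path4 = {{(E31, 0, 0), (E42, 1, 0)}}"
proof -
  have "M = {(E31, 0, 0), (E42, 1, 0)}" if M: "M \<in> matchings path4" for M
  proof -
    have sub: "M \<subseteq> {(E31, 0, 0), (E53, 0, 0), (E42, 1, 0)}"
      and ends: "\<And>w. w \<in> path4 \<Longrightarrow> \<exists>!e. e \<in> M \<and> ends e w"
      using M unfolding matchings_def mem_Collect_eq edges_in_path4 by blast+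
    have p: "(Sv, 0, 0) \<in> path4" "(Ov, 1, 0) \<in> path4" "(Ov, 0, 0) \<in> path4" by (simp_all add: path4_def)
    from ex1_implies_ex[OF ends[OF p(1)]] obtain e where e: "e \<in> M" "ends e (Sv, 0, 0)" by (elim exE conjE)
    with subsetD[OF sub e(1)] have 1: "(E31, 0, 0) \<in> M" by (elim insertE; simp)
    from ex1_implies_ex[OF ends[OF p(2)]] obtain e where e: "e \<in> M" "ends e (Ov, 1, 0)" by (elim exE conjE)
    with subsetD[OF sub e(1)] have 2: "(E42, 1, 0) \<in> M" by (elim insertE; simp)
    have "(E53, 0, 0) \<notin> M"
    proof
      assume "(E53, 0, 0) \<in> M"
      then have "((E53, 0, 0) :: edg) = (E31, 0, 0)"
        using 1 by (intro ex1_unique[OF ends[OF p(3)]] conjI) simp_all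
      then show False by simp
    qed
    then show ?thesis using 1 2 sub by blast
  qed
  moreover have "{(E31, 0, 0), (E42, 1, 0)} \<in> matchings path4"
  proof -
    have "\<exists>!e. e \<in> {(E31, 0, 0), (E42, 1, 0)} \<and> ends e w" if w: "w \<in> path4" for w
      by (rule ex1I[of _ "if w = (Sv, 0, 0) \<or> w = (Ov, 0, 0) then (E31, 0, 0) else (E42, 1, 0)"])
        (use w in \<open>auto simp: path4_def\<close>)
    then show ?thesis unfolding matchings_def mem_Collect_eq edges_in_path4 by blast
  qed
  ultimately show ?thesis by blast
qed

text \<open>The path has one matching and borders five faces; the weights of the edges
  \<open>E31\<close> and \<open>E42\<close> cancel four of them and leave the face labelled
  \<open>5\<close>.\<close>

lemma c_value_path4:
  fixes v :: "nat \<Rightarrow> 'a::field"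
  assumes "nondegen v"
  shows "c_value v path4 = v 5"
proof -
  have w: "wsum v path4 = 1 / (v 1 * v 3) * (1 / (v 2 * v 4))"
    by (simp add: wsum_def wt_def matchings_path4 mult_ac)
  have "bordered path4 k a b \<longleftrightarrow> (k, a, b) \<in> {(3, 0, 0), (1, 0, 0), (5, 0, 0), (4, 1, 0), (2, 1, 0)}" if "k < 6" for k a b
    unfolding bordered_face_bordered[OF that, symmetric] bordered_face_def edges_in_path4 by auto
  then have "{(a, b). bordered path4 k a b} = (if k = 0 then {} else if k = 2 \<or> k = 4 then {(1, 0)} else {(0, 0)})" if "k < 6" for k
    using that unfolding less_6_cases by (elim disjE; auto)
  then have "bordered_count path4 k = (if k = 0 then 0 else 1)" if "k < 6" for k
    using that by (auto simp: bordered_count_def count_def)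
  then have "c_value v path4 = 1 / (v 1 * v 3) * (1 / (v 2 * v 4)) * (v 1 * v 2 * v 3 * v 4 * v 5)"
    unfolding c_value_def w prod6 by simp
  then show ?thesis using nondegenD[OF assms] by (simp add: field_simps)
qed

lemma has_value_path4: "has_value T path4 0 1"
  unfolding has_value_def by (rule exI[of _ 5]) (auto simp: c_value_path4 lattice_val_def eis_norm_def)

definition realised :: "'a::field itself \<Rightarrow> int \<Rightarrow> int \<Rightarrow> bool" where
  "realised T x y \<longleftrightarrow> (\<exists>V. finite V \<and> no_enclosed V \<and> has_value T V x y)"

lemma realised_rot: "realised T x y \<Longrightarrow> realised T y (1 - x - y)"
  unfolding realised_def using has_value_rot no_enclosed_rot_vtx by blast

text \<open>The parameters solve \<open>(x, y) = (- i, 1 + i + j)\<close> and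
  \<open>(x, y) = (- i - j, 1 + i)\<close> from \<open>has_value_reg\<close>: the first family fills
  the part \<open>x + y \<ge> 1\<close> of the sector, the second the part
  \<open>x + y \<le> 0\<close>.\<close>

lemma realised_sector:
  assumes "y \<ge> 1" "x \<le> 0"
  shows "realised T x y"
proof -
  consider "x = 0" "y = 1" | "x + y \<ge> 1" "(x, y) \<noteq> (0, 1)" | "x + y \<le> 0" by force
  then show ?thesis
  proof cases
    case 1
    have "finite path4" by (simp add: path4_def)
    then show ?thesis unfolding realised_def 1 using has_value_path4 no_enclosed_path4 by blast
  next
    case 2
    have "has_value T (regI (- x) (x + y - 1)) x y" using has_value_reg[of "- x" "x + y - 1" T] 2 assms by auto
    moreover have "no_enclosed (regI (- x) (x + y - 1))" by (rule no_enclosed_regI) (use 2 assms in auto)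
    ultimately show ?thesis unfolding realised_def using finite_regI by blast
  next
    case 3
    have "has_value T (regII (y - 1) (1 - x - y)) x y" using has_value_reg[of "y - 1" "1 - x - y" T] 3 assms by auto
    moreover have "no_enclosed (regII (y - 1) (1 - x - y))" by (rule no_enclosed_regII) (use 3 assms in auto)
    ultimately show ?thesis unfolding realised_def using finite_regII by blast
  qed
qed

text \<open>The integers \<open>x\<close>, \<open>y\<close>, \<open>1 - x - y\<close> have sum
  \<open>1\<close>, so they are neither all positive nor all nonpositive. In cyclic order some
  nonpositive one is followed by a positive one, and a rotation moves these two into the positions
  of \<open>realised_sector\<close>.\<close>

lemma realised_all: "realised T x y"
proof -
  consider "y \<ge> 1" "x \<le> 0" | "x \<ge> 1" "1 - x - y \<le> 0" | "1 - x - y \<ge> 1" "y \<le> 0" by linarith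
  then show ?thesis
  proof cases
    case 1 then show ?thesis by (rule realised_sector)
  next
    case 2
    then have "realised T (1 - x - y) x" by (intro realised_sector)
    from realised_rot[OF this] show ?thesis by simp
  next
    case 3
    then have "realised T y (1 - x - y)" by (intro realised_sector)
    from realised_rot[OF realised_rot[OF this]] show ?thesis by simp
  qed
qed

lemma rot_point_of: "rot (point_of v) = point_of (rot_vtx (rot_vtx (rot_vtx v)))"
  by (cases v rule: point_of.cases) (simp_all add: rot_def)

lemma rot_label_cube: "l < 6 \<Longrightarrow> rot_label (rot_label (rot_label l)) = sigma l"
  unfolding less_6_cases by (auto simp: rot_label_simps sigma_def)

text \<open>The half turn is the cube of \<open>rot_vtx\<close>, and the cube of the induced action
  on lattice points is the identity. A region and its half turn thus have values that differ only in
  the label, \<open>l\<close> versus \<open>sigma l\<close>; if the region found carries the wrong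
  label of the pair, its half turn is taken instead.\<close>

lemma graph_c_realised:
  fixes x y :: int
  assumes "nondegen var" "k < 6" "int (k div 2) = (x - y) mod 3"
  shows "\<exists>V. finite V \<and> graph_c (point_of ` V) = var k * lattice_val var x y \<and> graph_c (rot ` point_of ` V) = var (sigma k) * lattice_val var x y"
proof -
  obtain V l where V: "finite V" "no_enclosed V" and l: "l < 6" "int (l div 2) = (x - y) mod 3"
    and c: "\<And>v :: nat \<Rightarrow> ratfun. nondegen v \<Longrightarrow> c_value v V = v l * lattice_val v x y"
    using realised_all[of "TYPE(ratfun)" x y] unfolding realised_def has_value_def by blast
  define V' where "V' = rot_vtx ` rot_vtx ` rot_vtx ` V"
  have rot: "rot ` point_of ` W = point_of ` rot_vtx ` rot_vtx ` rot_vtx ` W" for W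
    unfolding image_image by (simp add: rot_point_of)
  have g: "nondegen (var \<circ> rot_label \<circ> rot_label \<circ> rot_label)" using assms(1) by (intro nondegen_comp(1))
  have F: "lattice_val (var \<circ> rot_label \<circ> rot_label \<circ> rot_label) x y = lattice_val var x y" unfolding lattice_val_rot by simp
  have n: "no_enclosed V'" unfolding V'_def using V by (intro no_enclosed_rot_vtx)
  have g1: "graph_c (point_of ` V) = var l * lattice_val var x y"
    using graph_c_c_value[OF V(2)] c[OF assms(1)] by simp
  have g2: "graph_c (point_of ` V') = var (sigma l) * lattice_val var x y"
    using graph_c_c_value[OF n] c[OF g] rot_label_cube[OF l(1)] by (simp add: V'_def c_value_rot_vtx F)
  have "k div 2 = l div 2" using assms(3) l(2) by linarith
  then consider "k = l" | "k = sigma l" "sigma k = l"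
    using l(1) assms(2) unfolding less_6_cases by (elim disjE) (auto simp: sigma_def)
  then show ?thesis
  proof cases
    case 1 then show ?thesis using g1 g2 V rot[of V] unfolding V'_def by metis
  next
    case 2
    have "rot_vtx ` rot_vtx ` rot_vtx ` V' = V"
    proof -
      have "rot_vtx (rot_vtx (rot_vtx (rot_vtx (rot_vtx (rot_vtx w))))) = w" for w by (cases w rule: rot_vtx.cases) simp_all
      then show ?thesis unfolding V'_def image_image by simp
    qed
    then have "rot ` point_of ` V' = point_of ` V" by (simp add: rot)
    then show ?thesis using g1 g2 V 2 unfolding V'_def by (metis finite_imageI)
  qed
qed

section \<open>The cluster variables\<close>

lemma poly_mono_neq:
  fixes p q :: "nat \<Rightarrow>\<^sub>0 nat"
  assumes "p \<noteq> q"
  shows "Poly_Mapping.single p (1 :: rat) + Poly_Mapping.single q 1 \<noteq> 0"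
proof
  assume "Poly_Mapping.single p (1 :: rat) + Poly_Mapping.single q 1 = 0"
  then have "Poly_Mapping.lookup (Poly_Mapping.single p (1 :: rat) + Poly_Mapping.single q 1) p = 0" by simp
  then show False using assms by (simp add: lookup_add lookup_single)
qed

lemma var_nonzero: "var i \<noteq> 0"
proof -
  have "Poly_Mapping.lookup (Poly_Mapping.single m (1 :: rat)) m \<noteq> 0" for m :: "nat \<Rightarrow>\<^sub>0 nat" by simp
  then have "Poly_Mapping.single m (1 :: rat) \<noteq> 0" for m :: "nat \<Rightarrow>\<^sub>0 nat" by (metis lookup_zero)
  then show ?thesis by (simp add: var_def Zero_fract_def eq_fract)
qed

lemma var_binomial_nonzero:
  assumes "{i, j} \<noteq> {k, l}"
  shows "var i * var j + var k * var l \<noteq> 0"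
proof -
  let ?m = "\<lambda>i. Poly_Mapping.single i (1 :: nat)"
  have "?m i + ?m j \<noteq> ?m k + ?m l"
  proof
    assume "?m i + ?m j = ?m k + ?m l"
    then have "Poly_Mapping.lookup (?m i + ?m j) x = Poly_Mapping.lookup (?m k + ?m l) x" for x by simp
    from this[of i] this[of j] this[of k] this[of l] show False
      using assms by (auto simp: lookup_add lookup_single when_def split: if_splits)
  qed
  then have "Poly_Mapping.single (?m i + ?m j) (1 :: rat) + Poly_Mapping.single (?m k + ?m l) 1 \<noteq> 0"
    by (rule poly_mono_neq)
  then show ?thesis
    by (simp add: var_def mult_single Zero_fract_def eq_fract)
qed

lemma nondegen_var: "nondegen var"
  unfolding nondegen_def hA_def hB_def hC_def
  by (simp add: var_nonzero var_binomial_nonzero doubleton_eq_iff)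

text \<open>The quiver of each seed is the dP3 quiver with the vertices \<open>2 d, 2 d + 1\<close> swapped for the \<open>d\<close> with \<open>p d\<close>.\<close>
definition pair_perm :: "(nat \<Rightarrow> bool) \<Rightarrow> nat \<Rightarrow> nat" where
  "pair_perm p i = (if i < 6 \<and> p (i div 2) then sigma i else i)"

definition relabel :: "(nat \<Rightarrow> nat) \<Rightarrow> quiver \<Rightarrow> quiver" where
  "relabel \<pi> q = (\<lambda>i j. q (\<pi> i) (\<pi> j))"

lemma sigma_simps: "sigma 0 = 1" "sigma (Suc 0) = 0" "sigma 2 = 3" "sigma 3 = 2" "sigma 4 = 5" "sigma 5 = 4"
  by (simp_all add: sigma_def)

lemma sigma_pair: "i < 6 \<Longrightarrow> sigma i < 6 \<and> sigma i div 2 = i div 2 \<and> sigma (sigma i) = i \<and> sigma i \<noteq> i"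
  unfolding less_6_cases by (elim disjE) (simp_all add: sigma_simps)

lemma pair_perm: "pair_perm p (pair_perm p i) = i" "pair_perm p i div 2 = i div 2" "pair_perm p i < 6 \<longleftrightarrow> i < 6"
  using sigma_pair[of i] by (auto simp: pair_perm_def)

lemma pair_perm_sigma: "i < 6 \<Longrightarrow> pair_perm p (sigma i) = sigma (pair_perm p i)"
  using sigma_pair[of i] by (auto simp: pair_perm_def)

lemma mutate_relabel:
  assumes "\<And>i. \<pi> (\<pi> i) = i"
  shows "mutate_quiver k (relabel \<pi> q) = relabel \<pi> (mutate_quiver (\<pi> k) q)"
proof -
  have "\<pi> i = \<pi> j \<longleftrightarrow> i = j" for i j using assms by metis
  then show ?thesis
    unfolding mutate_quiver_def relabel_def delete_2cycles_def reverse_at_def add_paths_def by (intro ext) simp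
qed

lemma dP3_quiver_out: "i \<ge> 6 \<or> j \<ge> 6 \<Longrightarrow> dP3_quiver i j = 0"
  by (auto simp: dP3_quiver_def dP3_arrows_def)

lemma mutate_out:
  assumes "\<And>i j. i \<ge> 6 \<or> j \<ge> 6 \<Longrightarrow> q i j = 0" "i \<ge> 6 \<or> j \<ge> 6" "k < 6"
  shows "mutate_quiver k q i j = 0"
  using assms(1)[of i j] assms(1)[of j i] assms(1)[of i k] assms(1)[of k j] assms(1)[of j k] assms(1)[of k i] assms(2,3)
  unfolding mutate_quiver_def delete_2cycles_def reverse_at_def add_paths_def by auto

lemma mutate_pair_quiver_table:
  "\<forall>f\<in>set [0..<6]. \<forall>i\<in>set [0..<6]. \<forall>j\<in>set [0..<6].
     mutate_quiver (sigma f) (mutate_quiver f dP3_quiver) i j =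
     dP3_quiver (if i = f \<or> i = sigma f then sigma i else i) (if j = f \<or> j = sigma f then sigma j else j)"
  by code_simp

lemma mutate_pair_quiver:
  assumes "f < 6"
  shows "mutate_quiver (sigma f) (mutate_quiver f dP3_quiver) = relabel (pair_perm (\<lambda>d. d = f div 2)) dP3_quiver"
proof (intro ext)
  fix i j
  show "mutate_quiver (sigma f) (mutate_quiver f dP3_quiver) i j = relabel (pair_perm (\<lambda>d. d = f div 2)) dP3_quiver i j"
  proof (cases "i < 6 \<and> j < 6")
    case True
    have s: "x = f \<or> x = sigma f \<longleftrightarrow> x div 2 = f div 2" if "x < 6" for x
      using that assms unfolding less_6_cases by (elim disjE; simp add: sigma_simps)
    show ?thesis
      using mutate_pair_quiver_table True assms s[of i] s[of j] unfolding relabel_def pair_perm_def by auto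
  next
    case False
    then have o: "i \<ge> 6 \<or> j \<ge> 6" by linarith
    have "mutate_quiver (sigma f) (mutate_quiver f dP3_quiver) i j = 0"
      by (intro mutate_out o dP3_quiver_out) (use assms sigma_pair in auto)
    moreover have "dP3_quiver (pair_perm p i) (pair_perm p j) = 0" for p
      using o pair_perm(3) by (intro dP3_quiver_out) (meson linorder_not_less)
    ultimately show ?thesis by (simp add: relabel_def)
  qed
qed

text \<open>Mutation leaves the arrows at the partner vertex unchanged, so both exchange relations
  of one \<open>tau\<close> step can be read off the same quiver.\<close>

lemma mutate_quiver_partner_table:
  "\<forall>f\<in>set [0..<6]. \<forall>j\<in>set [0..<6].
     mutate_quiver f dP3_quiver (sigma f) j = dP3_quiver (sigma f) j \<and>
     mutate_quiver f dP3_quiver j (sigma f) = dP3_quiver j (sigma f)"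
  by code_simp

definition neighbours :: "nat \<Rightarrow> nat \<times> nat" where
  "neighbours d = [(1, 2), (0, 2), (0, 1)] ! d"

definition hat_of :: "nat \<Rightarrow> ratfun" where
  "hat_of d = [hA var, hB var, hC var] ! d"

text \<open>Either monomial of the exchange binomial contains one variable from each of the other
  two pairs, so their factors \<open>Z\<close> come out in front. What remains is the ratio
  \<open>hat_of\<close> times both variables of the pair; dividing by one leaves its partner, whence
  \<open>sigma\<close>. Only the arrows at \<open>m\<close> are prescribed, so the formula also
  applies between the two mutations of a step.\<close>

lemma exchange_formula:
  assumes "m < 6"
    and q: "\<And>j. j < 6 \<Longrightarrow> q m j = dP3_quiver (pair_perm p m) (pair_perm p j) \<and> q j m = dP3_quiver (pair_perm p j) (pair_perm p m)"
    and x: "\<And>j. j < 6 \<Longrightarrow> j div 2 \<noteq> m div 2 \<Longrightarrow> x j = var (pair_perm p j) * Z (j div 2)"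
    and xm: "x m = var (pair_perm p m) * Z (m div 2)"
    and Z: "Z (m div 2) \<noteq> 0"
  shows "exchange m (q, x) = var (sigma (pair_perm p m)) *
    (Z (fst (neighbours (m div 2))) * Z (snd (neighbours (m div 2))) * hat_of (m div 2) / Z (m div 2))"
proof -
  let ?\<pi> = "pair_perm p"
  let ?f = "?\<pi> m"
  have f: "?f < 6" "m div 2 = ?f div 2" using assms(1) by (simp_all add: pair_perm)
  have bij: "bij_betw ?\<pi> {..<6} {..<6}" by (rule bij6[of _ ?\<pi>]) (simp add: pair_perm)
  have same: "dP3_quiver ?f j = 0 \<and> dP3_quiver j ?f = 0" if "j < 6" "j div 2 = m div 2" for j
    using that f unfolding less_6_cases by (elim disjE; simp add: dP3_quiver_def dP3_arrows_def)
  let ?y = "\<lambda>i. var i * Z (i div 2)"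
  \<comment> \<open>No arrow joins \<open>m\<close> to its own pair, which therefore enters both
    products with exponent \<open>0\<close>.\<close>
  have t: "x j = ?y (?\<pi> j) \<or> (dP3_quiver ?f (?\<pi> j) = 0 \<and> dP3_quiver (?\<pi> j) ?f = 0)" if "j < 6" for j
    using x[OF that] same[of "?\<pi> j"] that by (auto simp: pair_perm)
  have "(\<Prod>j<6. x j ^ q m j) = (\<Prod>j<6. ?y (?\<pi> j) ^ dP3_quiver ?f (?\<pi> j))"
    by (intro prod.cong refl; drule lessThan_iff[THEN iffD1]; frule t; drule q; elim disjE conjE; simp add: pair_perm)
  also have "\<dots> = (\<Prod>j<6. ?y j ^ dP3_quiver ?f j)"
    by (rule prod.reindex_bij_betw[OF bij, where g = "\<lambda>i. ?y i ^ dP3_quiver ?f i"])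
  finally have 1: "(\<Prod>j<6. x j ^ q m j) = (\<Prod>j<6. ?y j ^ dP3_quiver ?f j)" .
  have "(\<Prod>j<6. x j ^ q j m) = (\<Prod>j<6. ?y (?\<pi> j) ^ dP3_quiver (?\<pi> j) ?f)"
    by (intro prod.cong refl; drule lessThan_iff[THEN iffD1]; frule t; drule q; elim disjE conjE; simp add: pair_perm)
  also have "\<dots> = (\<Prod>j<6. ?y j ^ dP3_quiver j ?f)"
    by (rule prod.reindex_bij_betw[OF bij, where g = "\<lambda>i. ?y i ^ dP3_quiver i ?f"])
  finally have 2: "(\<Prod>j<6. x j ^ q j m) = (\<Prod>j<6. ?y j ^ dP3_quiver j ?f)" .
  have "(\<Prod>j<6. ?y j ^ dP3_quiver ?f j) + (\<Prod>j<6. ?y j ^ dP3_quiver j ?f) =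
      Z (fst (neighbours (m div 2))) * Z (snd (neighbours (m div 2))) * hat_of (m div 2) * (var ?f * var (sigma ?f))"
    using f(1) unfolding f(2) prod6 less_6_cases
    by (elim disjE; simp add: dP3_quiver_def dP3_arrows_def neighbours_def hat_of_def sigma_simps
        hA_def hB_def hC_def var_nonzero field_simps)
  then show ?thesis unfolding exchange_def prod.case 1 2 xm using Z var_nonzero by (simp add: field_simps)
qed

definition seed_inv :: "(nat \<Rightarrow> bool) \<Rightarrow> (nat \<Rightarrow> ratfun) \<Rightarrow> seed \<Rightarrow> bool" where
  "seed_inv p Z s \<longleftrightarrow> fst s = relabel (pair_perm p) dP3_quiver \<and> (\<forall>i<6. snd s i = var (pair_perm p i) * Z (i div 2))"

lemma tau_seed_inv:
  assumes inv: "seed_inv p Z s" and k: "k \<in> {1, 2, 3}" and Z: "\<And>d. d < 3 \<Longrightarrow> Z d \<noteq> 0"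
  defines "d \<equiv> k - 1"
  shows "seed_inv (p(d := \<not> p d)) (Z(d := Z (fst (neighbours d)) * Z (snd (neighbours d)) * hat_of d / Z d)) (tau k s)"
proof -
  let ?\<pi> = "pair_perm p" and ?\<pi>' = "pair_perm (p(d := \<not> p d))"
  let ?z = "Z (fst (neighbours d)) * Z (snd (neighbours d)) * hat_of d / Z d"
  \<comment> \<open>\<open>tau k\<close> is a composition, so the odd vertex of the pair is mutated
    first.\<close>
  define m where "m = 2 * k - 1"
  have m: "m < 6" "m div 2 = d" "sigma m = 2 * k - 2" "d < 3"
    using k by (auto simp: m_def d_def sigma_simps)
  define m' where "m' = sigma m"
  have m': "m' < 6" "m' div 2 = d" "sigma m' = m" "m' \<noteq> m" using sigma_pair[OF m(1)] m(2) by (simp_all add: m'_def)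
  obtain q x where s: "s = (q, x)" by (cases s)
  have q: "q = relabel ?\<pi> dP3_quiver" and x: "\<And>i. i < 6 \<Longrightarrow> x i = var (?\<pi> i) * Z (i div 2)"
    using inv by (simp_all add: seed_inv_def s)
  define f where "f = ?\<pi> m"
  have f: "f < 6" "f div 2 = d" "?\<pi> m' = sigma f" using m m' pair_perm_sigma[OF m(1)] by (simp_all add: f_def m'_def pair_perm)
  define q1 where "q1 = mutate_quiver m q"
  define x1 where "x1 = x(m := exchange m (q, x))"
  have q1: "q1 = relabel ?\<pi> (mutate_quiver f dP3_quiver)"
    unfolding q1_def q f_def by (rule mutate_relabel) (rule pair_perm(1))
  have q2: "mutate_quiver m' q1 = relabel ?\<pi>' dP3_quiver"
  proof -
    have "mutate_quiver m' q1 = relabel ?\<pi> (mutate_quiver (sigma f) (mutate_quiver f dP3_quiver))"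
      unfolding q1 f(3)[symmetric] by (rule mutate_relabel) (rule pair_perm(1))
    also have "\<dots> = relabel ?\<pi> (relabel (pair_perm (\<lambda>c. c = d)) dP3_quiver)"
      unfolding mutate_pair_quiver[OF f(1)] f(2) ..
    also have "\<dots> = relabel ?\<pi>' dP3_quiver"
    proof -
      have "pair_perm (\<lambda>c. c = d) (?\<pi> i) = ?\<pi>' i" for i
        using sigma_pair[of i] by (auto simp: pair_perm_def)
      then show ?thesis by (simp add: relabel_def)
    qed
    finally show ?thesis .
  qed
  have e: "exchange m (q, x) = var (sigma (?\<pi> m)) * ?z"
    unfolding m(2)[symmetric]
    by (rule exchange_formula[OF m(1)]) (use x m Z in \<open>auto simp: q relabel_def\<close>)
  have e': "exchange m' (q1, x1) = var (sigma (?\<pi> m')) * ?z"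
    unfolding m'(2)[symmetric]
  proof (rule exchange_formula[OF m'(1)])
    fix j :: nat assume j: "j < 6"
    then have "?\<pi> j < 6" by (simp add: pair_perm)
    then show "q1 m' j = dP3_quiver (?\<pi> m') (?\<pi> j) \<and> q1 j m' = dP3_quiver (?\<pi> j) (?\<pi> m')"
      using mutate_quiver_partner_table f(1) by (simp add: q1 relabel_def f(3))
    show "x1 j = var (?\<pi> j) * Z (j div 2)" if "j div 2 \<noteq> m' div 2"
      using that j x m m' by (auto simp: x1_def)
  qed (use x m m' Z in \<open>auto simp: x1_def\<close>)
  have t: "tau k s = (relabel ?\<pi>' dP3_quiver, x1(m' := exchange m' (q1, x1)))"
    unfolding tau_def comp_def mutate_def m(3)[symmetric] m_def[symmetric] m'_def[symmetric] s
    by (simp add: q1_def[symmetric] x1_def[symmetric] q2)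
  have flip: "?\<pi>' i = (if i div 2 = d then sigma (?\<pi> i) else ?\<pi> i)" if "i < 6" for i
    using that sigma_pair[of i] by (auto simp: pair_perm_def)
  have "(x1(m' := exchange m' (q1, x1))) i = var (?\<pi>' i) * (Z(d := ?z)) (i div 2)" if i: "i < 6" for i
  proof (cases "i div 2 = d")
    case True
    then have "i = m \<or> i = m'"
      using m(1,2) i unfolding m'_def less_6_cases by (elim disjE; simp add: sigma_simps)
    then show ?thesis using flip[OF i] True e e' m' by (auto simp: x1_def)
  next
    case False
    then show ?thesis using flip[OF i] x[OF i] m m' by (auto simp: x1_def)
  qed
  then show ?thesis unfolding t seed_inv_def by simp
qed

section \<open>Unit triangles of the lattice and their flips\<close>

definition apex :: "nat \<Rightarrow> int \<times> int" where
  "apex c = [(0, 0), (1, 0), (0, 1)] ! c"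

definition hat_exp :: "nat \<Rightarrow> int \<Rightarrow> int \<Rightarrow> int" where
  "hat_exp c x y = eis_norm (x - fst (apex c)) (y - snd (apex c)) div 3"

lemma lattice_val_hat_exp: "lattice_val var x y = (\<Prod>c<3. hat_of c powi hat_exp c x y)"
proof -
  have "{..<3 :: nat} = {0, 1, 2}" by auto
  then show ?thesis by (simp add: lattice_val_def hat_of_def hat_exp_def apex_def)
qed

lemma eis_norm_minus: "eis_norm (- x) (- y) = eis_norm x y"
  by (simp add: eis_norm_def)

lemma hat_exp_mod:
  assumes "c < 3"
  shows "3 * hat_exp c x y = eis_norm (x - fst (apex c)) (y - snd (apex c)) - (if (x - y) mod 3 = int c then 0 else 1)"
proof -
  have "c = 0 \<or> c = 1 \<or> c = 2" using assms by linarith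
  then have "(x - fst (apex c) - (y - snd (apex c))) mod 3 = 0 \<longleftrightarrow> (x - y) mod 3 = int c"
    by (elim disjE; simp add: apex_def; presburger)
  then show ?thesis unfolding hat_exp_def eis_norm_div3 by simp
qed

text \<open>Unit triangles of the lattice, for the metric given by \<open>eis_norm\<close>; \<open>(x - y) mod 3\<close> is the usual 3-colouring.\<close>
definition triangle :: "(nat \<Rightarrow> int \<times> int) \<Rightarrow> bool" where
  "triangle P \<longleftrightarrow> (\<forall>d<3. (fst (P d) - snd (P d)) mod 3 = int d) \<and>
     (\<forall>d<3. \<forall>e<3. d \<noteq> e \<longrightarrow> eis_norm (fst (P d) - fst (P e)) (snd (P d) - snd (P e)) = 1)"

definition flip :: "nat \<Rightarrow> (nat \<Rightarrow> int \<times> int) \<Rightarrow> int \<times> int" where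
  "flip d P = (case neighbours d of (e, f) \<Rightarrow>
     (fst (P e) + fst (P f) - fst (P d), snd (P e) + snd (P f) - snd (P d)))"

lemma less_3_cases: "k < 3 \<longleftrightarrow> k = 0 \<or> k = 1 \<or> k = (2 :: nat)"
  by auto

lemma neighboursE:
  assumes "d < 3"
  obtains e f where "neighbours d = (e, f)" "e < 3" "f < 3" "e \<noteq> d" "f \<noteq> d" "e \<noteq> f" "\<forall>c<3. c = d \<or> c = e \<or> c = f"
    "(int e + int f - int d) mod 3 = int d"
proof -
  consider "d = 0" | "d = 1" | "d = 2" using assms by linarith
  then show thesis
  proof cases
    case 1 show thesis by (rule that[of 1 2]) (use 1 in \<open>auto simp: neighbours_def\<close>)
  next
    case 2 show thesis by (rule that[of 0 2]) (use 2 in \<open>auto simp: neighbours_def\<close>)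
  next
    case 3 show thesis by (rule that[of 0 1]) (use 3 in \<open>auto simp: neighbours_def\<close>)
  qed
qed

lemma mod3_add_diff: "(a + b - c) mod 3 = (a mod 3 + b mod 3 - c mod 3) mod (3 :: int)"
  by presburger

text \<open>The parallelogram law: for a rhombus made of two unit triangles, the norms at the
  flipped corner and its image exceed those at the other two corners by \<open>1\<close> in total.
  After rounding, the remainders modulo \<open>3\<close> cancel this excess, except for
  \<open>c = d\<close>, where they raise it to \<open>3\<close> and produce the extra ratio.\<close>

lemma hat_exp_flip:
  assumes P: "triangle P" and d: "d < 3" and c: "c < 3"
  shows "hat_exp c (fst (P d)) (snd (P d)) + hat_exp c (fst (flip d P)) (snd (flip d P)) =
    hat_exp c (fst (P (fst (neighbours d)))) (snd (P (fst (neighbours d)))) +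
    hat_exp c (fst (P (snd (neighbours d)))) (snd (P (snd (neighbours d)))) + (if c = d then 1 else 0)"
proof -
  obtain e f where ef: "neighbours d = (e, f)" "e < 3" "f < 3" "e \<noteq> d" "f \<noteq> d" "e \<noteq> f" "\<forall>c<3. c = d \<or> c = e \<or> c = f"
      "(int e + int f - int d) mod 3 = int d"
    by (rule neighboursE[OF d])
  obtain x y where Pd: "P d = (x, y)" by (cases "P d")
  obtain x1 y1 where Pe: "P e = (x1, y1)" by (cases "P e")
  obtain x2 y2 where Pf: "P f = (x2, y2)" by (cases "P f")
  let ?u = "x1 + x2 - x" and ?v = "y1 + y2 - y"
  obtain s t where st: "apex c = (s, t)" by (cases "apex c")
  have n0: "eis_norm (fst (P i) - fst (P j)) (snd (P i) - snd (P j)) = 1" if "i < 3" "j < 3" "i \<noteq> j" for i j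
    using P that by (simp add: triangle_def)
  have n: "eis_norm (x1 - x) (y1 - y) = 1" "eis_norm (x2 - x) (y2 - y) = 1" "eis_norm (x1 - x2) (y1 - y2) = 1"
    using n0[OF ef(2) d ef(4)] n0[OF ef(3) d ef(5)] n0[OF ef(2,3,6)] by (simp_all add: Pd Pe Pf)
  have col0: "(fst (P i) - snd (P i)) mod 3 = int i" if "i < 3" for i using P that by (simp add: triangle_def)
  have col: "(x - y) mod 3 = int d" "(x1 - y1) mod 3 = int e" "(x2 - y2) mod 3 = int f"
    using col0[OF d] col0[OF ef(2)] col0[OF ef(3)] by (simp_all add: Pd Pe Pf)
  have colu: "(?u - ?v) mod 3 = int d"
  proof -
    have "?u - ?v = (x1 - y1) + (x2 - y2) - (x - y)" by simp
    then have "(?u - ?v) mod 3 = ((x1 - y1) mod 3 + (x2 - y2) mod 3 - (x - y) mod 3) mod 3"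
      by (metis mod3_add_diff)
    then show ?thesis using ef(8) unfolding col by simp
  qed
  have sum: "eis_norm (x - s) (y - t) + eis_norm (?u - s) (?v - t) = eis_norm (x1 - s) (y1 - t) + eis_norm (x2 - s) (y2 - t) + 1"
    using n unfolding eis_norm_def by (simp add: algebra_simps)
  have "3 * (hat_exp c x y + hat_exp c ?u ?v) = 3 * (hat_exp c x1 y1 + hat_exp c x2 y2 + (if c = d then 1 else 0))"
    using hat_exp_mod[OF c, of x y] hat_exp_mod[OF c, of ?u ?v] hat_exp_mod[OF c, of x1 y1] hat_exp_mod[OF c, of x2 y2] sum ef(4-6) ef(7)[rule_format, OF c]
    unfolding col colu st fst_conv snd_conv by auto
  then show ?thesis by (simp add: ef(1) flip_def Pd Pe Pf)
qed

text \<open>The new corner minus one neighbour equals the other neighbour minus the old corner, so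
  distances stay \<open>1\<close>. Its colour is that of the old corner because the three colours
  sum to \<open>0\<close> modulo \<open>3\<close>.\<close>

lemma triangle_flip:
  assumes P: "triangle P" and d: "d < 3"
  shows "triangle (P(d := flip d P))"
proof -
  obtain e f where ef: "neighbours d = (e, f)" "e < 3" "f < 3" "e \<noteq> d" "f \<noteq> d" "e \<noteq> f" "\<forall>c<3. c = d \<or> c = e \<or> c = f"
      "(int e + int f - int d) mod 3 = int d"
    by (rule neighboursE[OF d])
  let ?P = "P(d := flip d P)"
  have fl: "flip d P = (fst (P e) + fst (P f) - fst (P d), snd (P e) + snd (P f) - snd (P d))"
    by (simp add: flip_def ef(1))
  have col: "(fst (P c) - snd (P c)) mod 3 = int c" if "c < 3" for c using P that by (simp add: triangle_def)
  have n: "eis_norm (fst (P b) - fst (P c)) (snd (P b) - snd (P c)) = 1" if "b < 3" "c < 3" "b \<noteq> c" for b c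
    using P that by (simp add: triangle_def)
  have "(fst (flip d P) - snd (flip d P)) mod 3 = int d"
  proof -
    have "fst (flip d P) - snd (flip d P) = (fst (P e) - snd (P e)) + (fst (P f) - snd (P f)) - (fst (P d) - snd (P d))"
      by (simp add: fl)
    then have "(fst (flip d P) - snd (flip d P)) mod 3 =
        ((fst (P e) - snd (P e)) mod 3 + (fst (P f) - snd (P f)) mod 3 - (fst (P d) - snd (P d)) mod 3) mod 3"
      by (metis mod3_add_diff)
    then show ?thesis using ef(8) unfolding col[OF d] col[OF ef(2)] col[OF ef(3)] by simp
  qed
  then have 1: "(fst (?P c) - snd (?P c)) mod 3 = int c" if "c < 3" for c using col[OF that] by auto
  have new: "eis_norm (fst (flip d P) - fst (P c)) (snd (flip d P) - snd (P c)) = 1" if "c < 3" "c \<noteq> d" for c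
  proof -
    have "c = e \<or> c = f" using ef(7)[rule_format, OF that(1)] that(2) by blast
    then show ?thesis using n[OF ef(2) d ef(4)] n[OF ef(3) d ef(5)] by (auto simp: fl)
  qed
  have new': "eis_norm (fst (P c) - fst (flip d P)) (snd (P c) - snd (flip d P)) = 1" if "c < 3" "c \<noteq> d" for c
    using new[OF that] eis_norm_minus[of "fst (flip d P) - fst (P c)" "snd (flip d P) - snd (P c)"] by simp
  have "eis_norm (fst (?P b) - fst (?P c)) (snd (?P b) - snd (?P c)) = 1" if "b < 3" "c < 3" "b \<noteq> c" for b c
    using n[OF that] new[of c] new'[of b] that by auto
  then show ?thesis using 1 unfolding triangle_def by blast
qed

lemma hat_of_nonzero: "c < 3 \<Longrightarrow> hat_of c \<noteq> 0"
  using nondegenD[OF nondegen_var] unfolding less_3_cases by (elim disjE) (simp_all add: hat_of_def)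

lemma lattice_val_var_nonzero: "lattice_val var x y \<noteq> 0"
  using nondegenD[OF nondegen_var] by (simp add: lattice_val_def power_int_eq_0_iff)

lemma lattice_val_flip:
  assumes "triangle P" "d < 3"
  shows "lattice_val var (fst (flip d P)) (snd (flip d P)) =
    lattice_val var (fst (P (fst (neighbours d)))) (snd (P (fst (neighbours d)))) *
    lattice_val var (fst (P (snd (neighbours d)))) (snd (P (snd (neighbours d)))) * hat_of d / lattice_val var (fst (P d)) (snd (P d))"
proof -
  let ?F = "\<lambda>p. lattice_val var (fst p) (snd p)" and ?n = "\<lambda>c p. hat_exp c (fst p) (snd p)"
  let ?E = "P (fst (neighbours d))" and ?G = "P (snd (neighbours d))"
  have "?F (P d) * ?F (flip d P) = (\<Prod>c<3. hat_of c powi (?n c (P d) + ?n c (flip d P)))"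
    unfolding lattice_val_hat_exp prod.distrib[symmetric]
    by (rule prod.cong) (simp_all add: hat_of_nonzero power_int_add)
  also have "\<dots> = (\<Prod>c<3. hat_of c powi ?n c ?E * hat_of c powi ?n c ?G * (if c = d then hat_of c else 1))"
    by (rule prod.cong) (auto simp: hat_exp_flip[OF assms] hat_of_nonzero power_int_add)
  also have "\<dots> = ?F ?E * ?F ?G * hat_of d"
    using assms(2) unfolding lattice_val_hat_exp by (simp add: prod.distrib prod.delta)
  finally show ?thesis using lattice_val_var_nonzero by (simp add: field_simps)
qed

lemma tau_seed_lattice:
  assumes "\<And>k. k \<ge> 1 \<Longrightarrow> a k \<in> {1, 2, 3}"
  shows "\<exists>p P. triangle P \<and> seed_inv p (\<lambda>d. lattice_val var (fst (P d)) (snd (P d))) (tau_seed a n)"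
proof (induction n)
  case 0
  have "triangle apex" unfolding triangle_def less_3_cases by (auto simp: apex_def eis_norm_def)
  \<comment> \<open>Distances within the initial triangle are at most one, so all exponents are
    \<open>0 div 3\<close> or \<open>1 div 3\<close>.\<close>
  moreover have "lattice_val var (fst (apex d)) (snd (apex d)) = 1" if "d < 3" for d
    using that unfolding less_3_cases by (elim disjE) (simp_all add: apex_def lattice_val_def eis_norm_def)
  then have "seed_inv (\<lambda>_. False) (\<lambda>d. lattice_val var (fst (apex d)) (snd (apex d))) (tau_seed a 0)"
    by (simp add: seed_inv_def relabel_def pair_perm_def)
  ultimately show ?case by blast
next
  case (Suc n)
  then obtain p P where P: "triangle P" and s: "seed_inv p (\<lambda>d. lattice_val var (fst (P d)) (snd (P d))) (tau_seed a n)" by blast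
  let ?k = "a (Suc n)"
  let ?d = "?k - 1"
  have k: "?k \<in> {1, 2, 3}" using assms by simp
  then have d: "?d < 3" by auto
  let ?Z = "\<lambda>d. lattice_val var (fst (P d)) (snd (P d))"
  have t: "seed_inv (p(?d := \<not> p ?d)) (?Z(?d := ?Z (fst (neighbours ?d)) * ?Z (snd (neighbours ?d)) * hat_of ?d / ?Z ?d)) (tau ?k (tau_seed a n))"
    by (rule tau_seed_inv[OF s k]) (rule lattice_val_var_nonzero)
  have e: "?Z(?d := ?Z (fst (neighbours ?d)) * ?Z (snd (neighbours ?d)) * hat_of ?d / ?Z ?d) =
      (\<lambda>c. lattice_val var (fst ((P(?d := flip ?d P)) c)) (snd ((P(?d := flip ?d P)) c)))"
    unfolding lattice_val_flip[OF P d, symmetric] by (rule ext) (simp add: fun_upd_def)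
  show ?case
    unfolding tau_seed.simps
    by (rule exI[of _ "p(?d := \<not> p ?d)"], rule exI[of _ "P(?d := flip ?d P)"], rule conjI[OF triangle_flip[OF P d] t[unfolded e]])
qed

theorem mainTheorem1:
  fixes a :: "nat \<Rightarrow> nat" and n :: nat
  assumes "\<And>k. k \<ge> 1 \<Longrightarrow> a k \<in> {1, 2, 3}"
    and "n \<ge> 1"
  shows "\<exists>G. finite G \<and> G \<subseteq> tiling_vertices \<and> 
    tau_y a n = graph_c G \<and> tau_y' a n = graph_c (rot ` G)"
proof -
  obtain p P where P: "triangle P" and s: "seed_inv p (\<lambda>d. lattice_val var (fst (P d)) (snd (P d))) (tau_seed a n)"
    using tau_seed_lattice[where a = a, OF assms(1)] by blast
  define d where "d = a n - 1"
  have k: "a n \<in> {1, 2, 3}" using assms by blast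
  then have d: "d < 3" "a n = d + 1" by (auto simp: d_def)
  \<comment> \<open>The label of the indeterminate in front of \<open>tau_y a n\<close>; the odd
    vertex of the same pair carries \<open>sigma l\<close> with the same factor.\<close>
  define l where "l = pair_perm p (2 * d)"
  have l: "l < 6" "l div 2 = d" "pair_perm p (2 * d + 1) = sigma l"
  proof -
    have "2 * d < 6" "sigma (2 * d) = 2 * d + 1" using d(1) unfolding less_3_cases by (auto simp: sigma_simps)
    then show "l < 6" "l div 2 = d" "pair_perm p (2 * d + 1) = sigma l"
      using pair_perm_sigma[of "2 * d" p] by (simp_all add: l_def pair_perm)
  qed
  let ?x = "fst (P d)" and ?y = "snd (P d)"
  have y: "tau_y a n = var l * lattice_val var ?x ?y" "tau_y' a n = var (sigma l) * lattice_val var ?x ?y"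
    using s d l(3) unfolding seed_inv_def tau_y_def tau_y'_def by (simp_all add: l_def)
  have "int (l div 2) = (?x - ?y) mod 3" using P d(1) l(2) by (simp add: triangle_def)
  from graph_c_realised[OF nondegen_var l(1) this]
  obtain V where "finite V" "graph_c (point_of ` V) = var l * lattice_val var ?x ?y" "graph_c (rot ` point_of ` V) = var (sigma l) * lattice_val var ?x ?y"
    by blast
  then show ?thesis using y point_of_vertices by (intro exI[of _ "point_of ` V"]) auto
qed

end
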